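(* Let $k\ge2$, and let $S_n$ be the number of blocks of a uniformly random $k$-Stirling permutation of order $n$. Then \[ \mathbb{P}\{S_n=m\}=\sum_{\ell=0}^{m}\binom{m}{\ell}(-1)^{\ell}\frac{\binom{n-\frac{\ell}{k}-1}{n}}{\binom{n+\frac1k-1}{n}},\qquad 1\le m\le n, \] and for $r=1,2,\dots$, \[ \mathbb{E}\binom{S_n+r}{r}=\frac{\binom{n-1+\frac{r+1}{k}}{n}}{\binom{n-1+\frac1k}{n}}=(r+1)\frac{\binom{n-1+\frac{r+1}{k}}{n-1}}{\binom{n-1+\frac1k}{n-1}}. \] When the permutations are grown by the random insertion process described in the context, the random variable $\mathcal{S}_n:=\frac{\binom{n-1+\frac1k}{n-1}}{\binom{n-1+\frac2k}{n-1}}(S_n+1)$ is a positive martingale and converges almost surely to a limit $\hat\zeta$, and \[ n^{-1/k}S_n\xrightarrow{a.s.}\zeta:=\frac{\Gamma(1+\frac1k)}{\Gamma(1+\frac2k)}\hat\zeta . \] The limit satisfies $\mathbb{E}(\zeta^r)=(r+1)!\,\frac{\Gamma(1+\frac1k)}{\Gamma(1+\frac{r+1}{k})}$ for all integers $r\ge0$ (and these moments determine its distribution). Further, $\zeta$ has a density $f(x)=\Gamma(\frac1k)x^{-k}g(x^{-k})$, $x>0$, where $g$ is the density of the positive $\frac1k$-stable distribution with Laplace transform $e^{-\lambda^{1/k}}$; explicitly \[ f(x)=\frac{\Gamma(\frac1k)}{\pi}\sum_{j=1}^{\infty}(-1)^{j-1}\frac{\Gamma(\frac jk+1)\sin\frac{j\pi}{k}}{j!}\,x^{j},\qquad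 x>0. \]
   Context: A $k$-Stirling permutation of order $n$ is a word $a_1\cdots a_{kn}$ in which each of $1,\dots,n$ occurs exactly $k$ times, such that for each $i$ every entry between two occurrences of $i$ is at least $i$. A block is a substring $a_p\cdots a_q$ ($p\le q$) with $a_p=a_q$ not contained in any strictly larger substring $a_{p'}\cdots a_{q'}$ with $a_{p'}=a_{q'}$. Growth process: start with $1^k=1\cdots1$; given a $k$-Stirling permutation of order $n$, obtain one of order $n+1$ by inserting the string $(n+1)^k$ into one of its $kn+1$ gaps (before the first entry, between two consecutive entries, or after the last) chosen uniformly at random; the resulting permutation of order $n$ is uniform, and the martingale is with respect to the filtration generated by this process. Binomial coefficients with real upper argument are $\binom{x}{n}=x(x-1)\cdots(x-n+1)/n!$. *)

theory Defs
  imports "HOL-Probability.Probability"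
begin

section \<open>Stirling permutations and their blocks\<close>

definition stirling_perms :: "nat \<Rightarrow> nat \<Rightarrow> nat list set" where
  "stirling_perms k n =
     {w. set w \<subseteq> {1..n} \<and> (\<forall>i\<in>{1..n}. count_list w i = k) \<and>
         (\<forall>p q r. p < q \<and> q < r \<and> r < length w \<and> w ! p = w ! r \<longrightarrow> w ! p \<le> w ! q)}"

text \<open>A block is identified with the pair of positions (counted from 0) of its first and its
  last entry.\<close>

definition blocks :: "nat list \<Rightarrow> (nat \<times> nat) set" where
  "blocks w =
     {(p, q). p \<le> q \<and> q < length w \<and> w ! p = w ! q \<and>
        \<not> (\<exists>p' q'. p' \<le> p \<and> q \<le> q' \<and> (p', q') \<noteq> (p, q) \<and> q' < length w \<and> w ! p' = w ! q')}"

definition num_blocks :: "nat list \<Rightarrow> nat" where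
  "num_blocks w = card (blocks w)"

section \<open>The growth process\<close>

text \<open>Gap \<open>g\<close> of a word is the place preceded by exactly \<open>g\<close> entries.\<close>

definition insert_at_gap :: "nat \<Rightarrow> 'b list \<Rightarrow> 'b list \<Rightarrow> 'b list" where
  "insert_at_gap g u w = take g w @ u @ drop g w"

text \<open>\<open>gap n\<close> is the gap used in passing from order \<open>n\<close> to order \<open>n + 1\<close>. The process starts at
  order 1, so neither \<open>gap 0\<close> nor \<open>W 0\<close> is constrained. The value of \<open>gap n\<close> is in \<open>{0..k * n}\<close>
  only almost surely; outside this event \<open>insert_at_gap\<close> appends at the end.\<close>

locale stirling_growth = prob_space M
  for M :: "'a measure" and k :: nat and gap :: "nat \<Rightarrow> 'a \<Rightarrow> nat" and W :: "nat \<Rightarrow> 'a \<Rightarrow> nat list" +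
  assumes gap_indep: "indep_vars (\<lambda>_. count_space UNIV) gap {1..}"
    and gap_uniform:
      "\<And>n. n \<ge> 1 \<Longrightarrow> distr M (count_space UNIV) (gap n) = measure_pmf (pmf_of_set {0..k * n})"
    and W_start: "\<And>\<omega>. \<omega> \<in> space M \<Longrightarrow> W 1 \<omega> = replicate k 1"
    and W_step: "\<And>n \<omega>. n \<ge> 1 \<Longrightarrow> \<omega> \<in> space M \<Longrightarrow>
      W (Suc n) \<omega> = insert_at_gap (gap n \<omega>) (replicate k (Suc n)) (W n \<omega>)"

definition generated_filtration :: "'a measure \<Rightarrow> (nat \<Rightarrow> 'a \<Rightarrow> 'b) \<Rightarrow> nat \<Rightarrow> 'a measure" where
  "generated_filtration M W n = sigma (space M) {W i -` A \<inter> space M |i A. 1 \<le> i \<and> i \<le> n}"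

definition martingale_from ::
    "nat \<Rightarrow> 'a measure \<Rightarrow> (nat \<Rightarrow> 'a measure) \<Rightarrow> (nat \<Rightarrow> 'a \<Rightarrow> real) \<Rightarrow> bool" where
  "martingale_from t0 M F X \<longleftrightarrow>
     filtration (space M) F \<and>
     (\<forall>n\<ge>t0. subalgebra M (F n) \<and> X n \<in> borel_measurable (F n) \<and> integrable M (X n)) \<and>
     (\<forall>i\<ge>t0. \<forall>j\<ge>i. AE \<omega> in M. real_cond_exp M (F i) (X j) \<omega> = X i \<omega>)"

text \<open>Growth processes exist for every \<open>k\<close>.\<close>

lemma stirling_growth_exists:
  "\<exists>(M :: (nat \<Rightarrow> nat) measure) gap W. stirling_growth M k gap W"
proof -
  define N where "N = (\<lambda>n. measure_pmf (pmf_of_set {0..k * n}))"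
  define M where "M = PiM UNIV N"
  define W :: "nat \<Rightarrow> (nat \<Rightarrow> nat) \<Rightarrow> nat list" where
    "W = (\<lambda>n \<omega>. rec_nat [] (\<lambda>m w. insert_at_gap (\<omega> m) (replicate k (Suc m)) w) n)"
  have N: "prob_space (N n)" for n
    by (simp add: N_def measure_pmf.prob_space_axioms)
  interpret M: prob_space M
    unfolding M_def by (rule prob_space_PiM) (rule N)
  have comp: "distr M (N n) (\<lambda>\<omega>. \<omega> n) = N n" for n
    unfolding M_def by (rule distr_PiM_component) (auto intro: N)
  have cs: "distr M (count_space UNIV) (\<lambda>\<omega>. \<omega> n) = N n" for n
    using comp[of n] by (subst distr_cong[OF refl, of _ "N n"]) (auto simp: N_def)
  have meas: "(\<lambda>\<omega>. \<omega> n) \<in> measurable M (N n)" for n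
    unfolding M_def by simp
  have "M.indep_vars N (\<lambda>n \<omega>. \<omega> n) UNIV"
  proof (subst M.indep_vars_iff_distr_eq_PiM)
    have "distr M (PiM UNIV N) (\<lambda>x. \<lambda>i\<in>UNIV. x i) = M"
      unfolding M_def by (simp add: restrict_UNIV)
    then show "distr M (PiM UNIV N) (\<lambda>x. \<lambda>i\<in>UNIV. x i) =
        PiM UNIV (\<lambda>i. distr M (N i) (\<lambda>\<omega>. \<omega> i))"
      unfolding comp by (simp add: M_def)
  qed (use meas in auto)
  then have "M.indep_vars (\<lambda>_. count_space UNIV) (\<lambda>n \<omega>. \<omega> n) UNIV"
    unfolding M.indep_vars_def
    by (simp add: N_def measurable_cong_sets[OF refl, of "measure_pmf _" "count_space UNIV"])
  then have ind: "M.indep_vars (\<lambda>_. count_space UNIV) (\<lambda>n \<omega>. \<omega> n) {1..}"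
    by (rule M.indep_vars_subset) simp
  have "stirling_growth M k (\<lambda>n \<omega>. \<omega> n) W"
  proof
    show "M.indep_vars (\<lambda>_. count_space UNIV) (\<lambda>n \<omega>. \<omega> n) {1..}" by (rule ind)
    show "distr M (count_space UNIV) (\<lambda>\<omega>. \<omega> n) = measure_pmf (pmf_of_set {0..k * n})" for n
      using cs[of n] by (simp add: N_def)
  qed (auto simp: W_def insert_at_gap_def)
  then show ?thesis by blast
qed

section \<open>Positive stable distributions\<close>

text \<open>Strict stability of index \<open>\<alpha>\<close>: if \<open>X\<close> and \<open>Y\<close> are independent copies, then \<open>a X + b Y\<close> has
  the law of \<open>(a\<^sup>\<alpha> + b\<^sup>\<alpha>)\<^bsup>1/\<alpha>\<^esup> X\<close>.\<close>

definition stable_law :: "real \<Rightarrow> real measure \<Rightarrow> bool" where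
  "stable_law \<alpha> \<mu> \<longleftrightarrow> real_distribution \<mu> \<and>
     (\<forall>a>0. \<forall>b>0. distr (\<mu> \<Otimes>\<^sub>M \<mu>) borel (\<lambda>(x, y). a * x + b * y) =
        distr \<mu> borel (\<lambda>x. (a powr \<alpha> + b powr \<alpha>) powr (1 / \<alpha>) * x))"

definition positive_stable_density :: "real \<Rightarrow> (real \<Rightarrow> real) \<Rightarrow> bool" where
  "positive_stable_density \<alpha> g \<longleftrightarrow>
     g \<in> borel_measurable borel \<and> (\<forall>x. 0 \<le> g x) \<and>
     (let \<mu> = density lborel (\<lambda>x. ennreal (g x)) in
        stable_law \<alpha> \<mu> \<and> (AE x in \<mu>. 0 < x) \<and>
        (\<forall>t\<ge>0. (\<integral>x. exp (- t * x) \<partial>\<mu>) = exp (- (t powr \<alpha>))))"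

end

theory Submission
  imports Defs
begin

text \<open>Inserting \<open>(n + 1)\<^sup>k\<close> into a gap creates a new block exactly if no pair of equal letters
  straddles the gap, and there are \<open>S\<^sub>n + 1\<close> such gaps. Hence \<open>S\<^sub>n\<close> is a Markov chain with jump
  probability \<open>(S\<^sub>n + 1) / (k n + 1)\<close>, which yields the explicit law, the rising factorial moments and
  the martingale. Its orthogonal increments are summable along \<open>n = j\<^bsup>4k\<^esup>\<close>, and \<open>S\<^sub>n\<close> is monotone, so
  almost sure convergence needs no maximal inequality.

  Summing the explicit law turns the distribution function of \<open>n\<^bsup>-1/k\<^esup> S\<^sub>n\<close> into a series to which
  Tannery's theorem applies. The limit is an entire function whose derivative is the series for
  \<open>f\<close>; so \<open>f\<close> is the density of \<open>\<zeta>\<close>, and in particular it is nonnegative. If \<open>\<Psi>\<close> is the Laplace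
  transform of \<open>g y = f (y\<^bsup>-1/k\<^esup>) / (\<Gamma>(1/k) y)\<close>, then the moments of \<open>\<zeta>\<close> show that \<open>\<Psi> (x\<^sup>k)\<close> has the
  moments \<open>r!\<close> on the half line. Both \<open>\<bar>v\<bar> \<Psi> (v\<^bsup>2k\<^esup>)\<close> and \<open>\<bar>v\<bar> exp (- v\<^sup>2)\<close> are therefore densities with the
  same moments, small enough to determine them, whence \<open>\<Psi> t = exp (- t\<^bsup>1/k\<^esup>)\<close>. Strict stability
  follows because the moments of \<open>exp (- X)\<close> determine the law of a positive \<open>X\<close>.\<close>

section \<open>Insertions and blocks\<close>

text \<open>The density \<open>g\<close> has infinite mean, so its own moments cannot identify it.
  On the half line the density \<Psi>(x^k) has the moments \<open>r!\<close>, too large for the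
  Taylor criterion of \<open>real_distribution_moments_unique\<close>, whose error at degree r would
  be of order t^r. Putting x = v^2 and symmetrising makes \<open>r!\<close> the moment of order 2r,
  and r!/(2r)! decays faster than every geometric sequence. This explains the exponent 2k and the
  factor |v|. No stable law is assumed to exist; \<open>g\<close> is built from the limit of the
  block counts. The moments of \<open>f\<close> are read off \<zeta>, because a series in positive
  powers of x cannot be integrated termwise over the half line. In the series for the distribution
  function the index l runs up to order n^(1/k), so the bounds on the terms must be uniform in n.
  The weight of index l grows about like (l/k)^(l/k), which for k \<ge> 2 is at most of the order of
  a geometric factor times sqrt(l!). The exponent 4k arises as follows: martingale increments after
  time n have mean square of order n^(-1/k), so along j^(4k) their absolute means are of order
  j^(-2).\<close>

lemma stirling_permsD:
  assumes "w \<in> stirling_perms k n"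
  shows "set w \<subseteq> {1..n}" "\<And>i. i \<in> {1..n} \<Longrightarrow> count_list w i = k"
    "\<And>p q r. p < q \<Longrightarrow> q < r \<Longrightarrow> r < length w \<Longrightarrow> w ! p = w ! r \<Longrightarrow> w ! p \<le> w ! q"
  using assms unfolding stirling_perms_def by auto

lemma length_stirling_perm:
  assumes "w \<in> stirling_perms k n"
  shows "length w = k * n"
proof -
  have "length w = (\<Sum>i\<in>set w. count_list w i)"
    by (simp add: sum_count_set[symmetric])
  also have "\<dots> = (\<Sum>i\<in>{1..n}. count_list w i)"
    using stirling_permsD(1)[OF assms] by (intro sum.mono_neutral_left) (auto simp: count_list_0_iff)
  also have "\<dots> = k * n"
    using stirling_permsD(2)[OF assms] by simp
  finally show ?thesis .
qed

lemma finite_stirling_perms: "finite (stirling_perms k n)"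
proof (rule finite_subset)
  show "stirling_perms k n \<subseteq> {w. set w \<subseteq> {1..n} \<and> length w = k * n}"
    using stirling_permsD(1) length_stirling_perm by blast
qed (simp add: finite_lists_length_eq)

lemma length_insert_at_gap [simp]: "length (insert_at_gap g u w) = length u + length w"
  by (simp add: insert_at_gap_def)

lemma nth_insert_replicate:
  assumes "g \<le> length w" "p < length w + k"
  shows "insert_at_gap g (replicate k N) w ! p =
    (if p < g then w ! p else if p < g + k then N else w ! (p - k))"
  using assms by (auto simp: insert_at_gap_def nth_append min_def)

lemma count_list_insert_at_gap:
  "count_list (insert_at_gap g u w) i = count_list u i + count_list w i"
proof -
  have "count_list w i = count_list (take g w @ drop g w) i" by simp
  then show ?thesis unfolding insert_at_gap_def count_list_append by linarith
qed

lemma set_insert_at_gap: "set (insert_at_gap g u w) = set u \<union> set w"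
proof -
  have "set w = set (take g w @ drop g w)" by simp
  then show ?thesis unfolding insert_at_gap_def set_append by blast
qed

lemma count_list_replicate: "count_list (replicate k x) y = (if x = y then k else 0)"
  by (induction k) auto

text \<open>The new letter exceeds all others, so it may stand between any two equal letters, and
  its own copies are adjacent.\<close>

lemma insert_at_gap_in_stirling_perms:
  assumes w: "w \<in> stirling_perms k n" and g: "g \<le> length w"
  shows "insert_at_gap g (replicate k (Suc n)) w \<in> stirling_perms k (Suc n)" (is "?v \<in> _")
proof -
  note D = stirling_permsD[OF w]
  have nth_le: "w ! p \<le> n" if "p < length w" for p
    using D(1) nth_mem[OF that] by auto
  have 1: "set ?v \<subseteq> {1..Suc n}"
    using D(1) by (auto simp: set_insert_at_gap)
  have N: "count_list w (Suc n) = 0"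
    using D(1) by (auto simp: count_list_0_iff)
  have 2: "count_list ?v i = k" if "i \<in> {1..Suc n}" for i
    using D(2)[of i] N that by (cases "i = Suc n") (auto simp: count_list_insert_at_gap count_list_replicate)
  have 3: "?v ! p \<le> ?v ! q" if pqr: "p < q" "q < r" "r < length ?v" "?v ! p = ?v ! r" for p q r
  proof -
    have v: "?v ! s = (if s < g then w ! s else if s < g + k then Suc n else w ! (s - k))"
      if "s \<le> r" for s
      using that pqr by (intro nth_insert_replicate g) auto
    \<comment> \<open>\<open>?d\<close> reads a position outside the inserted run back in
      \<open>w\<close>; it preserves the order of such positions.\<close>
    let ?d = "\<lambda>s. if s < g then s else s - k"
    have *: "?v ! s = w ! ?d s \<and> ?d s < length w" if "s \<le> r" "s < g \<or> g + k \<le> s" for s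
      using that pqr g by (auto simp: v)
    have inside: "?v ! s = Suc n" if "s \<le> r" "g \<le> s" "s < g + k" for s
      using that by (auto simp: v)
    show ?thesis
    proof (cases "q < g \<or> g + k \<le> q")
      case False
      then have "?v ! q = Suc n" using pqr by (intro inside) auto
      moreover have "?v ! p \<le> Suc n"
        using 1 pqr nth_mem[of p ?v] by (auto simp del: nth_mem)
      ultimately show ?thesis by simp
    next
      case q: True
      show ?thesis
      proof (cases "(p < g \<or> g + k \<le> p) \<and> (r < g \<or> g + k \<le> r)")
        case True
        then have "?d p < ?d q" "?d q < ?d r" "?d r < length w"
          using q pqr g by auto
        moreover have "w ! ?d p = w ! ?d r"
          using *[of p] *[of r] True pqr by simp
        ultimately have "w ! ?d p \<le> w ! ?d q" by (rule D(3))
        then show ?thesis using *[of p] *[of q] True q pqr by simp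
      next
        \<comment> \<open>One end of the triple lies in the run. Then both do, since
          \<open>w\<close> does not contain the new letter, and a position \<open>q\<close> between
          them cannot be outside.\<close>
        case False
        then have "?v ! p = Suc n \<or> ?v ! r = Suc n"
          using inside[of p] inside[of r] pqr by auto
        then have "?v ! p = Suc n" "?v ! r = Suc n" using pqr(4) by auto
        moreover have "g \<le> s \<and> s < g + k" if "?v ! s = Suc n" "s \<le> r" for s
          using *[of s] nth_le[of "?d s"] that by linarith
        ultimately have "g \<le> p" "r < g + k" using pqr by auto
        then show ?thesis using q pqr by auto
      qed
    qed
  qed
  show ?thesis
    unfolding stirling_perms_def using 1 2 3 by blast
qed

text \<open>Deleting \<open>N\<close> returns the word, and the prefix before the first
  \<open>N\<close> has length \<open>g\<close>. With \<open>k = 0\<close> the gap would leave no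
  trace.\<close>

lemma insert_at_gap_eqD:
  assumes "insert_at_gap g (replicate k N) w = insert_at_gap g' (replicate k N) w'"
    and "N \<notin> set w" "N \<notin> set w'" "g \<le> length w" "g' \<le> length w'" "k \<ge> 1"
  shows "w = w'" "g = g'"
proof -
  have fil: "filter (\<lambda>x. x \<noteq> N) (insert_at_gap g (replicate k N) w) = w"
    if "N \<notin> set w" for w g
  proof -
    have "filter (\<lambda>x. x \<noteq> N) (insert_at_gap g (replicate k N) w) =
        filter (\<lambda>x. x \<noteq> N) (take g w @ drop g w)"
      unfolding insert_at_gap_def filter_append by simp
    then show ?thesis using that by (auto simp: filter_id_conv)
  qed
  show "w = w'" using fil[of w g] fil[of w' g'] assms by simp
  have tw: "length (takeWhile (\<lambda>x. x \<noteq> N) (insert_at_gap g (replicate k N) w)) = g"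
    if "N \<notin> set w" "g \<le> length w" for w g
  proof -
    obtain j where j: "k = Suc j" using assms(6) by (cases k) auto
    have "\<And>x. x \<in> set (take g w) \<Longrightarrow> x \<noteq> N" using that by (auto dest: in_set_takeD)
    then have "takeWhile (\<lambda>x. x \<noteq> N) (insert_at_gap g (replicate k N) w) = take g w"
      unfolding insert_at_gap_def j by (subst takeWhile_append2) auto
    then show ?thesis using that by simp
  qed
  show "g = g'" using tw[of w g] tw[of w' g'] assms by simp
qed

text \<open>A letter between two copies of the maximum must be at least the maximum, so these copies
  form one run; removing the run gives \<open>w\<close>.\<close>

lemma stirling_perm_Suc_obtain:
  assumes v: "v \<in> stirling_perms k (Suc n)" and k: "k \<ge> 1"
  obtains w g where "w \<in> stirling_perms k n" "g \<le> length w"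
    "v = insert_at_gap g (replicate k (Suc n)) w"
proof -
  note D = stirling_permsD[OF v]
  define t where "t = takeWhile (\<lambda>x. x \<noteq> Suc n) v"
  define u where "u = dropWhile (\<lambda>x. x \<noteq> Suc n) v"
  define b where "b = takeWhile (\<lambda>x. x = Suc n) u"
  define s where "s = dropWhile (\<lambda>x. x = Suc n) u"
  have vt: "v = t @ b @ s" by (simp add: t_def u_def b_def s_def)
  have nt: "Suc n \<notin> set t" unfolding t_def by (auto dest: set_takeWhileD)
  have b: "b = replicate (length b) (Suc n)"
    unfolding b_def by (metis (full_types) replicate_length_same set_takeWhileD)
  have "Suc n \<in> set v" using D(2)[of "Suc n"] k by (intro ccontr[of "_ \<in> _"]) (auto simp: count_list_0_iff[symmetric])
  then have une: "u \<noteq> []" unfolding u_def by (auto simp: dropWhile_eq_Nil_conv)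
  then have hu: "hd u = Suc n" unfolding u_def using hd_dropWhile[of "\<lambda>x. x \<noteq> Suc n" v] by auto
  then have bne: "b \<noteq> []" unfolding b_def using une by (cases u) auto
  have ns: "Suc n \<notin> set s"
  proof
    assume "Suc n \<in> set s"
    then obtain j where j: "j < length s" "s ! j = Suc n" by (auto simp: in_set_conv_nth)
    then have sne: "s \<noteq> []" by auto
    then have hs: "hd s \<noteq> Suc n" unfolding s_def using hd_dropWhile by blast
    then have s0: "s ! 0 \<noteq> Suc n" using sne by (simp add: hd_conv_nth)
    then have j0: "0 < j" using j by (cases j) auto
    have l1: "v ! length t = Suc n"
      by (subst vt, subst b) (use bne in \<open>simp add: nth_append\<close>)
    have l2: "v ! (length t + length b + j) = Suc n"
      using j by (simp add: vt nth_append)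
    have l3: "v ! (length t + length b) = s ! 0"
      using j by (simp add: vt nth_append)
    \<comment> \<open>First copy, first letter after the run, later copy: this triple violates the
      Stirling condition.\<close>
    have "v ! length t \<le> v ! (length t + length b)"
    proof (rule D(3))
      show "length t < length t + length b" using bne by auto
      show "length t + length b < length t + length b + j" using j0 by auto
      show "length t + length b + j < length v" using j by (simp add: vt)
      show "v ! length t = v ! (length t + length b + j)" using l1 l2 by simp
    qed
    moreover have "s ! 0 \<le> Suc n" using D(1) sne nth_mem[of 0 s] by (auto simp: vt simp del: nth_mem)
    ultimately show False using l1 l3 s0 by simp
  qed
  have "count_list v (Suc n) = length b"
    using nt ns arg_cong[OF b, of "\<lambda>x. count_list x (Suc n)"]
    by (simp add: vt count_list_replicate count_list_0_iff)
  then have lb: "length b = k" using D(2)[of "Suc n"] by simp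
  define w where "w = t @ s"
  have vw: "v = insert_at_gap (length t) (replicate k (Suc n)) w"
    using b lb by (simp add: insert_at_gap_def w_def vt)
  have g: "length t \<le> length w" by (simp add: w_def)
  have "w \<in> stirling_perms k n"
    unfolding stirling_perms_def mem_Collect_eq
  proof (intro conjI ballI allI impI)
    show "set w \<subseteq> {1..n}"
    proof
      fix x assume "x \<in> set w"
      then have "x \<in> set v" "x \<noteq> Suc n" using nt ns by (auto simp: w_def vt)
      then show "x \<in> {1..n}" using D(1) by (auto simp: subset_iff le_Suc_eq)
    qed
    show "count_list w i = k" if "i \<in> {1..n}" for i
      using D(2)[of i] that unfolding vw count_list_insert_at_gap by (simp add: count_list_replicate)
  next
    fix p q r assume a: "p < q \<and> q < r \<and> r < length w \<and> w ! p = w ! r"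
    let ?e = "\<lambda>s. if s < length t then s else s + k"
    have e: "v ! ?e s = w ! s" if "s < length w" for s
      using that g by (auto simp: vw nth_insert_replicate)
    have "v ! ?e p \<le> v ! ?e q"
      using a e[of p] e[of r] by (intro D(3)[of _ _ "?e r"]) (auto simp: vw)
    then show "w ! p \<le> w ! q" using a e by auto
  qed
  then show thesis using that g vw by blast
qed

text \<open>This is why uniform gaps produce a uniform permutation at every order; it also yields
  the recursion for the cardinality.\<close>

lemma bij_betw_insert_at_gap:
  assumes k: "k \<ge> 1"
  shows "bij_betw (\<lambda>(w, g). insert_at_gap g (replicate k (Suc n)) w)
    (stirling_perms k n \<times> {0..k * n}) (stirling_perms k (Suc n))"
  unfolding bij_betw_def
proof (intro conjI inj_onI equalityI subsetI)
  fix x y assume xy: "x \<in> stirling_perms k n \<times> {0..k * n}" "y \<in> stirling_perms k n \<times> {0..k * n}"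
    "(case x of (w, g) \<Rightarrow> insert_at_gap g (replicate k (Suc n)) w) =
     (case y of (w, g) \<Rightarrow> insert_at_gap g (replicate k (Suc n)) w)"
  obtain w g w' g' where "x = (w, g)" "y = (w', g')" by (cases x, cases y) auto
  moreover have "Suc n \<notin> set w" "Suc n \<notin> set w'" "g \<le> length w" "g' \<le> length w'"
    using xy calculation stirling_permsD(1)[of w k n] stirling_permsD(1)[of w' k n]
      length_stirling_perm[of w k n] length_stirling_perm[of w' k n] by auto
  ultimately show "x = y"
    using insert_at_gap_eqD[of g k "Suc n" w g' w'] xy k by auto
next
  fix v assume "v \<in> (\<lambda>(w, g). insert_at_gap g (replicate k (Suc n)) w) ` (stirling_perms k n \<times> {0..k * n})"
  then show "v \<in> stirling_perms k (Suc n)"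
    using insert_at_gap_in_stirling_perms length_stirling_perm by fastforce
next
  fix v assume "v \<in> stirling_perms k (Suc n)"
  then obtain w g where "w \<in> stirling_perms k n" "g \<le> length w"
    "v = insert_at_gap g (replicate k (Suc n)) w"
    using stirling_perm_Suc_obtain k by blast
  then show "v \<in> (\<lambda>(w, g). insert_at_gap g (replicate k (Suc n)) w) ` (stirling_perms k n \<times> {0..k * n})"
    by (auto simp: length_stirling_perm intro!: image_eqI[of _ _ "(w, g)"])
qed

section \<open>Which insertions create a block\<close>

definition good_gaps :: "nat list \<Rightarrow> nat set" where
  "good_gaps w = {g. g \<le> length w \<and> \<not> (\<exists>p q. p < g \<and> g \<le> q \<and> q < length w \<and> w ! p = w ! q)}"

lemma finite_blocks: "finite (blocks w)"
  by (rule finite_subset[of _ "{..<length w} \<times> {..<length w}"]) (auto simp: blocks_def)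

text \<open>A pair of equal letters in the new word comes from such a pair of \<open>w\<close> or
  lies inside the run. Old blocks stay maximal, since no pair inside the run contains them; the run
  is maximal exactly when no old pair straddles the gap.\<close>

lemma num_blocks_insert:
  assumes N: "N \<notin> set w" and g: "g \<le> length w" and k: "k \<ge> 1"
  shows "num_blocks (insert_at_gap g (replicate k N) w) =
    num_blocks w + (if g \<in> good_gaps w then 1 else 0)"
proof -
  let ?v = "insert_at_gap g (replicate k N) w"
  \<comment> \<open>\<open>e\<close> sends a position of \<open>w\<close> to its place after the
    insertion; it is strictly increasing and misses the run.\<close>
  define e where "e = (\<lambda>s. if s < g then s else s + k)"
  have e_less: "e s < e t \<longleftrightarrow> s < t" and e_le: "e s \<le> e t \<longleftrightarrow> s \<le> t" for s t
    by (auto simp: e_def)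
  have e_eq: "e s = e t \<longleftrightarrow> s = t" for s t by (auto simp: e_def)
  have e_nth: "?v ! e s = w ! s" "e s < length ?v" "w ! s \<noteq> N" if "s < length w" for s
    using that g N nth_mem[of s w] by (auto simp: e_def nth_insert_replicate)
  have e_ran: "e s < g \<or> g + k \<le> e s" for s by (auto simp: e_def)
  have cov: "(\<exists>t < length w. s = e t) \<or> (g \<le> s \<and> s < g + k \<and> ?v ! s = N)" if "s < length ?v" for s
  proof (cases "g \<le> s \<and> s < g + k")
    case True then show ?thesis using that g by (auto simp: nth_insert_replicate)
  next
    case False
    then have "s = e (if s < g then s else s - k)" "(if s < g then s else s - k) < length w"
      using that g by (auto simp: e_def)
    then show ?thesis by blast
  qed
  have pair: "(\<exists>p q. p' = e p \<and> q' = e q \<and> p \<le> q \<and> q < length w \<and> w ! p = w ! q) \<or> (g \<le> p' \<and> q' < g + k)"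
    if "p' \<le> q'" "q' < length ?v" "?v ! p' = ?v ! q'" for p' q'
  proof -
    have "p' < length ?v" using that by simp
    from cov[OF this] cov[OF that(2)] show ?thesis
    proof (elim disjE exE conjE)
      fix t t' assume "t < length w" "p' = e t" "t' < length w" "q' = e t'"
      then show ?thesis using that e_nth[of t] e_nth[of t'] e_le[of t t'] by auto
    next
      fix t assume "t < length w" "p' = e t" "?v ! q' = N"
      then show ?thesis using that e_nth[of t] by auto
    next
      fix t assume "t < length w" "q' = e t" "?v ! p' = N"
      then show ?thesis using that e_nth[of t] by auto
    qed auto
  qed
  let ?B = "(\<lambda>(p, q). (e p, e q)) ` blocks w"
  let ?X = "if g \<in> good_gaps w then {(g, g + k - 1)} else {}"
  have new: "?v ! p = N" if "g \<le> p" "p < g + k" for p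
    using that g by (auto simp: nth_insert_replicate)
  have old: "(e p, e q) \<in> blocks ?v" if pq: "(p, q) \<in> blocks w" for p q
  proof -
    have b: "p \<le> q" "q < length w" "w ! p = w ! q"
      "\<And>p' q'. p' \<le> p \<Longrightarrow> q \<le> q' \<Longrightarrow> q' < length w \<Longrightarrow> w ! p' = w ! q' \<Longrightarrow> (p', q') = (p, q)"
      using pq unfolding blocks_def by auto
    have False if m: "p' \<le> e p" "e q \<le> q'" "(p', q') \<noteq> (e p, e q)" "q' < length ?v" "?v ! p' = ?v ! q'" for p' q'
    proof -
      have le: "p' \<le> q'" using m b e_le[of p q] by linarith
      from pair[OF le m(4,5)] show False
      proof (elim disjE exE conjE)
        fix p1 q1 assume "p' = e p1" "q' = e q1" "q1 < length w" "w ! p1 = w ! q1"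
        then show False using b(4)[of p1 q1] m by (auto simp: e_le)
      next
        assume "g \<le> p'" "q' < g + k"
        then show False using e_ran[of p] m le e_le[of p q] b(1) by auto
      qed
    qed
    then show ?thesis unfolding blocks_def using b e_nth[of p] e_nth[of q] by (auto simp: e_le)
  qed
  have "blocks ?v = ?B \<union> ?X"
  proof (intro equalityI subsetI)
    fix z assume z: "z \<in> blocks ?v"
    obtain p' q' where zz: "z = (p', q')" by (cases z)
    have b: "p' \<le> q'" "q' < length ?v" "?v ! p' = ?v ! q'"
      "\<And>p q. p \<le> p' \<Longrightarrow> q' \<le> q \<Longrightarrow> q < length ?v \<Longrightarrow> ?v ! p = ?v ! q \<Longrightarrow> (p, q) = (p', q')"
      using z zz unfolding blocks_def by auto
    from pair[OF b(1-3)] show "z \<in> ?B \<union> ?X"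
    proof (elim disjE exE conjE)
      fix p q assume pq: "p' = e p" "q' = e q" "p \<le> q" "q < length w" "w ! p = w ! q"
      have "(p, q) \<in> blocks w"
        unfolding blocks_def
      proof (clarsimp simp: pq)
        fix p1 q1 assume h: "p1 \<le> p" "p1 = p \<longrightarrow> q1 \<noteq> q" "q \<le> q1" "q1 < length w" "w ! p1 = w ! q1"
        have "(e p1, e q1) = (p', q')"
          using h pq e_nth[of p1] e_nth[of q1] by (intro b(4)) (auto simp: e_le)
        then show False using h pq by (auto simp: e_eq)
      qed
      then show ?thesis using zz pq by auto
    next
      assume in': "g \<le> p'" "q' < g + k"
      \<comment> \<open>A block inside the run must be the whole run, and a straddling pair of
        \<open>w\<close> would properly contain it.\<close>
      have "(g, g + k - 1) = (p', q')"
        using in' k g new by (intro b(4)) auto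
      moreover have "g \<in> good_gaps w"
      proof (rule ccontr)
        assume "g \<notin> good_gaps w"
        then obtain p q where pq: "p < g" "g \<le> q" "q < length w" "w ! p = w ! q"
          using g by (auto simp: good_gaps_def)
        have "(e p, e q) = (p', q')"
          using pq in' e_nth[of p] e_nth[of q] by (intro b(4)) (auto simp: e_def)
        then show False using pq in' by (auto simp: e_def)
      qed
      ultimately show ?thesis using zz by auto
    qed
  next
    fix z assume "z \<in> ?B \<union> ?X"
    then show "z \<in> blocks ?v"
    proof
      assume "z \<in> ?B" then show ?thesis using old by auto
    next
      assume "z \<in> ?X"
      then have zz: "z = (g, g + k - 1)" and gg: "g \<in> good_gaps w" by (auto split: if_splits)
      have False if m: "p' \<le> g" "g + k - 1 \<le> q'" "(p', q') \<noteq> (g, g + k - 1)" "q' < length ?v" "?v ! p' = ?v ! q'" for p' q'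
      proof -
        have le: "p' \<le> q'" using m k by linarith
        from pair[OF le m(4,5)] show False
        proof (elim disjE exE conjE)
          fix p1 q1 assume h: "p' = e p1" "q' = e q1" "q1 < length w" "w ! p1 = w ! q1"
          then have "p1 < g" "g \<le> q1"
            using m k by (auto simp: e_def split: if_splits)
          then show False using gg h unfolding good_gaps_def by blast
        next
          assume "g \<le> p'" "q' < g + k"
          then show False using m k by auto
        qed
      qed
      then show ?thesis unfolding zz blocks_def using k g new by auto
    qed
  qed
  moreover have "card ?B = card (blocks w)"
    by (intro card_image) (auto simp: inj_on_def e_eq)
  moreover have "(g, g + k - 1) \<notin> ?B"
  proof
    assume "(g, g + k - 1) \<in> ?B"
    then obtain p where "g = e p" by auto
    then show False using e_ran[of p] k by auto
  qed
  ultimately show ?thesis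
    using finite_blocks[of w] by (auto simp: num_blocks_def)
qed

text \<open>The blocks cut a Stirling permutation into consecutive segments. Their first positions
  are therefore the good gaps other than the last gap, which is always good.\<close>

lemma card_good_gaps:
  assumes w: "w \<in> stirling_perms k n"
  shows "card (good_gaps w) = num_blocks w + 1"
proof -
  let ?L = "length w"
  note S = stirling_permsD(3)[OF w]
  have maxl: "(p', q') = (p, q)" if "(p, q) \<in> blocks w" "p' \<le> p" "q \<le> q'" "q' < ?L" "w ! p' = w ! q'" for p q p' q'
    using that unfolding blocks_def by auto
  have "bij_betw fst (blocks w) (good_gaps w - {?L})"
    unfolding bij_betw_def
  proof (intro conjI inj_onI equalityI subsetI)
    fix x y assume xy: "x \<in> blocks w" "y \<in> blocks w" "fst x = fst y"
    obtain p q q' where "x = (p, q)" "y = (p, q')" using xy by (cases x, cases y) auto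
    moreover have "q < ?L" "q' < ?L" "w ! p = w ! q" "w ! p = w ! q'"
      using xy calculation unfolding blocks_def by auto
    ultimately show "x = y"
      using maxl[of p q p q'] maxl[of p q' p q] xy by (cases "q \<le> q'") auto
  next
    fix p assume "p \<in> fst ` blocks w"
    then obtain q where b: "(p, q) \<in> blocks w" by auto
    then have pq: "p \<le> q" "q < ?L" "w ! p = w ! q" unfolding blocks_def by auto
    have False if h: "p' < p" "p \<le> q'" "q' < ?L" "w ! p' = w ! q'" for p' q'
    proof (cases "q \<le> q'")
      case True
      then show False using maxl[OF b, of p' q'] h by auto
    next
      case False
      \<comment> \<open>The pairs (p', q') and (p, q) overlap. The Stirling condition at
        \<open>p\<close> and at \<open>q'\<close> makes their letters agree, and then (p', q)
        extends the block.\<close>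
      have "w ! p' = w ! p"
      proof (cases "p = q'")
        case False
        have "w ! p' \<le> w ! p" using S[of p' p q'] h False by auto
        moreover have "w ! p \<le> w ! q'" using S[of p q' q] h False \<open>\<not> q \<le> q'\<close> pq by auto
        ultimately show ?thesis using h by simp
      qed (use h in simp)
      then show False using maxl[OF b, of p' q] h pq by auto
    qed
    then show "p \<in> good_gaps w - {?L}" unfolding good_gaps_def using pq by auto
  next
    fix g assume g: "g \<in> good_gaps w - {?L}"
    then have gL: "g < ?L" and gg: "\<And>p q. p < g \<Longrightarrow> g \<le> q \<Longrightarrow> q < ?L \<Longrightarrow> w ! p \<noteq> w ! q"
      unfolding good_gaps_def by auto
    \<comment> \<open>No letter standing at or after \<open>g\<close> also stands before
      \<open>g\<close>, so the last occurrence of the letter at \<open>g\<close> closes a block that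
      begins at \<open>g\<close>.\<close>
    define q where "q = Max {j. j < ?L \<and> w ! j = w ! g}"
    have fin: "finite {j. j < ?L \<and> w ! j = w ! g}" by auto
    have "q \<in> {j. j < ?L \<and> w ! j = w ! g}" unfolding q_def using fin gL by (intro Max_in) auto
    then have q: "q < ?L" "w ! q = w ! g" by auto
    have qm: "j \<le> q" if "j < ?L" "w ! j = w ! g" for j using that fin unfolding q_def by (intro Max_ge) auto
    have "g \<le> q" using qm gL by auto
    moreover have False if "p' \<le> g" "q \<le> q'" "(p', q') \<noteq> (g, q)" "q' < ?L" "w ! p' = w ! q'" for p' q'
      using that gg[of p' q'] qm[of q'] calculation by (cases "p' = g") auto
    ultimately have "(g, q) \<in> blocks w" unfolding blocks_def using q by auto
    then show "g \<in> fst ` blocks w" by force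
  qed
  then have "card (good_gaps w - {?L}) = num_blocks w"
    unfolding num_blocks_def by (metis bij_betw_same_card)
  moreover have "?L \<in> good_gaps w" "finite (good_gaps w)" by (auto simp: good_gaps_def)
  ultimately show ?thesis by (metis Suc_eq_plus1 card.remove)
qed

lemma stirling_perms_0: "stirling_perms k 0 = {[]}"
  by (auto simp: stirling_perms_def)

lemma num_blocks_Nil: "num_blocks [] = 0"
  by (simp add: num_blocks_def blocks_def)

lemma stirling_perms_nonempty:
  assumes "k \<ge> 1"
  shows "stirling_perms k n \<noteq> {}"
proof (induction n)
  case (Suc n)
  then show ?case
    using bij_betw_insert_at_gap[OF assms, of n] by (auto simp: bij_betw_def)
qed (simp add: stirling_perms_0)

lemma good_gaps_le: "w \<in> stirling_perms k n \<Longrightarrow> good_gaps w \<subseteq> {0..k * n}"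
  by (auto simp: good_gaps_def length_stirling_perm)

lemma num_blocks_le:
  assumes "w \<in> stirling_perms k n"
  shows "num_blocks w \<le> k * n"
  using card_mono[OF _ good_gaps_le[OF assms]] card_good_gaps[OF assms] by simp

section \<open>The law of the number of blocks\<close>

lemma sum_stirling_perms_Suc:
  fixes h :: "nat list \<Rightarrow> 'c::comm_monoid_add"
  assumes k: "k \<ge> 1"
  shows "(\<Sum>v\<in>stirling_perms k (Suc n). h v) =
    (\<Sum>w\<in>stirling_perms k n. \<Sum>g\<in>{0..k * n}. h (insert_at_gap g (replicate k (Suc n)) w))"
  by (simp add: sum.cartesian_product sum.reindex_bij_betw[OF bij_betw_insert_at_gap[OF k], symmetric] split_def)

lemma card_stirling_perms_Suc:
  assumes k: "k \<ge> 1"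
  shows "card (stirling_perms k (Suc n)) = card (stirling_perms k n) * (k * n + 1)"
  using bij_betw_same_card[OF bij_betw_insert_at_gap[OF k, of n]]
  by (simp add: card_cartesian_product)

lemma num_blocks_insert_stirling:
  assumes "w \<in> stirling_perms k n" "g \<in> {0..k * n}" "k \<ge> 1"
  shows "num_blocks (insert_at_gap g (replicate k (Suc n)) w) =
    num_blocks w + (if g \<in> good_gaps w then 1 else 0)"
  using assms stirling_permsD(1)[OF assms(1)] length_stirling_perm[OF assms(1)]
  by (intro num_blocks_insert) auto

text \<open>One step of the Markov chain against a test function: \<open>num_blocks w + 1\<close> of
  the gaps raise the count and the others keep it.\<close>

lemma sum_gaps_num_blocks:
  fixes \<phi> :: "nat \<Rightarrow> real"
  assumes w: "w \<in> stirling_perms k n" and k: "k \<ge> 1"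
  shows "(\<Sum>g\<in>{0..k * n}. \<phi> (num_blocks (insert_at_gap g (replicate k (Suc n)) w))) =
    (real (num_blocks w) + 1) * \<phi> (num_blocks w + 1) + (real (k * n) - real (num_blocks w)) * \<phi> (num_blocks w)"
proof -
  let ?S = "num_blocks w"
  have fin: "finite (good_gaps w)" and sub: "good_gaps w \<subseteq> {0..k * n}"
    using good_gaps_le[OF w] finite_subset by auto
  have "(\<Sum>g\<in>{0..k * n}. \<phi> (num_blocks (insert_at_gap g (replicate k (Suc n)) w))) =
      (\<Sum>g\<in>{0..k * n}. if g \<in> good_gaps w then \<phi> (?S + 1) else \<phi> ?S)"
    using num_blocks_insert_stirling[OF w _ k] by (intro sum.cong) auto
  also have "\<dots> = real (card (good_gaps w)) * \<phi> (?S + 1) + real (card ({0..k * n} - good_gaps w)) * \<phi> ?S"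
    using sub by (simp add: sum.If_cases Int_absorb1 Diff_eq)
  also have "card ({0..k * n} - good_gaps w) = k * n - ?S"
    using card_good_gaps[OF w] card_Diff_subset[OF fin sub] by simp
  also have "real (k * n - ?S) = real (k * n) - real ?S"
    using num_blocks_le[OF w] by simp
  finally show ?thesis using card_good_gaps[OF w] by simp
qed

text \<open>Expectations are kept as finite averages, so that the recursion in \<open>n\<close> is
  plain summation; it can start from the empty word of order 0.\<close>

definition block_mean :: "nat \<Rightarrow> nat \<Rightarrow> (nat \<Rightarrow> real) \<Rightarrow> real" where
  "block_mean k n \<phi> = (\<Sum>w\<in>stirling_perms k n. \<phi> (num_blocks w)) / real (card (stirling_perms k n))"

lemma expectation_num_blocks:
  assumes "k \<ge> 1"
  shows "measure_pmf.expectation (pmf_of_set (stirling_perms k n)) (\<lambda>w. \<phi> (num_blocks w)) = block_mean k n \<phi>"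
  unfolding block_mean_def
  by (rule integral_pmf_of_set[OF stirling_perms_nonempty[OF assms] finite_stirling_perms])

lemma block_mean_0: "block_mean k 0 \<phi> = \<phi> 0"
  by (simp add: block_mean_def stirling_perms_0 num_blocks_Nil)

lemma block_mean_Suc:
  assumes k: "k \<ge> 1"
  shows "block_mean k (Suc n) \<phi> =
    block_mean k n (\<lambda>s. (real s + 1) * \<phi> (s + 1) + (real (k * n) - real s) * \<phi> s) / real (k * n + 1)"
proof -
  have "(\<Sum>w\<in>stirling_perms k (Suc n). \<phi> (num_blocks w)) =
      (\<Sum>w\<in>stirling_perms k n. (real (num_blocks w) + 1) * \<phi> (num_blocks w + 1)
         + (real (k * n) - real (num_blocks w)) * \<phi> (num_blocks w))"
    unfolding sum_stirling_perms_Suc[OF k] by (intro sum.cong refl sum_gaps_num_blocks k)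
  then show ?thesis
    by (simp only: block_mean_def card_stirling_perms_Suc[OF k] of_nat_mult divide_divide_eq_left)
qed

lemma block_mean_cmult: "block_mean k n (\<lambda>s. c * \<phi> s) = c * block_mean k n \<phi>"
  by (simp add: block_mean_def sum_distrib_left[symmetric])

lemma block_mean_add: "block_mean k n (\<lambda>s. \<phi> s + \<psi> s) = block_mean k n \<phi> + block_mean k n \<psi>"
  by (simp add: block_mean_def sum.distrib add_divide_distrib)

definition block_prob :: "nat \<Rightarrow> nat \<Rightarrow> nat \<Rightarrow> real" where
  "block_prob k n m = block_mean k n (\<lambda>s. of_bool (s = m))"

text \<open>The forward equation of the chain, from the indicator of \<open>m\<close> as test
  function. The case \<open>m = 0\<close> is separate because \<open>m - 1\<close> is
  truncated.\<close>

lemma block_prob_Suc: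
  assumes k: "k \<ge> 1"
  shows "real (k * n + 1) * block_prob k (Suc n) m =
    (if m = 0 then 0 else real m * block_prob k n (m - 1)) + (real (k * n) - real m) * block_prob k n m"
proof -
  have pos: "real (k * n + 1) \<noteq> 0" by linarith
  have "(\<lambda>s. (real s + 1) * of_bool (s + 1 = m) + (real (k * n) - real s) * of_bool (s = m)) =
    (\<lambda>s. (if m = 0 then 0 else real m) * of_bool (s = m - 1) + (real (k * n) - real m) * of_bool (s = m))"
    by (intro ext) auto
  then have "real (k * n + 1) * block_prob k (Suc n) m =
      block_mean k n (\<lambda>s. (if m = 0 then 0 else real m) * of_bool (s = m - 1) + (real (k * n) - real m) * of_bool (s = m))"
    unfolding block_prob_def block_mean_Suc[OF k] by (simp only: times_divide_eq_right nonzero_mult_div_cancel_left[OF pos])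
  then show ?thesis
    by (simp add: block_mean_add block_mean_cmult block_prob_def)
qed

section \<open>The explicit law\<close>

definition block_weight :: "nat \<Rightarrow> nat \<Rightarrow> nat \<Rightarrow> real" where
  "block_weight k n l = pochhammer (- (real l / real k)) n / pochhammer (1 / real k) n"

text \<open>\<open>block_weight\<close> is the quotient of binomial coefficients in the theorem
  after cancelling n!. Its recursion is the forward equation without the gain term, with
  \<open>l\<close> in place of \<open>m\<close>.\<close>

lemma block_weight_Suc:
  assumes k: "k \<ge> 1"
  shows "real (k * n + 1) * block_weight k (Suc n) l = (real (k * n) - real l) * block_weight k n l"
proof -
  have "real k * (1 / real k + real n) = real (k * n + 1)"
    using k by (simp add: field_simps)
  moreover have "pochhammer (1 / real k) n > 0" "1 / real k + real n > 0"
    using k by (auto intro!: pochhammer_pos add_pos_nonneg)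
  moreover have "real (k * n) - real l = real k * (- (real l / real k) + real n)"
    using k by (simp add: field_simps)
  moreover have "block_weight k (Suc n) l * (1 / real k + real n) = block_weight k n l * (- (real l / real k) + real n)"
    unfolding block_weight_def pochhammer_Suc using calculation(2,3) by simp
  ultimately show ?thesis
    by (metis mult.assoc mult.commute)
qed

text \<open>Binomial inversion diagonalises the forward equation. Since m choose(m - 1, l) = (m - l)
  choose(m, l), gain and loss combine to (m - l) + (k n - m) = k n - l, the multiplier of
  \<open>block_weight\<close>.\<close>

lemma block_prob_eq:
  assumes k: "k \<ge> 1"
  shows "block_prob k n m = (\<Sum>l=0..m. real (m choose l) * (- 1) ^ l * block_weight k n l)"
proof (induction n arbitrary: m)
  case 0
  have "(\<Sum>l=0..m. real (m choose l) * (- 1) ^ l) = of_bool (m = 0)"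
    using choose_alternating_sum[of m, where ?'a = real]
    by (cases "m = 0") (simp_all add: atLeast0AtMost mult.commute)
  then show ?case by (simp add: block_prob_def block_mean_0 block_weight_def)
next
  case (Suc n)
  let ?c = "\<lambda>m l. real (m choose l) * (- 1) ^ l * block_weight k n l"
  have pos: "real (k * n + 1) \<noteq> 0" by linarith
  have *: "(if m = 0 then 0 else real m * (\<Sum>l=0..m - 1. ?c (m - 1) l)) =
      (\<Sum>l=0..m. (real m - real l) * ?c m l)"
  proof (cases m)
    case (Suc j)
    have "(\<Sum>l=0..m. (real m - real l) * ?c m l) = (\<Sum>l=0..j. (real m - real l) * ?c m l)"
      by (simp add: Suc)
    also have "\<dots> = (\<Sum>l=0..j. real m * ?c j l)"
    proof (intro sum.cong refl)
      fix l assume "l \<in> {0..j}"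
      then have "(m - l) * (m choose l) = m * (j choose l)"
        using binomial_absorb_comp[of m l] by (simp add: Suc)
      then have "(real m - real l) * real (m choose l) = real m * real (j choose l)"
        using \<open>l \<in> {0..j}\<close> by (metis Suc atLeastAtMost_iff le_SucI of_nat_diff of_nat_mult)
      then show "(real m - real l) * ?c m l = real m * ?c j l"
        by (metis mult.assoc)
    qed
    finally show ?thesis using Suc by (simp add: sum_distrib_left)
  qed simp
  have "real (k * n + 1) * block_prob k (Suc n) m =
      (\<Sum>l=0..m. (real m - real l) * ?c m l) + (real (k * n) - real m) * (\<Sum>l=0..m. ?c m l)"
    unfolding block_prob_Suc[OF k] Suc.IH * by simp
  also have "\<dots> = (\<Sum>l=0..m. real (m choose l) * (- 1) ^ l * ((real (k * n) - real l) * block_weight k n l))"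
    unfolding sum_distrib_left sum.distrib[symmetric] by (intro sum.cong) (auto simp: algebra_simps)
  also have "\<dots> = real (k * n + 1) * (\<Sum>l=0..m. real (m choose l) * (- 1) ^ l * block_weight k (Suc n) l)"
    unfolding block_weight_Suc[OF k, symmetric] sum_distrib_left by (intro sum.cong) (auto simp: algebra_simps)
  finally show ?case using pos by (simp only: mult_cancel_left simp_thms)
qed

section \<open>Rising factorial moments\<close>

definition block_moment :: "nat \<Rightarrow> nat \<Rightarrow> nat \<Rightarrow> real" where
  "block_moment k n r = pochhammer ((real r + 1) / real k) n / pochhammer (1 / real k) n"

lemma block_moment_Suc:
  assumes k: "k \<ge> 1"
  shows "block_moment k (Suc n) r = block_moment k n r * (1 + real r / real (k * n + 1))"
proof -
  have "1 / real k + real n = real (k * n + 1) / real k" "(real r + 1) / real k + real n = (real (k * n + 1) + real r) / real k"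
    using k by (auto simp: field_simps)
  then have "((real r + 1) / real k + real n) / (1 / real k + real n) = (real (k * n + 1) + real r) / real (k * n + 1)"
    using k by (simp only:) simp
  also have "\<dots> = 1 + real r / real (k * n + 1)" 
    unfolding add_divide_distrib by (subst divide_self) linarith+
  finally show ?thesis
    by (simp add: block_moment_def pochhammer_Suc times_divide_times_eq[symmetric] del: of_nat_add of_nat_Suc)
qed

text \<open>The binomial coefficient is an eigenfunction of the one-step operator: (s + 1) choose(s
  + 1 + r, r) = (s + 1 + r) choose(s + r, r). Each step thus multiplies the mean by (k n + 1 + r) /
  (k n + 1).\<close>

lemma block_mean_choose:
  assumes k: "k \<ge> 1"
  shows "block_mean k n (\<lambda>s. real ((s + r) choose r)) = block_moment k n r"
proof (induction n)
  case 0
  show ?case by (simp add: block_mean_0 block_moment_def)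
next
  case (Suc n)
  have pos: "real (k * n + 1) \<noteq> 0" by linarith
  have "(real s + 1) * real ((s + 1 + r) choose r) + (real (k * n) - real s) * real ((s + r) choose r) =
      (real (k * n + 1) + real r) * real ((s + r) choose r)" for s
  proof -
    have "(s + 1) * ((s + 1 + r) choose r) = (s + 1 + r) * ((s + r) choose r)"
      using binomial_absorb_comp[of "s + 1 + r" r] by simp
    then have "(real s + 1) * real ((s + 1 + r) choose r) = (real s + 1 + real r) * real ((s + r) choose r)"
      by (metis of_nat_1 of_nat_add of_nat_mult)
    then show ?thesis by (simp only:) (simp add: algebra_simps)
  qed
  then have "block_mean k (Suc n) (\<lambda>s. real ((s + r) choose r)) =
      (real (k * n + 1) + real r) / real (k * n + 1) * block_moment k n r"
    unfolding block_mean_Suc[OF k] by (simp only: block_mean_cmult Suc) simp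
  then show ?case
    unfolding block_moment_Suc[OF k] using pos by (simp add: add_divide_distrib)
qed

text \<open>The hockey-stick identity sums out \<open>j\<close>. This form of the distribution
  function is the one that is passed to the limit.\<close>

lemma sum_block_prob:
  assumes k: "k \<ge> 1"
  shows "(\<Sum>j\<le>m. block_prob k n j) = (\<Sum>l\<le>m. real (Suc m choose Suc l) * (- 1) ^ l * block_weight k n l)"
proof -
  have "(\<Sum>j\<le>m. block_prob k n j) = (\<Sum>j\<le>m. \<Sum>l\<le>m. real (j choose l) * (- 1) ^ l * block_weight k n l)"
    unfolding block_prob_eq[OF k] atLeast0AtMost
    by (intro sum.cong refl sum.mono_neutral_left) (auto simp: binomial_eq_0)
  also have "\<dots> = (\<Sum>l\<le>m. real (\<Sum>j\<le>m. j choose l) * (- 1) ^ l * block_weight k n l)"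
    by (subst sum.swap) (simp add: sum_distrib_right)
  finally show ?thesis by (simp add: sum_choose_upper[of _ m, unfolded atLeast0AtMost])
qed

lemma gbinomial_shift_pochhammer:
  "(real n - 1 + x) gchoose n = pochhammer x n / fact n"
  by (simp add: gbinomial_pochhammer')

lemma block_weight_gbinomial:
  "((real n - real l / real k - 1) gchoose n) / ((real n + 1 / real k - 1) gchoose n) = block_weight k n l"
  using gbinomial_shift_pochhammer[of n "- (real l / real k)"] gbinomial_shift_pochhammer[of n "1 / real k"]
  by (simp add: block_weight_def algebra_simps)

lemma block_moment_gbinomial:
  "((real n - 1 + real (r + 1) / real k) gchoose n) / ((real n - 1 + 1 / real k) gchoose n) = block_moment k n r"
  unfolding gbinomial_shift_pochhammer by (simp add: block_moment_def add.commute)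

lemma gbinomial_shift_pochhammer':
  assumes "n \<ge> 1"
  shows "x * ((real n - 1 + x) gchoose (n - 1)) = pochhammer x n / fact (n - 1)"
  using assms by (cases n) (auto simp: gbinomial_pochhammer' pochhammer_rec algebra_simps)

text \<open>The factor r + 1 is the quotient of (r + 1)/k and 1/k, the first factors of the two
  Pochhammer symbols.\<close>

lemma block_moment_gbinomial':
  assumes k: "k \<ge> 1" and n: "n \<ge> 1"
  shows "real (r + 1) * (((real n - 1 + real (r + 1) / real k) gchoose (n - 1)) /
                          ((real n - 1 + 1 / real k) gchoose (n - 1))) = block_moment k n r"
proof -
  have "block_moment k n r = ((real (r + 1) / real k) * ((real n - 1 + real (r + 1) / real k) gchoose (n - 1))) /
      ((1 / real k) * ((real n - 1 + 1 / real k) gchoose (n - 1)))"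
    unfolding gbinomial_shift_pochhammer'[OF n] by (simp add: block_moment_def add.commute)
  then show ?thesis using k by simp
qed

section \<open>Moment problems\<close>

text \<open>The Taylor polynomial of degree 2n of the characteristic function depends on the moments
  alone, and its error is at most twice the quantity in \<open>lim\<close>. The degree is even so
  that the absolute moment in the error is itself a moment.\<close>

lemma real_distribution_moments_unique:
  fixes \<mu> \<nu> :: "real measure" and m :: "nat \<Rightarrow> real"
  assumes \<mu>: "real_distribution \<mu>" and \<nu>: "real_distribution \<nu>"
    and m\<mu>: "\<And>r. has_bochner_integral \<mu> (\<lambda>x. x ^ r) (m r)"
    and m\<nu>: "\<And>r. has_bochner_integral \<nu> (\<lambda>x. x ^ r) (m r)"
    and lim: "\<And>t. (\<lambda>n. t ^ (2 * n) * m (2 * n) / fact (2 * n)) \<longlonglongrightarrow> 0"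
  shows "\<mu> = \<nu>"
proof (rule Levy_uniqueness[OF \<mu> \<nu>], rule ext)
  fix t :: real
  define s where "s = (\<lambda>n. \<Sum>j\<le>2 * n. ((\<i> * t) ^ j / fact j) * complex_of_real (m j))"
  have key: "s \<longlonglongrightarrow> char \<rho> t"
    if \<rho>: "real_distribution \<rho>" and m\<rho>: "\<And>r. has_bochner_integral \<rho> (\<lambda>x. x ^ r) (m r)" for \<rho>
  proof -
    interpret real_distribution \<rho> by (rule \<rho>)
    have int: "integrable \<rho> (\<lambda>x. x ^ r)" and eq: "expectation (\<lambda>x. x ^ r) = m r" for r
      using m\<rho>[of r] by (auto simp: has_bochner_integral_iff)
    have "norm (s n - char \<rho> t) \<le> 2 * (t ^ (2 * n) * m (2 * n) / fact (2 * n))" for n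
    proof -
      have "cmod (char \<rho> t - s n) \<le> (2 * \<bar>t\<bar> ^ (2 * n) / fact (2 * n)) * expectation (\<lambda>x. \<bar>x\<bar> ^ (2 * n))"
        using char_approx1[of "2 * n" t, OF int] by (simp only: s_def eq)
      also have "\<dots> = 2 * (t ^ (2 * n) * m (2 * n) / fact (2 * n))"
        using eq[of "2 * n"] by (simp add: power_even_abs)
      finally show ?thesis by (simp only: norm_minus_commute)
    qed
    moreover have "(\<lambda>n. 2 * (t ^ (2 * n) * m (2 * n) / fact (2 * n))) \<longlonglongrightarrow> 0"
      using tendsto_mult_left[OF lim[of t], of 2] by simp
    ultimately have "(\<lambda>n. s n - char \<rho> t) \<longlonglongrightarrow> 0"
      by (intro Lim_null_comparison[of "\<lambda>n. s n - char \<rho> t"] always_eventually allI)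
    then show ?thesis by (simp add: LIM_zero_iff)
  qed
  show "char \<mu> t = char \<nu> t"
    using key[OF \<mu> m\<mu>] key[OF \<nu> m\<nu>] by (rule LIMSEQ_unique)
qed

text \<open>For t \<ge> R the integrand t^x exp(-t) is at least R^x exp(-t). The free parameter R
  lets Gamma beat any prescribed geometric rate.\<close>

lemma Gamma_lower_bound:
  fixes R x :: real
  assumes "R > 0" "x \<ge> 0"
  shows "R powr x * exp (- R) \<le> Gamma (1 + x)"
proof -
  have "((\<lambda>t. R powr x * exp (- (1::real) * t)) has_integral (R powr x * (exp (- 1 * R) / 1))) {R..}"
    by (intro has_integral_mult_right has_integral_exp_minus_to_infinity) simp
  then have 1: "((\<lambda>t. if t \<in> {R..} then R powr x * exp (- t) else 0) has_integral (R powr x * exp (- R))) {0..}"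
    using assms by (subst has_integral_restrict) auto
  have 2: "((\<lambda>t. t powr x / exp t) has_integral Gamma (1 + x)) {0..}"
    using Gamma_integral_real[of "1 + x"] assms by simp
  show ?thesis
  proof (rule has_integral_le[OF 1 2])
    fix t :: real assume "t \<in> {0..}"
    then show "(if t \<in> {R..} then R powr x * exp (- t) else 0) \<le> t powr x / exp t"
      using assms powr_mono2[of x R t] by (auto simp: exp_minus field_simps)
  qed
qed

lemma limit_moments_growth:
  fixes k :: nat and c t :: real
  assumes k: "k \<ge> 1"
  defines "m \<equiv> \<lambda>r::nat. fact (r + 1) * (c / Gamma (1 + real (r + 1) / real k))"
  shows "(\<lambda>r. t ^ r * m r / fact r) \<longlonglongrightarrow> 0"
proof -
  \<comment> \<open>R = b^k turns \<open>R powr ((r + 1) / k)\<close> into b^(r + 1), and b > 2|t|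
    leaves a factor 2^(-r) after division of |t|^r by Gamma.\<close>
  define b where "b = 2 * (\<bar>t\<bar> + 1)"
  define R where "R = b ^ k"
  have b: "b > 0" by (simp add: b_def)
  have R: "R > 0" using b by (simp add: R_def)
  have "norm (t ^ r * m r / fact r) \<le> \<bar>c\<bar> * exp R * (real (r + 1) * (1 / 2) ^ r)" for r
  proof -
    have "R powr (real (r + 1) / real k) = b ^ (r + 1)"
    proof -
      have "R powr (real (r + 1) / real k) = b powr (real k * (real (r + 1) / real k))"
        using b by (simp only: R_def powr_realpow[symmetric] powr_powr)
      also have "real k * (real (r + 1) / real k) = real (r + 1)" using k by simp
      finally show ?thesis using b by (simp only: powr_realpow)
    qed
    then have G: "b ^ (r + 1) * exp (- R) \<le> Gamma (1 + real (r + 1) / real k)"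
      using Gamma_lower_bound[OF R, of "real (r + 1) / real k"] by simp
    have "(2 * \<bar>t\<bar>) ^ r \<le> b ^ r" by (intro power_mono) (auto simp: b_def)
    also have "\<dots> \<le> b ^ r * b" using mult_left_mono[of 1 b "b ^ r"] b by (simp add: b_def)
    finally have "(2 * \<bar>t\<bar>) ^ r * exp (- R) \<le> b ^ (r + 1) * exp (- R)" by (simp add: mult.commute)
    from order_trans[OF this G] have G': "2 ^ r * \<bar>t\<bar> ^ r * exp (- R) \<le> Gamma (1 + real (r + 1) / real k)"
      by (simp only: power_mult_distrib)
    have "0 \<le> real (r + 1) / real k" by simp
    then have "0 < 1 + real (r + 1) / real k" by linarith
    then have Gp: "Gamma (1 + real (r + 1) / real k) > 0"
      by (rule Gamma_real_pos)
    have f: "fact (r + 1) / fact r = (real (r + 1) :: real)"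
      by (simp add: field_simps)
    have "norm (t ^ r * m r / fact r) = \<bar>c\<bar> * (fact (r + 1) / fact r) * (\<bar>t\<bar> ^ r / Gamma (1 + real (r + 1) / real k))"
      using Gp by (simp add: m_def abs_mult power_abs mult_ac del: fact_Suc)
    also have "\<dots> = \<bar>c\<bar> * real (r + 1) * (\<bar>t\<bar> ^ r / Gamma (1 + real (r + 1) / real k))"
      by (simp only: f)
    also have "\<dots> \<le> \<bar>c\<bar> * real (r + 1) * (exp R * (1 / 2) ^ r)"
    proof (rule mult_left_mono)
      have "\<bar>t\<bar> ^ r = (1 / 2) ^ r * exp R * (2 ^ r * \<bar>t\<bar> ^ r * exp (- R))"
      proof -
        have "(1 / 2) ^ r * exp R * (2 ^ r * \<bar>t\<bar> ^ r * exp (- R)) =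
            ((1 / 2) ^ r * 2 ^ r) * (exp R * exp (- R)) * \<bar>t\<bar> ^ r"
          by (simp only: mult_ac)
        then show ?thesis
          by (simp only: power_mult_distrib[symmetric] exp_minus_inverse) simp
      qed
      also have "\<dots> \<le> (1 / 2) ^ r * exp R * Gamma (1 + real (r + 1) / real k)"
        using G' by (intro mult_left_mono) auto
      finally show "\<bar>t\<bar> ^ r / Gamma (1 + real (r + 1) / real k) \<le> exp R * (1 / 2) ^ r"
        unfolding pos_divide_le_eq[OF Gp] by (simp only: mult_ac)
    qed simp
    finally show ?thesis by (simp only: mult_ac)
  qed
  moreover have "(\<lambda>r. \<bar>c\<bar> * exp R * (real (r + 1) * (1 / 2) ^ r)) \<longlonglongrightarrow> 0"
  proof -
    have "(\<lambda>r. real r * (1 / 2) ^ r) \<longlonglongrightarrow> (0::real)"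
      using powser_times_n_limit_0[of "1/2 :: real"] by simp
    moreover have "(\<lambda>r. (1 / 2) ^ r) \<longlonglongrightarrow> (0::real)"
      by (rule LIMSEQ_power_zero) simp
    ultimately have "(\<lambda>r. real r * (1 / 2) ^ r + (1 / 2) ^ r) \<longlonglongrightarrow> (0::real)"
      by (intro tendsto_add_zero)
    then show ?thesis
      using tendsto_mult_left[of "\<lambda>r. real r * (1 / 2) ^ r + (1 / 2) ^ r" 0 sequentially "\<bar>c\<bar> * exp R"]
      by (simp only: of_nat_add of_nat_1 distrib_right mult_1 mult_zero_right)
  qed
  ultimately show ?thesis
    by (intro Lim_null_comparison[of "\<lambda>r. t ^ r * m r / fact r"] always_eventually allI)
qed

section \<open>Asymptotics of the law\<close>

text \<open>The reciprocal \<open>rGamma\<close> is used at \<open>x\<close> because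
  \<open>x\<close> may be a pole of Gamma. This happens for x = -l/k with k dividing l, where the
  limit is 0.\<close>

lemma pochhammer_ratio_tendsto:
  fixes x y :: real
  assumes y: "y > 0"
  shows "(\<lambda>n. pochhammer x n / pochhammer y n * real n powr (y - x)) \<longlonglongrightarrow> rGamma x * Gamma y"
proof -
  have ry: "rGamma y \<noteq> 0" "rGamma y = inverse (Gamma y)"
    using less_imp_neq[OF Gamma_real_pos[OF y]] by (auto simp: rGamma_inverse_Gamma)
  \<comment> \<open>\<open>rGamma_series\<close> contains a Pochhammer symbol of length n + 1; the
    last quotient removes the surplus factors.\<close>
  have 1: "(\<lambda>n. rGamma_series x n / rGamma_series y n * ((y + real n) / (x + real n)))
      \<longlonglongrightarrow> rGamma x / rGamma y * 1"
  proof (intro tendsto_intros)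
    show "(\<lambda>n. (y + real n) / (x + real n)) \<longlonglongrightarrow> 1" by real_asymp
  qed (use ry in auto)
  have 2: "rGamma_series x n / rGamma_series y n * ((y + real n) / (x + real n)) =
      pochhammer x n / pochhammer y n * real n powr (y - x)" if n: "real n > \<bar>x\<bar>" "n > 0" for n
  proof -
    have nz: "x + real n \<noteq> 0" "y + real n \<noteq> 0" "pochhammer y n > 0"
      using n y by (auto intro: pochhammer_pos)
    have rp: "real n powr (y - x) = exp (y * ln (real n)) / exp (x * ln (real n))"
      using n by (simp add: powr_def left_diff_distrib exp_diff)
    show ?thesis
    proof -
      have alg: "(a * c / (F * e1)) / (b * d / (F * e2)) * (d / c) = a / b * (e2 / e1)"
        if "c \<noteq> 0" "d \<noteq> 0" "F \<noteq> 0" "e1 \<noteq> 0" for a b c d e1 e2 F :: real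
        using that by (simp add: field_simps)
      show ?thesis
        unfolding rGamma_series_def Suc_eq_plus1[symmetric] pochhammer_Suc rp of_real_eq_id id_apply
        using nz by (intro alg) auto
    qed
  qed
  have "eventually (\<lambda>n. real n > \<bar>x\<bar>) sequentially" by real_asymp
  then have "eventually (\<lambda>n. rGamma_series x n / rGamma_series y n * ((y + real n) / (x + real n)) =
      pochhammer x n / pochhammer y n * real n powr (y - x)) sequentially"
    using eventually_gt_at_top[of 0] by eventually_elim (use 2 in blast)
  from Lim_transform_eventually[OF 1 this] show ?thesis
    using ry(2) by (simp add: field_simps)
qed

text \<open>A factor with i > \<beta> is at most exp(-\<beta>/i). Among the first floor(\<beta>)
  factors some may exceed 1, but their product does not.\<close>

lemma abs_prod_le_harm:
  fixes \<beta> :: real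
  assumes \<beta>: "0 \<le> \<beta>" and N: "nat \<lfloor>\<beta>\<rfloor> \<le> N"
  shows "(\<Prod>i=1..N. \<bar>real i - \<beta>\<bar> / real i) \<le> exp (\<beta> * (harm (nat \<lfloor>\<beta>\<rfloor>) - harm N))"
  using N
proof (induction N rule: dec_induct)
  case base
  let ?q = "nat \<lfloor>\<beta>\<rfloor>"
  have q: "real ?q \<le> \<beta>" "\<beta> < real ?q + 1" using \<beta> by linarith+
  \<comment> \<open>With q = floor(\<beta>) one has |i - \<beta>| \<le> q + 1 - i, and these bounds
    multiply to q!.\<close>
  have "(\<Prod>i=1..?q. \<bar>real i - \<beta>\<bar>) \<le> (\<Prod>i=1..?q. real (1 + ?q - i))"
  proof (intro prod_mono conjI)
    fix i assume "i \<in> {1..?q}"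
    then have "real i \<le> real ?q" "real (1 + ?q - i) = 1 + real ?q - real i" by (auto simp: of_nat_diff)
    then show "\<bar>real i - \<beta>\<bar> \<le> real (1 + ?q - i)" using q by linarith
  qed simp
  also have "\<dots> = (\<Prod>i=1..?q. real i)"
    using prod.atLeastAtMost_rev[of real 1 ?q] by (simp only: add.commute)
  finally have "(\<Prod>i=1..?q. \<bar>real i - \<beta>\<bar>) / (\<Prod>i=1..?q. real i) \<le> 1"
    by (subst pos_divide_le_eq) (auto intro!: prod_pos)
  then show ?case by (simp add: prod_dividef)
next
  case (step N)
  have "\<beta> < real (Suc N)" using step \<beta> by linarith
  then have "\<bar>real (Suc N) - \<beta>\<bar> / real (Suc N) = 1 + (- \<beta> / real (Suc N))"
    by (simp add: field_simps)
  also have "\<dots> \<le> exp (- \<beta> / real (Suc N))" by (rule exp_ge_add_one_self)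
  finally have "(\<Prod>i=1..N. \<bar>real i - \<beta>\<bar> / real i) * (\<bar>real (Suc N) - \<beta>\<bar> / real (Suc N)) \<le>
      exp (\<beta> * (harm (nat \<lfloor>\<beta>\<rfloor>) - harm N)) * exp (- \<beta> / real (Suc N))"
    using step.IH by (intro mult_mono) (auto intro!: prod_nonneg)
  also have "\<dots> = exp (\<beta> * (harm (nat \<lfloor>\<beta>\<rfloor>) - harm (Suc N)))"
    by (simp add: exp_add[symmetric] harm_Suc field_simps)
  finally show ?case by simp
qed

text \<open>The bound is independent of \<open>n\<close>, as domination in Tannery's theorem
  demands. The first Pochhammer factor gives \<beta>, the others form the product just estimated,
  and harm(n - 1) \<ge> ln n cancels \<open>n powr \<beta>\<close>.\<close>

lemma abs_pochhammer_minus_le: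
  fixes \<beta> :: real
  assumes \<beta>: "0 \<le> \<beta>" "\<beta> < real n"
  shows "\<bar>pochhammer (- \<beta>) n\<bar> / fact (n - 1) * real n powr \<beta> \<le> \<beta> * exp (\<beta> * (1 + ln (\<beta> + 1)))"
proof -
  define q where "q = nat \<lfloor>\<beta>\<rfloor>"
  have n: "n > 0" using \<beta> by auto
  then obtain N where N: "n = Suc N" by (cases n) auto
  have qb: "real q \<le> \<beta>" unfolding q_def using \<beta> by linarith
  have qN: "q \<le> N" using qb \<beta> N by linarith
  have hq: "harm q \<le> 1 + ln (\<beta> + 1)"
  proof (cases "q = 0")
    case False
    have "harm q - ln (real q) \<le> harm 1 - ln (real 1)"
      using euler_mascheroni_sequence_decreasing[of 1 q] False by simp
    moreover have "ln (real q) \<le> ln (\<beta> + 1)" using qb False by (subst ln_le_cancel_iff) auto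
    ultimately show ?thesis by (simp add: harm_expand)
  qed (use \<beta> in \<open>simp add: harm_expand\<close>)
  have hN: "ln (real n) \<le> harm N" using ln_le_harm[of N] N by (simp add: add.commute)
  have "(\<Prod>i=0..<n. \<bar>- \<beta> + real i\<bar>) = \<beta> * (\<Prod>i=1..N. \<bar>real i - \<beta>\<bar>)"
    using \<beta> unfolding N by (subst prod.atLeast_Suc_lessThan)
      (auto simp: atLeastLessThanSuc_atLeastAtMost abs_minus_commute intro!: prod.cong)
  then have "\<bar>pochhammer (- \<beta>) n\<bar> / fact (n - 1) = \<beta> * (\<Prod>i=1..N. \<bar>real i - \<beta>\<bar> / real i)"
    by (simp only: pochhammer_prod abs_prod N fact_prod prod_dividef) (simp add: fact_prod)
  also have "\<dots> \<le> \<beta> * exp (\<beta> * (harm q - harm N))"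
    using abs_prod_le_harm[OF \<beta>(1), of N] qN \<beta> unfolding q_def by (intro mult_left_mono) auto
  also have "\<dots> \<le> \<beta> * exp (\<beta> * (1 + ln (\<beta> + 1) - ln (real n)))"
    using hq hN \<beta> by (intro mult_left_mono) (auto intro!: mult_left_mono)
  finally have "\<bar>pochhammer (- \<beta>) n\<bar> / fact (n - 1) * real n powr \<beta> \<le>
      \<beta> * exp (\<beta> * (1 + ln (\<beta> + 1) - ln (real n))) * real n powr \<beta>"
    by (rule mult_right_mono) simp
  also have "\<dots> = \<beta> * exp (\<beta> * (1 + ln (\<beta> + 1)))"
    using n by (simp add: powr_def exp_add[symmetric] algebra_simps)
  finally show ?thesis .
qed

text \<open>The absolute term is the product of |2z|^l / sqrt(l!) and 2^(-l), hence at most the sum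
  of their squares, and both squares are summable.\<close>

lemma summable_power_over_sqrt_fact:
  fixes z :: real
  shows "summable (\<lambda>l. z ^ l / sqrt (fact l))"
proof (rule summable_comparison_test')
  show "summable (\<lambda>l. (4 * z\<^sup>2) ^ l / fact l + (1 / 4) ^ l)"
    using summable_exp[of "4 * z\<^sup>2"] summable_geometric[of "1/4 :: real"]
    by (intro summable_add) (simp_all add: field_simps)
  fix l :: nat
  define a where "a = \<bar>2 * z\<bar> ^ l / sqrt (fact l)"
  define b where "b = (1 / 2 :: real) ^ l"
  have "norm (z ^ l / sqrt (fact l)) = a * b"
    by (simp add: a_def b_def abs_mult power_mult_distrib power_abs power_one_over)
  also have "\<dots> \<le> a\<^sup>2 + b\<^sup>2"
    using sum_squares_bound[of a b] zero_le_power2[of a] zero_le_power2[of b] by linarith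
  also have "a\<^sup>2 = (4 * z\<^sup>2) ^ l / fact l"
  proof -
    have "a\<^sup>2 = (\<bar>2 * z\<bar> ^ l)\<^sup>2 / fact l"
      by (simp add: a_def power_divide)
    also have "(\<bar>2 * z\<bar> ^ l)\<^sup>2 = (\<bar>2 * z\<bar>\<^sup>2) ^ l"
      by (simp only: power_mult[symmetric] mult.commute)
    also have "\<bar>2 * z\<bar>\<^sup>2 = 4 * z\<^sup>2" by (simp add: power2_eq_square)
    finally show ?thesis .
  qed
  also have "b\<^sup>2 = (1 / 4) ^ l"
  proof -
    have "b\<^sup>2 = ((1 / 2)\<^sup>2) ^ l"
      by (simp only: b_def power_mult[symmetric] mult.commute)
    also have "(1 / 2 :: real)\<^sup>2 = 1 / 4" by (simp add: power2_eq_square)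
    finally show ?thesis .
  qed
  finally show "norm (z ^ l / sqrt (fact l)) \<le> (4 * z\<^sup>2) ^ l / fact l + (1 / 4) ^ l" .
qed

text \<open>Since k \<ge> 2 gives l/k \<le> l/2, the growth is that of a square root of l^l, hence
  of sqrt(l!) up to exponential factors. Against the factorial in the denominator of the series this
  leaves 1/sqrt(l!).\<close>

lemma exp_log_growth_le:
  assumes k: "k \<ge> (2::nat)"
  defines "\<beta> \<equiv> \<lambda>l. real l / real k"
  shows "exp (\<beta> l * (1 + ln (\<beta> l + 1))) \<le> exp (real l + 1) * sqrt (fact l)"
proof -
  have \<beta>: "0 \<le> \<beta> l" "\<beta> l \<le> real l / 2"
    using k mult_left_mono[of 2 "real k" "real l"] by (auto simp: \<beta>_def field_simps)
  have "exp (\<beta> l * ln (\<beta> l + 1)) \<le> exp ((real l / 2) * ln (real l + 1))"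
    using \<beta> k by (subst exp_le_cancel_iff, intro mult_mono) auto
  also have "\<dots> = sqrt (exp (real l * ln (real l + 1)))"
    by (rule real_sqrt_unique[symmetric]) (auto simp: power2_eq_square exp_add[symmetric])
  also have "exp (real l * ln (real l + 1)) = (real l + 1) ^ l"
    by (subst exp_of_nat_mult) simp
  also have "(real l + 1) ^ l \<le> exp (real l + 1) * fact l"
  proof -
    have "(real l + 1) ^ l / fact l \<le> exp (real l + 1)"
      using sum_le_suminf[OF summable_exp[of "real l + 1"], of "{l}"]
      by (simp add: exp_def field_simps)
    then show ?thesis by (simp add: field_simps)
  qed
  also have "sqrt (exp (real l + 1) * fact l) = exp ((real l + 1) / 2) * sqrt (fact l)"
    by (simp add: real_sqrt_mult) (rule real_sqrt_unique, auto simp: power2_eq_square exp_add[symmetric] field_simps)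
  finally have 1: "exp (\<beta> l * ln (\<beta> l + 1)) \<le> exp ((real l + 1) / 2) * sqrt (fact l)" by simp
  have "exp (\<beta> l * (1 + ln (\<beta> l + 1))) = exp (\<beta> l) * exp (\<beta> l * ln (\<beta> l + 1))"
    by (simp add: exp_add[symmetric] algebra_simps)
  also have "\<dots> \<le> exp ((real l + 1) / 2) * (exp ((real l + 1) / 2) * sqrt (fact l))"
    using 1 \<beta> by (intro mult_mono) auto
  also have "\<dots> = exp (real l + 1) * sqrt (fact l)"
    by (simp add: mult.assoc[symmetric] exp_add[symmetric])
  finally show ?thesis .
qed

section \<open>The limiting distribution function and its derivative\<close>

definition limit_coeff :: "nat \<Rightarrow> nat \<Rightarrow> real" where
  "limit_coeff k l = (- 1) ^ l * rGamma (- (real l / real k)) * Gamma (1 / real k) / fact l"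

definition limit_density :: "nat \<Rightarrow> real \<Rightarrow> real" where
  "limit_density k x = (\<Sum>l. limit_coeff k l * x ^ l)"

definition limit_cdf :: "nat \<Rightarrow> real \<Rightarrow> real" where
  "limit_cdf k x = (\<Sum>l. limit_coeff k l / real (Suc l) * x ^ Suc l)"

lemma block_weight_tendsto:
  assumes k: "k \<ge> 1"
  shows "(\<lambda>n. block_weight k n l * real n powr (real (Suc l) / real k))
    \<longlonglongrightarrow> rGamma (- (real l / real k)) * Gamma (1 / real k)"
  using pochhammer_ratio_tendsto[of "1 / real k" "- (real l / real k)"] k
  by (simp add: block_weight_def add_divide_distrib[symmetric] add.commute)

text \<open>Applied to the cutoff of the summed law and later to the shifted random number of
  blocks.\<close>

lemma binomial_over_power_tendsto:
  fixes M :: "nat \<Rightarrow> nat" and q :: "nat \<Rightarrow> real"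
  assumes M: "(\<lambda>n. real (M n) / q n) \<longlonglongrightarrow> x" and q: "filterlim q at_top sequentially"
  shows "(\<lambda>n. real (M n choose j) / q n ^ j) \<longlonglongrightarrow> x ^ j / fact j"
proof -
  have "(\<lambda>n. (real (M n) - real i) / q n) \<longlonglongrightarrow> x" for i
    using tendsto_diff[OF M real_tendsto_divide_at_top[OF tendsto_const q, of "real i"]]
    by (simp add: diff_divide_distrib)
  then have "(\<lambda>n. (\<Prod>i=0..<j. (real (M n) - real i) / q n) / fact j) \<longlonglongrightarrow> (\<Prod>i=0..<j. x) / fact j"
    by (intro tendsto_intros) auto
  then show ?thesis
    by (simp add: binomial_gbinomial gbinomial_prod_rev prod_dividef mult.commute)
qed

text \<open>The binomial coefficient contributes (x n^(1/k))^(l + 1) / (l + 1)! and the weight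
  contributes n^(-(l + 1)/k), so every term has a limit; the preceding bounds dominate the terms
  uniformly in n.\<close>

lemma sum_block_prob_tendsto:
  assumes k: "k \<ge> 2" and x: "x \<ge> 0"
  shows "(\<lambda>n. \<Sum>j\<le>nat \<lfloor>x * real n powr (1 / real k)\<rfloor>. block_prob k n j) \<longlonglongrightarrow> limit_cdf k x"
    and "summable (\<lambda>l. norm (limit_coeff k l / real (Suc l) * x ^ Suc l))"
proof -
  define q where "q = (\<lambda>n. real n powr (1 / real k))"
  \<comment> \<open>The successor comes from \<open>Suc m choose Suc l\<close> in the summed
    law.\<close>
  define M where "M = (\<lambda>n. Suc (nat \<lfloor>x * q n\<rfloor>))"
  define a where "a = (\<lambda>l n. real (M n choose Suc l) * (- 1) ^ l * block_weight k n l)"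
  have k1: "k \<ge> 1" using k by simp
  have qtop: "filterlim q at_top sequentially"
    unfolding q_def using k by real_asymp
  have qp: "q n ^ j = real n powr (real j / real k)" if "n > 0" for n j
    using that by (simp add: q_def powr_realpow[symmetric] powr_powr)
  have Mle: "real (M n) \<le> x * q n + 1" and Mge: "x * q n \<le> real (M n)" for n
  proof -
    have "0 \<le> x * q n" using x by (simp add: q_def)
    then show "real (M n) \<le> x * q n + 1" "x * q n \<le> real (M n)"
      unfolding M_def by linarith+
  qed
  have Mq: "(\<lambda>n. real (M n) / q n) \<longlonglongrightarrow> x"
  proof (rule real_tendsto_sandwich)
    have ev: "eventually (\<lambda>n. q n > 0) sequentially"
      using filterlim_at_top_dense[of q sequentially] qtop by auto
    show "eventually (\<lambda>n. x \<le> real (M n) / q n) sequentially"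
      using ev by eventually_elim (use Mge in \<open>simp add: field_simps\<close>)
    show "eventually (\<lambda>n. real (M n) / q n \<le> x + 1 / q n) sequentially"
      using ev by eventually_elim (use Mle in \<open>simp add: field_simps\<close>)
    show "(\<lambda>n. x + 1 / q n) \<longlonglongrightarrow> x"
      using tendsto_add[OF tendsto_const[of x] real_tendsto_divide_at_top[OF tendsto_const[of 1] qtop]] by simp
  qed auto
  have lim: "(\<lambda>n. a l n) \<longlonglongrightarrow> limit_coeff k l / real (Suc l) * x ^ Suc l" for l
  proof -
    have "(\<lambda>n. (real (M n choose Suc l) / q n ^ Suc l) * (- 1) ^ l * (block_weight k n l * real n powr (real (Suc l) / real k)))
      \<longlonglongrightarrow> (x ^ Suc l / fact (Suc l)) * (- 1) ^ l * (rGamma (- (real l / real k)) * Gamma (1 / real k))"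
      by (intro tendsto_mult binomial_over_power_tendsto[OF Mq qtop] tendsto_const block_weight_tendsto[OF k1])
    moreover have "eventually (\<lambda>n. (real (M n choose Suc l) / q n ^ Suc l) * (- 1) ^ l * (block_weight k n l * real n powr (real (Suc l) / real k)) = a l n) sequentially"
      using eventually_gt_at_top[of 0]
    proof eventually_elim
      case (elim n)
      then have "q n ^ Suc l = real n powr (real (Suc l) / real k)" "real n powr (real (Suc l) / real k) > 0"
        using qp[of n "Suc l"] by auto
      then show ?case unfolding a_def by (simp only:) simp
    qed
    ultimately have "(\<lambda>n. a l n) \<longlonglongrightarrow> (x ^ Suc l / fact (Suc l)) * (- 1) ^ l * (rGamma (- (real l / real k)) * Gamma (1 / real k))"
      by (rule Lim_transform_eventually)
    also have "(x ^ Suc l / fact (Suc l)) * (- 1) ^ l * (rGamma (- (real l / real k)) * Gamma (1 / real k)) =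
        limit_coeff k l / real (Suc l) * x ^ Suc l"
      by (simp add: limit_coeff_def field_simps)
    finally show ?thesis .
  qed
  \<comment> \<open>\<open>C\<close> eventually bounds the convergent \<open>Gamma_series'\<close>.
    In \<open>D\<close> the factor x + 1 comes from M n \<le> (x + 1) q n, valid once q n > 1, and
    \<open>exp 1\<close> from \<open>exp_log_growth_le\<close>.\<close>
  define C where "C = Gamma (1 / real k) + 1"
  define D where "D = (\<lambda>l. C * (exp 1 * (x + 1)) * ((exp 1 * (x + 1)) ^ l / sqrt (fact l)))"
  have Cp: "C > 0" unfolding C_def using k Gamma_real_pos[of "1 / real k"] by (simp add: add_pos_pos)
  have ev: "eventually (\<lambda>n. n > 0 \<and> q n > 1 \<and> (x + 1) * q n < real n \<and> Gamma_series' (1 / real k) n < C) sequentially"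
  proof (intro eventually_conj)
    show "eventually (\<lambda>n. q n > 1) sequentially"
      using filterlim_at_top_dense[of q sequentially] qtop by auto
    have "(\<lambda>n. (x + 1) * real n powr (1 / real k - 1)) \<longlonglongrightarrow> 0"
      using k by real_asymp
    then have "eventually (\<lambda>n. (x + 1) * real n powr (1 / real k - 1) < 1) sequentially"
      by (rule order_tendstoD) simp
    then show "eventually (\<lambda>n. (x + 1) * q n < real n) sequentially"
      using eventually_gt_at_top[of 0]
      by eventually_elim (auto simp: q_def powr_diff field_simps)
    show "eventually (\<lambda>n. Gamma_series' (1 / real k) n < C) sequentially"
      by (rule order_tendstoD(2)[OF Gamma_series'_LIMSEQ]) (simp add: C_def)
  qed (rule eventually_gt_at_top)
  have bound: "norm (a l n) \<le> D l"
    if n: "n > 0" "q n > 1" "(x + 1) * q n < real n" "Gamma_series' (1 / real k) n < C" for l n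
  proof (cases "l < M n")
    case False
    then have "a l n = 0" by (simp add: a_def binomial_eq_0 del: binomial_Suc_Suc)
    then show ?thesis using Cp x by (simp add: D_def)
  next
    case True
    define \<beta> where "\<beta> = real l / real k"
    have "M n \<le> (x + 1) * q n" using Mle[of n] n(2) by (simp add: algebra_simps)
    \<comment> \<open>The cutoff is eventually below n, so \<beta> < n as the Pochhammer bound
      requires.\<close>
    then have ln: "real l < real n" using n True by linarith
    have "\<beta> \<le> real l" unfolding \<beta>_def using k mult_left_mono[of 1 "real k" "real l"] by (auto simp: field_simps)
    then have \<beta>: "0 \<le> \<beta>" "\<beta> < real n" "\<beta> \<le> real l" using ln unfolding \<beta>_def by auto
    have pk: "pochhammer (1 / real k) n > 0" using k by (intro pochhammer_pos) auto
    have "real (M n choose Suc l) = (\<Prod>i=0..<Suc l. real (M n) - real i) / fact (Suc l)"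
      by (simp add: binomial_gbinomial gbinomial_prod_rev)
    also have "\<dots> \<le> real (M n) ^ Suc l / fact (Suc l)"
    proof (rule divide_right_mono)
      have "(\<Prod>i=0..<Suc l. real (M n) - real i) \<le> (\<Prod>i=0..<Suc l. real (M n))"
        using True by (intro prod_mono) auto
      then show "(\<Prod>i=0..<Suc l. real (M n) - real i) \<le> real (M n) ^ Suc l" by simp
    qed simp
    also have "\<dots> \<le> ((x + 1) * q n) ^ Suc l / fact (Suc l)"
      using \<open>M n \<le> (x + 1) * q n\<close> by (intro divide_right_mono power_mono) auto
    finally have ch: "real (M n choose Suc l) \<le> (x + 1) ^ Suc l / fact (Suc l) * q n ^ Suc l"
      by (simp only: power_mult_distrib times_divide_eq_left)
    \<comment> \<open>\<open>Gamma_series'\<close> at 1/k absorbs the denominator of the weight, the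
      factorial of n - 1 and one factor n^(1/k).\<close>
    have "\<bar>block_weight k n l\<bar> * q n ^ Suc l =
        (\<bar>pochhammer (- \<beta>) n\<bar> / fact (n - 1) * real n powr \<beta>) * Gamma_series' (1 / real k) n"
    proof -
      have "q n ^ Suc l = real n powr \<beta> * real n powr (1 / real k)"
        using qp[OF n(1), of "Suc l"] by (simp add: \<beta>_def powr_add[symmetric] add_divide_distrib add.commute)
      then show ?thesis
        using pk n(1) by (simp add: block_weight_def Gamma_series'_def \<beta>_def powr_def abs_divide)
    qed
    also have "\<dots> \<le> (\<beta> * exp (\<beta> * (1 + ln (\<beta> + 1)))) * C"
      using n(4) \<beta> pk by (intro mult_mono abs_pochhammer_minus_le) (auto simp: Gamma_series'_def)
    also have "\<dots> \<le> (real l * (exp (real l + 1) * sqrt (fact l))) * C"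
      using exp_log_growth_le[OF k, of l] \<beta> Cp unfolding \<beta>_def by (intro mult_right_mono mult_mono) auto
    finally have bw: "\<bar>block_weight k n l\<bar> * q n ^ Suc l \<le> C * real (Suc l) * exp (real l + 1) * sqrt (fact l)"
      using Cp by (simp add: algebra_simps) (smt (verit) exp_ge_zero mult_nonneg_nonneg real_sqrt_ge_zero fact_ge_zero)
    have "norm (a l n) = real (M n choose Suc l) * \<bar>block_weight k n l\<bar>"
      by (simp add: a_def abs_mult)
    also have "\<dots> \<le> ((x + 1) ^ Suc l / fact (Suc l) * q n ^ Suc l) * \<bar>block_weight k n l\<bar>"
      using ch by (intro mult_right_mono) auto
    also have "\<dots> = (x + 1) ^ Suc l / fact (Suc l) * (\<bar>block_weight k n l\<bar> * q n ^ Suc l)"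
      by (simp only: mult_ac)
    also have "\<dots> \<le> (x + 1) ^ Suc l / fact (Suc l) * (C * real (Suc l) * exp (real l + 1) * sqrt (fact l))"
      using bw x by (intro mult_left_mono) auto
    also have "\<dots> = C * ((x + 1) ^ Suc l * exp (real l + 1)) * ((real (Suc l) / fact (Suc l)) * sqrt (fact l))"
      by (simp only: times_divide_eq_left times_divide_eq_right mult_ac)
    also have "(real (Suc l) / fact (Suc l)) * sqrt (fact l) = 1 / sqrt (fact l)"
    proof -
      have "real (Suc l) / fact (Suc l) = 1 / (fact l :: real)" by (simp only: fact_Suc) simp
      then show ?thesis by (simp add: real_div_sqrt divide_simps)
    qed
    also have "exp (real l + 1) = exp 1 ^ Suc l"
      by (simp add: exp_of_nat_mult[symmetric] exp_add mult.commute)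
    finally show ?thesis
      by (simp add: D_def power_mult_distrib mult_ac)
  qed
  have "eventually (\<lambda>(l, n). norm (a l n) \<le> D l) (at_top \<times>\<^sub>F sequentially)"
    unfolding eventually_prod_filter
    using ev bound by (intro exI[of _ "\<lambda>_. True"] exI conjI) auto
  moreover have "summable D"
    unfolding D_def by (intro summable_mult summable_power_over_sqrt_fact)
  ultimately have T: "summable (\<lambda>l. norm (limit_coeff k l / real (Suc l) * x ^ Suc l))"
      "(\<lambda>n. \<Sum>l. a l n) \<longlonglongrightarrow> (\<Sum>l. limit_coeff k l / real (Suc l) * x ^ Suc l)"
    using tannerys_theorem[OF lim, where M = D] by auto
  show "summable (\<lambda>l. norm (limit_coeff k l / real (Suc l) * x ^ Suc l))" by (rule T)
  \<comment> \<open>The binomial coefficient vanishes beyond the cutoff, so the series is the finite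
    sum of the law.\<close>
  have "(\<Sum>l. a l n) = (\<Sum>j\<le>nat \<lfloor>x * q n\<rfloor>. block_prob k n j)" for n
  proof -
    have "(\<Sum>l. a l n) = (\<Sum>l\<le>nat \<lfloor>x * q n\<rfloor>. a l n)"
      by (intro suminf_finite) (auto simp: a_def M_def binomial_eq_0 simp del: binomial_Suc_Suc)
    then show ?thesis by (simp add: sum_block_prob[OF k1] a_def M_def del: binomial_Suc_Suc)
  qed
  then show "(\<lambda>n. \<Sum>j\<le>nat \<lfloor>x * real n powr (1 / real k)\<rfloor>. block_prob k n j) \<longlonglongrightarrow> limit_cdf k x"
    using T(2) by (simp add: limit_cdf_def q_def)
qed


text \<open>Shifting the index gives a power series with zero constant coefficient, to which
  termwise differentiation applies. Absolute convergence at |x| covers negative x as well.\<close>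

lemma limit_cdf_powser:
  assumes k: "k \<ge> 2"
  defines "d \<equiv> (\<lambda>n. case n of 0 \<Rightarrow> 0 | Suc l \<Rightarrow> limit_coeff k l / real (Suc l))"
  shows "summable (\<lambda>n. d n * x ^ n)" "limit_cdf k x = (\<Sum>n. d n * x ^ n)" "diffs d = limit_coeff k"
proof -
  have "summable (\<lambda>n. norm (d n * x ^ n))"
    using sum_block_prob_tendsto(2)[OF k, of "\<bar>x\<bar>"]
    by (subst summable_Suc_iff[symmetric]) (simp add: d_def abs_mult power_abs)
  then show s: "summable (\<lambda>n. d n * x ^ n)" by (rule summable_norm_cancel)
  show "limit_cdf k x = (\<Sum>n. d n * x ^ n)"
    using suminf_split_head[OF s] by (simp add: limit_cdf_def d_def)
  show "diffs d = limit_coeff k"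
    by (auto simp: diffs_def d_def)
qed

lemma summable_limit_density:
  assumes k: "k \<ge> 2"
  shows "summable (\<lambda>l. limit_coeff k l * x ^ l)"
  using termdiff_converges_all[OF limit_cdf_powser(1)[OF k], of x]
  by (simp only: limit_cdf_powser(3)[OF k])

lemma limit_cdf_deriv:
  assumes k: "k \<ge> 2"
  shows "(limit_cdf k has_real_derivative limit_density k x) (at x)"
proof -
  have "limit_cdf k = (\<lambda>x. \<Sum>n. (case n of 0 \<Rightarrow> 0 | Suc l \<Rightarrow> limit_coeff k l / real (Suc l)) * x ^ n)"
    by (rule ext) (rule limit_cdf_powser(2)[OF k])
  then show ?thesis
    using termdiffs_strong_converges_everywhere[OF limit_cdf_powser(1)[OF k], of x]
    by (simp only: limit_cdf_powser(3)[OF k] limit_density_def)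
qed

lemma isCont_limit_density:
  assumes k: "k \<ge> 2"
  shows "isCont (limit_density k) x"
  unfolding limit_density_def[abs_def]
  by (rule isCont_powser_converges_everywhere) (rule summable_limit_density[OF k])

lemma limit_cdf_0: "limit_cdf k 0 = 0"
  by (simp add: limit_cdf_def)

lemma block_prob_nonneg: "block_prob k n m \<ge> 0"
  unfolding block_prob_def block_mean_def by (intro divide_nonneg_nonneg sum_nonneg) auto

text \<open>The series alternates and shows no sign. But \<open>limit_cdf\<close> is on the half
  line a pointwise limit of distribution functions, hence monotone, so its derivative is
  nonnegative.\<close>

lemma limit_density_nonneg:
  assumes k: "k \<ge> 2" and x: "x > 0"
  shows "limit_density k x \<ge> 0"
proof (rule mono_on_imp_deriv_nonneg[OF _ limit_cdf_deriv[OF k]])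
  show "mono_on {0..} (limit_cdf k)"
  proof (rule mono_onI)
    fix r s :: real assume rs: "r \<in> {0..}" "s \<in> {0..}" "r \<le> s"
    show "limit_cdf k r \<le> limit_cdf k s"
    proof (rule LIMSEQ_le[OF sum_block_prob_tendsto(1)[OF k, of r] sum_block_prob_tendsto(1)[OF k, of s]])
      have "(\<Sum>j\<le>nat \<lfloor>r * real n powr (1 / real k)\<rfloor>. block_prob k n j) \<le>
          (\<Sum>j\<le>nat \<lfloor>s * real n powr (1 / real k)\<rfloor>. block_prob k n j)" for n
        using rs by (intro sum_mono2 block_prob_nonneg) (auto intro!: nat_mono floor_mono mult_right_mono)
      then show "\<exists>N. \<forall>n\<ge>N. (\<Sum>j\<le>nat \<lfloor>r * real n powr (1 / real k)\<rfloor>. block_prob k n j) \<le>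
          (\<Sum>j\<le>nat \<lfloor>s * real n powr (1 / real k)\<rfloor>. block_prob k n j)" by blast
    qed (use rs in auto)
  qed
  show "x \<in> interior {0..}" using x by simp
qed

text \<open>The reflection formula in its reciprocal form, which remains valid at integers
  \<open>b\<close>, where both sides vanish.\<close>

lemma rGamma_minus:
  fixes b :: real
  assumes "b > 0"
  shows "rGamma (- b) = - Gamma (b + 1) * sin (b * pi) / pi"
proof -
  have "complex_of_real (rGamma b * rGamma (- b)) = complex_of_real (- b * sin (pi * b) / pi)"
    using rGamma_reflection_complex'[of "complex_of_real b"]
    by (simp add: rGamma_complex_of_real[symmetric] sin_of_real[symmetric])
  then have "rGamma b * rGamma (- b) = - b * sin (pi * b) / pi"
    by (simp only: of_real_eq_iff)
  moreover have "Gamma b > 0" using assms by (rule Gamma_real_pos)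
  moreover have "Gamma (b + 1) = b * Gamma b"
    using assms by (intro Gamma_plus1) (auto elim: nonpos_Ints_cases)
  moreover have "rGamma b = 1 / Gamma b" by (simp add: rGamma_inverse_Gamma divide_inverse)
  ultimately have "rGamma (- b) = Gamma b * (- b * sin (pi * b) / pi)"
    by (simp add: field_simps)
  then show ?thesis
    unfolding \<open>Gamma (b + 1) = b * Gamma b\<close> by (simp add: mult_ac)
qed

text \<open>The coefficient of index 0 vanishes because \<open>rGamma\<close> does at 0, hence the
  shift to \<open>Suc j\<close>; the sines come from reflection.\<close>

lemma limit_density_series:
  assumes k: "k \<ge> 2"
  shows "summable (\<lambda>j. (- 1) ^ j * (Gamma (real (Suc j) / real k + 1) *
            sin (real (Suc j) * pi / real k) / fact (Suc j)) * x ^ Suc j)" (is "summable ?s")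
    and "limit_density k x = Gamma (1 / real k) / pi *
      (\<Sum>j. (- 1) ^ j * (Gamma (real (Suc j) / real k + 1) *
            sin (real (Suc j) * pi / real k) / fact (Suc j)) * x ^ Suc j)"
proof -
  have G: "Gamma (1 / real k) > 0" using k by (intro Gamma_real_pos) auto
  have eq: "limit_coeff k (Suc j) * x ^ Suc j = Gamma (1 / real k) / pi * ?s j" for j
  proof -
    have "rGamma (- (real (Suc j) / real k)) =
        - Gamma (real (Suc j) / real k + 1) * sin (real (Suc j) / real k * pi) / pi"
      using k by (intro rGamma_minus) auto
    also have "real (Suc j) / real k * pi = real (Suc j) * pi / real k" by simp
    finally show ?thesis
      unfolding limit_coeff_def power_Suc[of "- 1" j] by (simp add: mult_ac del: fact_Suc of_nat_Suc)
  qed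
  have "summable (\<lambda>j. limit_coeff k (Suc j) * x ^ Suc j)"
    using summable_limit_density[OF k, of x] by (subst summable_Suc_iff)
  then have 1: "summable (\<lambda>j. Gamma (1 / real k) / pi * ?s j)" by (simp only: eq)
  then show s: "summable ?s"
    using G by (subst (asm) summable_cmult_iff) auto
  have "limit_density k x = limit_coeff k 0 * x ^ 0 + (\<Sum>j. limit_coeff k (Suc j) * x ^ Suc j)"
    unfolding limit_density_def using suminf_split_head[OF summable_limit_density[OF k, of x]] by simp
  also have "limit_coeff k 0 = 0" by (simp add: limit_coeff_def)
  also have "(\<Sum>j. limit_coeff k (Suc j) * x ^ Suc j) = Gamma (1 / real k) / pi * (\<Sum>j. ?s j)"
    unfolding eq by (rule suminf_mult[OF s])
  finally show "limit_density k x = Gamma (1 / real k) / pi * (\<Sum>j. ?s j)" by simp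
qed

section \<open>The stable density\<close>

text \<open>A bridge from nonnegative Lebesgue integrals to the gauge integral, where the change of
  variables below is carried out.\<close>

lemma set_nn_integral_eq_has_integral:
  fixes h :: "real \<Rightarrow> real"
  assumes [measurable]: "h \<in> borel_measurable borel" "S \<in> sets borel"
    and nn: "\<And>x. x \<in> S \<Longrightarrow> 0 \<le> h x" and r: "0 \<le> r"
  shows "(\<integral>\<^sup>+x\<in>S. ennreal (h x) \<partial>lborel) = ennreal r \<longleftrightarrow> (h has_integral r) S"
proof
  assume I: "(\<integral>\<^sup>+x\<in>S. ennreal (h x) \<partial>lborel) = ennreal r"
  have "(\<integral>\<^sup>+x. ennreal (if x \<in> S then h x else 0) \<partial>lborel) = ennreal r"
    unfolding I[symmetric] by (intro nn_integral_cong) auto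
  then have "((\<lambda>x. if x \<in> S then h x else 0) has_integral r) UNIV"
    using r nn by (intro nn_integral_has_integral) auto
  then show "(h has_integral r) S" by (simp add: has_integral_restrict_UNIV)
next
  assume "(h has_integral r) S"
  then show "(\<integral>\<^sup>+x\<in>S. ennreal (h x) \<partial>lborel) = ennreal r"
    by (intro nn_integral_has_integral_lebesgue' nn)
qed

text \<open>Used with the positive exponent \<open>2 * j\<close> and the negative exponent
  \<open>- k\<close>. By \<open>iff\<close>, each side takes a given finite value exactly when the
  other does, so the sides also agree when one is infinite.\<close>

lemma nn_integral_powr_substitution:
  fixes h :: "real \<Rightarrow> real" and p :: real
  assumes p: "p \<noteq> 0" and [measurable]: "h \<in> borel_measurable borel"
    and nn: "\<And>y. 0 < y \<Longrightarrow> 0 \<le> h y"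
  shows "(\<integral>\<^sup>+y\<in>{0<..}. ennreal (h y) \<partial>lborel) =
    (\<integral>\<^sup>+x\<in>{0<..}. ennreal (\<bar>p\<bar> * x powr (p - 1) * h (x powr p)) \<partial>lborel)"
    (is "?L = ?R")
proof -
  have im: "(\<lambda>x. x powr p) ` {0<..} = {0<..}"
  proof (intro equalityI subsetI)
    fix y :: real assume "y \<in> {0<..}"
    then have "y = (y powr (1 / p)) powr p" "y powr (1 / p) \<in> {0<..}"
      using p by (auto simp: powr_powr)
    then show "y \<in> (\<lambda>x. x powr p) ` {0<..}" by blast
  qed auto
  have iff: "?L = ennreal r \<longleftrightarrow> ?R = ennreal r" if r: "0 \<le> r" for r
  proof -
    have "?L = ennreal r \<longleftrightarrow> (h has_integral r) ((\<lambda>x. x powr p) ` {0<..})"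
      unfolding im using nn r by (intro set_nn_integral_eq_has_integral) auto
    also have "\<dots> \<longleftrightarrow> h absolutely_integrable_on ((\<lambda>x. x powr p) ` {0<..}) \<and>
        integral ((\<lambda>x. x powr p) ` {0<..}) h = r"
      unfolding has_integral_iff im using nn by (subst absolutely_integrable_on_iff_nonneg) auto
    also have "\<dots> \<longleftrightarrow> (\<lambda>x. \<bar>p * x powr (p - 1)\<bar> * h (x powr p)) absolutely_integrable_on {0<..} \<and>
        integral {0<..} (\<lambda>x. \<bar>p * x powr (p - 1)\<bar> * h (x powr p)) = r"
    proof (rule has_absolute_integral_change_of_variables_1'[symmetric])
      show "inj_on (\<lambda>x. x powr p) {0<..}"
        using p by (intro inj_onI) (metis greaterThan_iff less_imp_le powr_powr powr_one mult.commute nonzero_divide_eq_eq)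
      show "((\<lambda>x. x powr p) has_real_derivative p * x powr (p - 1)) (at x within {0<..})" if "x \<in> {0<..}" for x
        using that by (auto intro!: derivative_eq_intros simp: powr_diff)
    qed simp
    also have "\<dots> \<longleftrightarrow> ((\<lambda>x. \<bar>p * x powr (p - 1)\<bar> * h (x powr p)) has_integral r) {0<..}"
      unfolding has_integral_iff using nn by (subst absolutely_integrable_on_iff_nonneg) auto
    also have "\<dots> \<longleftrightarrow> (\<integral>\<^sup>+x\<in>{0<..}. ennreal (\<bar>p * x powr (p - 1)\<bar> * h (x powr p)) \<partial>lborel) = ennreal r"
      using nn r by (intro set_nn_integral_eq_has_integral[symmetric]) auto
    finally show ?thesis by (simp add: abs_mult)
  qed
  show ?thesis
  proof (cases ?L)
    case (real r) then show ?thesis using iff[of r] by simp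
  next
    case top
    show ?thesis
    proof (cases ?R)
      case (real r) then show ?thesis using iff[of r] by simp
    qed (use top in simp)
  qed
qed

lemma nn_integral_gamma_scaled:
  fixes s c :: real
  assumes s: "s > 0" and c: "c > 0"
  shows "(\<integral>\<^sup>+u\<in>{0<..}. ennreal (u powr (s - 1) * exp (- c * u)) \<partial>lborel) = ennreal (Gamma s * c powr (- s))"
proof -
  have "ennreal (Gamma s) = (\<integral>\<^sup>+t. ennreal (indicator {0..} t * t powr (s - 1) / exp t) \<partial>lborel)"
    by (rule Gamma_conv_nn_integral_real[OF s])
  also have "\<dots> = (\<integral>\<^sup>+t. ennreal (t powr (s - 1) * exp (- t)) * indicator {0<..} t \<partial>lborel)"
    by (intro nn_integral_cong) (auto simp: indicator_def exp_minus field_simps)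
  also have "\<dots> = ennreal \<bar>c\<bar> * (\<integral>\<^sup>+u. ennreal ((0 + c * u) powr (s - 1) * exp (- (0 + c * u))) * indicator {0<..} (0 + c * u) \<partial>lborel)"
    using c by (intro nn_integral_real_affine) auto
  also have "(\<integral>\<^sup>+u. ennreal ((0 + c * u) powr (s - 1) * exp (- (0 + c * u))) * indicator {0<..} (0 + c * u) \<partial>lborel) =
      (\<integral>\<^sup>+u. ennreal (c powr (s - 1)) * (ennreal (u powr (s - 1) * exp (- c * u)) * indicator {0<..} u) \<partial>lborel)"
    using c by (intro nn_integral_cong)
      (auto simp: indicator_def powr_mult ennreal_mult'[symmetric] zero_less_mult_iff mult_ac)
  also have "\<dots> = ennreal (c powr (s - 1)) * (\<integral>\<^sup>+u\<in>{0<..}. ennreal (u powr (s - 1) * exp (- c * u)) \<partial>lborel)"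
    by (intro nn_integral_cmult) auto
  finally have *: "ennreal (Gamma s) = ennreal (c powr s) * (\<integral>\<^sup>+u\<in>{0<..}. ennreal (u powr (s - 1) * exp (- c * u)) \<partial>lborel)"
    using c by (simp add: mult.assoc[symmetric] ennreal_mult'[symmetric] powr_diff)
  have "ennreal (Gamma s * c powr (- s)) = ennreal (c powr (- s)) * ennreal (Gamma s)"
    using Gamma_real_pos[OF s] by (simp add: ennreal_mult'[symmetric] mult.commute)
  also have "\<dots> = (\<integral>\<^sup>+u\<in>{0<..}. ennreal (u powr (s - 1) * exp (- c * u)) \<partial>lborel)"
    unfolding * using c by (simp add: mult.assoc[symmetric] ennreal_mult'[symmetric] powr_minus)
  finally show ?thesis ..
qed

lemma nn_integral_even:
  fixes h :: "real \<Rightarrow> ennreal"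
  assumes [measurable]: "h \<in> borel_measurable borel" and even: "\<And>x. h (- x) = h x"
  shows "(\<integral>\<^sup>+x. h x \<partial>lborel) = 2 * (\<integral>\<^sup>+x\<in>{0<..}. h x \<partial>lborel)"
proof -
  have "(\<integral>\<^sup>+x. h x \<partial>lborel) = (\<integral>\<^sup>+x. h x * indicator {0<..} x + h x * indicator {..<0} x \<partial>lborel)"
    using AE_lborel_singleton[of "0::real"]
    by (intro nn_integral_cong_AE, eventually_elim) (auto simp: indicator_def)
  also have "\<dots> = (\<integral>\<^sup>+x\<in>{0<..}. h x \<partial>lborel) + (\<integral>\<^sup>+x\<in>{..<0}. h x \<partial>lborel)"
    by (intro nn_integral_add) auto
  also have "(\<integral>\<^sup>+x\<in>{..<0}. h x \<partial>lborel) = ennreal \<bar>- 1\<bar> * (\<integral>\<^sup>+x. h (0 + (- 1) * x) * indicator {..<0} (0 + (- 1) * x) \<partial>lborel)"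
    by (rule nn_integral_real_affine) auto
  also have "\<dots> = (\<integral>\<^sup>+x\<in>{0<..}. h x \<partial>lborel)"
    by (simp, intro nn_integral_cong) (auto simp: even indicator_def)
  finally show ?thesis by (simp add: mult_2)
qed

text \<open>Substitute u = v^(2j) in the Gamma integral and double by evenness. The case
  \<open>j = k\<close> serves the Laplace transform, the case \<open>j = 1\<close> the comparison
  density |v| exp(-v^2).\<close>

lemma nn_integral_even_exp_power:
  fixes c :: real and j r :: nat
  assumes c: "c > 0" and j: "j \<ge> 1"
  shows "(\<integral>\<^sup>+v. ennreal (\<bar>v\<bar> * v ^ (2 * r) * exp (- c * v ^ (2 * j))) \<partial>lborel) =
    ennreal (Gamma (real (r + 1) / real j) * c powr (- (real (r + 1) / real j)) / real j)"
proof -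
  define s where "s = real (r + 1) / real j"
  have s: "s > 0" using j by (simp add: s_def)
  define I where "I = (\<integral>\<^sup>+v\<in>{0<..}. ennreal (\<bar>v\<bar> * v ^ (2 * r) * exp (- c * v ^ (2 * j))) \<partial>lborel)"
  have "ennreal (Gamma s * c powr (- s)) = (\<integral>\<^sup>+u\<in>{0<..}. ennreal (u powr (s - 1) * exp (- c * u)) \<partial>lborel)"
    by (rule nn_integral_gamma_scaled[OF s c, symmetric])
  also have "\<dots> = (\<integral>\<^sup>+v\<in>{0<..}. ennreal (\<bar>real (2 * j)\<bar> * v powr (real (2 * j) - 1) *
      ((v powr real (2 * j)) powr (s - 1) * exp (- c * (v powr real (2 * j))))) \<partial>lborel)"
    using j by (intro nn_integral_powr_substitution) auto
  also have "\<dots> = (\<integral>\<^sup>+v. ennreal (real (2 * j)) * (ennreal (\<bar>v\<bar> * v ^ (2 * r) * exp (- c * v ^ (2 * j))) * indicator {0<..} v) \<partial>lborel)"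
  proof (intro nn_integral_cong)
    fix v :: real
    show "ennreal (\<bar>real (2 * j)\<bar> * v powr (real (2 * j) - 1) *
      ((v powr real (2 * j)) powr (s - 1) * exp (- c * (v powr real (2 * j))))) * indicator {0<..} v =
      ennreal (real (2 * j)) * (ennreal (\<bar>v\<bar> * v ^ (2 * r) * exp (- c * v ^ (2 * j))) * indicator {0<..} v)"
    proof (cases "v > 0")
      case True
      have "v powr (real (2 * j) - 1) * (v powr real (2 * j)) powr (s - 1) = v powr (real (2 * j) - 1 + real (2 * j) * (s - 1))"
        by (simp add: powr_powr powr_add)
      also have "real (2 * j) - 1 + real (2 * j) * (s - 1) = real (2 * r + 1)"
        using j by (simp add: s_def field_simps)
      finally have "v powr (real (2 * j) - 1) * (v powr real (2 * j)) powr (s - 1) = v ^ (2 * r + 1)"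
        using True by (simp only: powr_realpow)
      then have "\<bar>real (2 * j)\<bar> * v powr (real (2 * j) - 1) *
          ((v powr real (2 * j)) powr (s - 1) * exp (- c * (v powr real (2 * j)))) =
          real (2 * j) * (\<bar>v\<bar> * v ^ (2 * r) * exp (- c * v ^ (2 * j)))"
        using True by (simp add: powr_realpow mult.assoc[symmetric] del: of_nat_mult)
      then show ?thesis using True by (simp only:) (simp add: ennreal_mult)
    qed simp
  qed
  also have "\<dots> = ennreal (real (2 * j)) * I"
    unfolding I_def by (intro nn_integral_cmult) auto
  finally have *: "ennreal (Gamma s * c powr (- s)) = ennreal (real j) * (2 * I)"
    by (simp add: ennreal_mult mult.assoc mult.left_commute[of 2])
  have "(\<integral>\<^sup>+v. ennreal (\<bar>v\<bar> * v ^ (2 * r) * exp (- c * v ^ (2 * j))) \<partial>lborel) = 2 * I"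
    unfolding I_def by (intro nn_integral_even) auto
  also have "\<dots> = ennreal (1 / real j) * (ennreal (real j) * (2 * I))"
    using j by (simp add: mult.assoc[symmetric] ennreal_mult'[symmetric])
  also have "\<dots> = ennreal (Gamma s * c powr (- s) / real j)"
    unfolding *[symmetric] using Gamma_real_pos[OF s] by (simp add: ennreal_mult'[symmetric])
  finally show ?thesis unfolding s_def .
qed

text \<open>Odd moments exist because |v^r| \<le> 1 + v^(2r), and they vanish because reflection
  preserves the measure.\<close>

lemma density_even_moments:
  fixes e :: "real \<Rightarrow> ennreal" and c :: "nat \<Rightarrow> real"
  assumes [measurable]: "e \<in> borel_measurable borel" and even: "\<And>v. e (- v) = e v"
    and mom: "\<And>r. (\<integral>\<^sup>+v. e v * ennreal (v ^ (2 * r)) \<partial>lborel) = ennreal (c r)" "\<And>r. 0 \<le> c r"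
  shows "has_bochner_integral (density lborel e) (\<lambda>v. v ^ r) (if even r then c (r div 2) else 0)"
proof -
  let ?M = "density lborel e"
  have I2: "(\<integral>\<^sup>+v. ennreal (v ^ (2 * r)) \<partial>?M) = ennreal (c r)" for r
    by (subst nn_integral_density) (use mom in auto)
  have ev: "has_bochner_integral ?M (\<lambda>v. v ^ (2 * r)) (c r)" for r
    using I2[of r] mom(2)[of r] by (intro has_bochner_integral_nn_integral) auto
  show ?thesis
  proof (cases "even r")
    case True
    then show ?thesis using ev[of "r div 2"] by simp
  next
    case False
    have int: "integrable ?M (\<lambda>v. v ^ r)"
    proof (rule Bochner_Integration.integrable_bound)
      show "integrable ?M (\<lambda>v. v ^ (2 * 0) + v ^ (2 * r))"
        using ev[of 0] ev[of r] by (intro Bochner_Integration.integrable_add) (auto simp: has_bochner_integral_iff)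
      have "norm (v ^ r) \<le> norm (v ^ (2 * 0) + v ^ (2 * r))" for v :: real
      proof -
        have "2 * \<bar>v ^ r\<bar> \<le> 1 + (v ^ r)\<^sup>2"
          using sum_squares_bound[of 1 "\<bar>v ^ r\<bar>"] by simp
        moreover have "v ^ (2 * r) = (v ^ r)\<^sup>2" by (simp only: power_mult[symmetric] mult.commute)
        ultimately have "\<bar>v ^ r\<bar> \<le> v ^ (2 * 0) + v ^ (2 * r)"
          using zero_le_power2[of "v ^ r"] abs_ge_zero[of "v ^ r"] by simp
        then show ?thesis by simp
      qed
      then show "AE v in ?M. norm (v ^ r) \<le> norm (v ^ (2 * 0) + v ^ (2 * r))"
        by (intro AE_I2)
    qed auto
    have "distr ?M borel uminus = ?M"
    proof (rule measure_eqI)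
      fix A assume "A \<in> sets (distr ?M borel uminus)"
      then have [measurable]: "A \<in> sets borel" by simp
      have [measurable]: "uminus -` A \<in> sets borel"
        using measurable_sets[of uminus borel borel A] by simp
      have "emeasure (distr ?M borel uminus) A = (\<integral>\<^sup>+v. e v * indicator (uminus -` A) v \<partial>lborel)"
        by (subst emeasure_distr) (auto simp: emeasure_density)
      also have "\<dots> = ennreal \<bar>- 1\<bar> * (\<integral>\<^sup>+v. e (0 + (- 1) * v) * indicator (uminus -` A) (0 + (- 1) * v) \<partial>lborel)"
        by (rule nn_integral_real_affine) auto
      also have "\<dots> = (\<integral>\<^sup>+v. e v * indicator A v \<partial>lborel)"
        by (simp add: even, intro nn_integral_cong) (auto simp: indicator_def)
      finally show "emeasure (distr ?M borel uminus) A = emeasure ?M A"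
        by (simp add: emeasure_density)
    qed simp
    then have "(\<integral>v. v ^ r \<partial>?M) = (\<integral>v. v ^ r \<partial>distr ?M borel uminus)" by simp
    also have "\<dots> = (\<integral>v. (- v) ^ r \<partial>?M)" by (rule integral_distr) auto
    also have "\<dots> = - (\<integral>v. v ^ r \<partial>?M)" using False by simp
    finally show ?thesis using int False by (simp add: has_bochner_integral_iff)
  qed
qed


text \<open>The transform at the integer n is the n-th moment of exp(-X), a number in [0, 1], so the
  Taylor criterion holds; -ln then recovers X.\<close>

lemma laplace_unique:
  fixes \<mu> \<nu> :: "real measure"
  assumes \<mu>: "real_distribution \<mu>" "AE x in \<mu>. 0 < x" and \<nu>: "real_distribution \<nu>" "AE x in \<nu>. 0 < x"
    and eq: "\<And>n::nat. (\<integral>\<^sup>+x. ennreal (exp (- real n * x)) \<partial>\<mu>) = (\<integral>\<^sup>+x. ennreal (exp (- real n * x)) \<partial>\<nu>)"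
  shows "\<mu> = \<nu>"
proof -
  define m where "m = (\<lambda>n. enn2real (\<integral>\<^sup>+x. ennreal (exp (- real n * x)) \<partial>\<mu>))"
  have key: "real_distribution (distr \<rho> borel (\<lambda>x. exp (- x)))"
      "has_bochner_integral (distr \<rho> borel (\<lambda>x. exp (- x))) (\<lambda>x. x ^ n) (m n)" "0 \<le> m n" "m n \<le> 1"
      "distr (distr \<rho> borel (\<lambda>x. exp (- x))) borel (\<lambda>x. - ln x) = \<rho>"
    if \<rho>: "real_distribution \<rho>" "AE x in \<rho>. 0 < x"
      and r: "\<And>n::nat. (\<integral>\<^sup>+x. ennreal (exp (- real n * x)) \<partial>\<rho>) = (\<integral>\<^sup>+x. ennreal (exp (- real n * x)) \<partial>\<mu>)" for \<rho> n
  proof -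
    interpret real_distribution \<rho> by (rule \<rho>)
    show "real_distribution (distr \<rho> borel (\<lambda>x. exp (- x)))"
      by (intro real_distribution_distr) simp
    have "(\<integral>\<^sup>+x. ennreal (exp (- real n * x)) \<partial>\<rho>) \<le> (\<integral>\<^sup>+x. 1 \<partial>\<rho>)"
      using \<rho>(2) by (intro nn_integral_mono_AE, eventually_elim) auto
    also have "\<dots> = 1" using emeasure_space_1 by simp
    finally have le: "(\<integral>\<^sup>+x. ennreal (exp (- real n * x)) \<partial>\<mu>) \<le> 1" unfolding r .
    then have fin: "(\<integral>\<^sup>+x. ennreal (exp (- real n * x)) \<partial>\<rho>) = ennreal (m n)"
      unfolding m_def r by (simp add: less_le_trans[OF _ le] top.not_eq_extremum order_le_less_trans)
    show "0 \<le> m n" by (simp add: m_def)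
    show "m n \<le> 1" using le enn2real_mono[OF le] unfolding m_def by simp
    have "has_bochner_integral \<rho> (\<lambda>x. exp (- real n * x)) (m n)"
      using fin by (intro has_bochner_integral_nn_integral) (auto simp: m_def)
    then have "has_bochner_integral \<rho> (\<lambda>x. exp (- x) ^ n) (m n)"
      by (simp add: exp_of_nat_mult[symmetric])
    then show "has_bochner_integral (distr \<rho> borel (\<lambda>x. exp (- x))) (\<lambda>x. x ^ n) (m n)"
      by (intro has_bochner_integral_distr) auto
    have "distr (distr \<rho> borel (\<lambda>x. exp (- x))) borel (\<lambda>x. - ln x) = distr \<rho> borel (\<lambda>x. x)"
      by (subst distr_distr) (auto simp: o_def)
    also have "\<dots> = \<rho>"
      by (rule distr_id2) simp
    finally show "distr (distr \<rho> borel (\<lambda>x. exp (- x))) borel (\<lambda>x. - ln x) = \<rho>" .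
  qed
  note K\<mu> = key[OF \<mu> refl] and K\<nu> = key[OF \<nu> eq[symmetric]]
  have "distr \<mu> borel (\<lambda>x. exp (- x)) = distr \<nu> borel (\<lambda>x. exp (- x))"
  proof (rule real_distribution_moments_unique[OF K\<mu>(1) K\<nu>(1) K\<mu>(2) K\<nu>(2)])
    fix t :: real
    have "(\<lambda>n. t ^ n / fact n) \<longlonglongrightarrow> 0"
      using summable_LIMSEQ_zero[OF summable_exp[of t]] by (simp add: field_simps)
    from LIMSEQ_subseq_LIMSEQ[OF this, of "\<lambda>n. 2 * n"]
    have 1: "(\<lambda>n. t ^ (2 * n) / fact (2 * n)) \<longlonglongrightarrow> 0"
      by (simp add: strict_mono_def o_def)
    have "norm (t ^ (2 * n) * m (2 * n) / fact (2 * n)) \<le> t ^ (2 * n) / fact (2 * n)" for n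
      using K\<mu>(3,4)[of "2 * n"] mult_left_mono[of "m (2 * n)" 1 "t ^ (2 * n)"]
      by (simp add: abs_mult divide_right_mono)
    then show "(\<lambda>n. t ^ (2 * n) * m (2 * n) / fact (2 * n)) \<longlonglongrightarrow> 0"
      by (intro Lim_null_comparison[OF always_eventually 1] allI)
  qed
  then show ?thesis using K\<mu>(5) K\<nu>(5) by metis
qed


section \<open>The candidate stable density and its Laplace transform\<close>

definition block_limit_moment :: "nat \<Rightarrow> nat \<Rightarrow> real" where
  "block_limit_moment k r = fact (r + 1) * (Gamma (1 + 1 / real k) / Gamma (1 + real (r + 1) / real k))"

text \<open>The left side is r! times the limit of the scaled rising factorial moments. Gamma(1 + s)
  = s Gamma(s) at s = 1/k and s = (r + 1)/k converts it to the form in the theorem.\<close>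

lemma block_limit_moment_alt:
  assumes k: "k \<ge> 1"
  shows "(Gamma (1 / real k) / Gamma (real (r + 1) / real k)) * fact r = block_limit_moment k r"
proof -
  define s where "s = real (r + 1) / real k"
  have s: "s > 0" using k by (simp add: s_def)
  have a: "Gamma (1 + 1 / real k) = 1 / real k * Gamma (1 / real k)"
    using k Gamma_plus1[of "1 / real k"] nonpos_Ints_nonpos[of "1 / real k"] by (auto simp: add.commute)
  have b: "Gamma (1 + s) = s * Gamma s"
    using s Gamma_plus1[of s] nonpos_Ints_nonpos[of s] by (auto simp: add.commute)
  have "block_limit_moment k r = fact (r + 1) * (1 / real k) / s * (Gamma (1 / real k) / Gamma s)"
    unfolding block_limit_moment_def s_def[symmetric] a b by simp
  also have "fact (r + 1) * (1 / real k) / s = fact (r + 1) / real (r + 1)"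
    using k by (simp add: s_def del: fact_Suc of_nat_Suc)
  also have "\<dots> = fact r" by (simp del: of_nat_Suc)
  finally show ?thesis by (simp add: s_def)
qed

definition stable_density :: "nat \<Rightarrow> real \<Rightarrow> real" where
  "stable_density k y =
    (if 0 < y then limit_density k (y powr (- 1 / real k)) / (Gamma (1 / real k) * y) else 0)"

lemma borel_measurable_limit_density [measurable]:
  assumes "k \<ge> 2"
  shows "limit_density k \<in> borel_measurable borel"
  using isCont_limit_density[OF assms] by (intro borel_measurable_continuous_onI continuous_at_imp_continuous_on) auto

lemma borel_measurable_stable_density:
  assumes "k \<ge> 2"
  shows "stable_density k \<in> borel_measurable borel"
proof -
  note [measurable] = borel_measurable_limit_density[OF assms]
  show ?thesis unfolding stable_density_def[abs_def] by measurable
qed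

lemma stable_density_nonneg:
  assumes "k \<ge> 2"
  shows "0 \<le> stable_density k y"
  using assms limit_density_nonneg[OF assms, of "y powr (- 1 / real k)"] Gamma_real_pos[of "1 / real k"]
  by (auto simp: stable_density_def intro!: divide_nonneg_nonneg)

text \<open>Valued in \<open>ennreal\<close>, so that integrals can be interchanged before
  finiteness or total mass 1 is known.\<close>

definition stable_laplace :: "nat \<Rightarrow> real \<Rightarrow> ennreal" where
  "stable_laplace k t = (\<integral>\<^sup>+y. ennreal (exp (- t * y) * stable_density k y) \<partial>lborel)"

text \<open>The substitution y = z^(-k) returns to \<open>limit_density\<close>; k/z is what the
  Jacobian and the factor 1/y of the candidate leave.\<close>

lemma stable_laplace_eq_limit_density:
  assumes k: "k \<ge> 2"
  shows "stable_laplace k t =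
    (\<integral>\<^sup>+z\<in>{0<..}. ennreal (real k / Gamma (1 / real k) * (limit_density k z / z) * exp (- t * z powr (- real k))) \<partial>lborel)"
proof -
  note [measurable] = borel_measurable_stable_density[OF k]
  have "stable_laplace k t = (\<integral>\<^sup>+y\<in>{0<..}. ennreal (exp (- t * y) * stable_density k y) \<partial>lborel)"
    unfolding stable_laplace_def by (intro nn_integral_cong) (auto simp: indicator_def stable_density_def)
  also have "\<dots> = (\<integral>\<^sup>+z\<in>{0<..}. ennreal (\<bar>- real k\<bar> * z powr (- real k - 1) *
      (exp (- t * z powr (- real k)) * stable_density k (z powr (- real k)))) \<partial>lborel)"
    using k by (intro nn_integral_powr_substitution mult_nonneg_nonneg stable_density_nonneg) auto
  also have "\<dots> = (\<integral>\<^sup>+z\<in>{0<..}. ennreal (real k / Gamma (1 / real k) * (limit_density k z / z) * exp (- t * z powr (- real k))) \<partial>lborel)"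
  proof (intro nn_integral_cong)
    fix z :: real
    show "ennreal (\<bar>- real k\<bar> * z powr (- real k - 1) *
        (exp (- t * z powr (- real k)) * stable_density k (z powr (- real k)))) * indicator {0<..} z =
      ennreal (real k / Gamma (1 / real k) * (limit_density k z / z) * exp (- t * z powr (- real k))) * indicator {0<..} z"
    proof (cases "0 < z")
      case True
      have "(z powr (- real k)) powr (- 1 / real k) = z"
        using True k by (simp add: powr_powr)
      then have "stable_density k (z powr (- real k)) = limit_density k z / (Gamma (1 / real k) * z powr (- real k))"
        using True by (simp add: stable_density_def)
      moreover have "z powr (- real k - 1) = z powr (- real k) / z"
        using True by (simp add: powr_diff)
      ultimately have "\<bar>- real k\<bar> * z powr (- real k - 1) *
        (exp (- t * z powr (- real k)) * stable_density k (z powr (- real k))) =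
        real k / Gamma (1 / real k) * (limit_density k z / z) * exp (- t * z powr (- real k))"
        using True by (simp add: mult_ac)
      then show ?thesis by simp
    qed simp
  qed
  finally show ?thesis .
qed

text \<open>By Tonelli the integral over v comes first. With s = (r + 1)/k it equals Gamma(s) z^(r +
  1) / k, which leaves the r-th moment of \<open>limit_density\<close>; there Gamma(s) cancels and
  r! remains.\<close>

lemma stable_laplace_moments:
  assumes k: "k \<ge> 2"
    and mom: "\<And>r. (\<integral>\<^sup>+x\<in>{0<..}. ennreal (x ^ r * limit_density k x) \<partial>lborel) = ennreal (block_limit_moment k r)"
  shows "(\<integral>\<^sup>+v. ennreal \<bar>v\<bar> * stable_laplace k (v ^ (2 * k)) * ennreal (v ^ (2 * r)) \<partial>lborel) = ennreal (fact r)"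
proof -
  let ?e = "\<lambda>v z. \<bar>v\<bar> * v ^ (2 * r) * exp (- (z powr (- real k)) * v ^ (2 * k))"
  let ?L = "\<lambda>v. stable_laplace k (v ^ (2 * k))"
  note [measurable] = borel_measurable_limit_density[OF k]
  define C where "C = real k / Gamma (1 / real k)"
  define s where "s = real (r + 1) / real k"
  let ?c = "\<lambda>z. C * (limit_density k z / z)"
  have G: "Gamma (1 / real k) > 0" using k by (intro Gamma_real_pos) auto
  have C: "C > 0" using G k by (simp add: C_def)
  have s: "s > 0" using k by (simp add: s_def)
  have "(\<integral>\<^sup>+v. ennreal \<bar>v\<bar> * ?L v * ennreal (v ^ (2 * r)) \<partial>lborel) =
    (\<integral>\<^sup>+v. (\<integral>\<^sup>+z. (ennreal (?c z) * indicator {0<..} z) *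
        ennreal (?e v z) \<partial>lborel) \<partial>lborel)"
  proof (intro nn_integral_cong)
    fix v :: real
    have "ennreal \<bar>v\<bar> * ?L v * ennreal (v ^ (2 * r)) =
        ennreal (\<bar>v\<bar> * v ^ (2 * r)) * ?L v"
    proof -
      have "ennreal (\<bar>v\<bar> * v ^ (2 * r)) = ennreal \<bar>v\<bar> * ennreal (v ^ (2 * r))" by (intro ennreal_mult) auto
      then show ?thesis by (simp only: mult_ac)
    qed
    also have "\<dots> = (\<integral>\<^sup>+z. ennreal (\<bar>v\<bar> * v ^ (2 * r)) * (ennreal (?c z * exp (- (v ^ (2 * k)) * z powr (- real k)))
         * indicator {0<..} z) \<partial>lborel)"
      unfolding stable_laplace_eq_limit_density[OF k] C_def by (intro nn_integral_cmult[symmetric]) auto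
    also have "\<dots> = (\<integral>\<^sup>+z. (ennreal (?c z) * indicator {0<..} z) *
        ennreal (?e v z) \<partial>lborel)"
    proof (intro nn_integral_cong)
      fix z :: real
      have "ennreal (\<bar>v\<bar> * v ^ (2 * r)) * ennreal (?c z * exp (- (v ^ (2 * k)) * z powr (- real k))) =
          ennreal (?c z) * ennreal (?e v z)"
        if "z > 0"
      proof -
        have a: "0 \<le> \<bar>v\<bar> * v ^ (2 * r)" by simp
        have b: "0 \<le> ?c z"
          using C limit_density_nonneg[OF k that] that by simp
        show ?thesis
          unfolding ennreal_mult'[OF a, symmetric] ennreal_mult'[OF b, symmetric] by (simp add: mult_ac)
      qed
      then show "ennreal (\<bar>v\<bar> * v ^ (2 * r)) * (ennreal (?c z * exp (- (v ^ (2 * k)) * z powr (- real k)))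
         * indicator {0<..} z) = (ennreal (?c z) * indicator {0<..} z) *
        ennreal (?e v z)"
        by (auto simp: indicator_def)
    qed
    finally show "ennreal \<bar>v\<bar> * ?L v * ennreal (v ^ (2 * r)) = \<dots>" .
  qed
  also have "\<dots> = (\<integral>\<^sup>+z. (\<integral>\<^sup>+v. (ennreal (?c z) * indicator {0<..} z) *
        ennreal (?e v z) \<partial>lborel) \<partial>lborel)"
    by (intro lborel_pair.Fubini') measurable
  also have "\<dots> = (\<integral>\<^sup>+z. ennreal (Gamma s / Gamma (1 / real k)) * (ennreal (z ^ r * limit_density k z) * indicator {0<..} z) \<partial>lborel)"
  proof (intro nn_integral_cong)
    fix z :: real
    show "(\<integral>\<^sup>+v. (ennreal (?c z) * indicator {0<..} z) *
        ennreal (?e v z) \<partial>lborel) =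
      ennreal (Gamma s / Gamma (1 / real k)) * (ennreal (z ^ r * limit_density k z) * indicator {0<..} z)"
    proof (cases "z > 0")
      case True
      have "(z powr (- real k)) powr (- s) = z powr real (r + 1)"
        using k by (simp add: powr_powr s_def add.commute)
      also have "\<dots> = z ^ r * z" using True by (subst powr_realpow) auto
      finally have zs: "(z powr (- real k)) powr (- s) = z ^ r * z" .
      have "(\<integral>\<^sup>+v. ennreal (?c z) *
          ennreal (?e v z) \<partial>lborel) =
        ennreal (?c z) * ennreal (Gamma s * (z powr (- real k)) powr (- s) / real k)"
        using True k nn_integral_even_exp_power[of "z powr (- real k)" k r]
        by (subst nn_integral_cmult) (auto simp: s_def)
      also have "\<dots> = ennreal (?c z * (Gamma s * (z ^ r * z) / real k))"
        unfolding zs using True C limit_density_nonneg[OF k True] by (intro ennreal_mult'[symmetric]) auto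
      also have "?c z * (Gamma s * (z ^ r * z) / real k) =
          Gamma s / Gamma (1 / real k) * (z ^ r * limit_density k z)"
        using True k by (simp add: C_def)
      also have "ennreal \<dots> = ennreal (Gamma s / Gamma (1 / real k)) * ennreal (z ^ r * limit_density k z)"
        using G Gamma_real_pos[OF s] by (intro ennreal_mult') simp
      finally show ?thesis using True by (simp only: indicator_simps greaterThan_iff mult_1_right simp_thms)
    qed simp
  qed
  also have "\<dots> = ennreal (Gamma s / Gamma (1 / real k)) * ennreal (block_limit_moment k r)"
    unfolding mom[symmetric] by (intro nn_integral_cmult) measurable
  also have "\<dots> = ennreal (Gamma s / Gamma (1 / real k) * block_limit_moment k r)"
    using G Gamma_real_pos[OF s] by (intro ennreal_mult'[symmetric]) simp
  also have "Gamma s / Gamma (1 / real k) * block_limit_moment k r = fact r"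
  proof -
    have k1: "k \<ge> 1" using k by simp
    show ?thesis
      unfolding block_limit_moment_alt[OF k1, symmetric] s_def[symmetric]
      using G Gamma_real_pos[OF s] by simp
  qed
  finally show ?thesis .
qed


lemma borel_measurable_stable_laplace [measurable]:
  assumes k: "k \<ge> 2"
  shows "stable_laplace k \<in> borel_measurable borel"
proof -
  note [measurable] = borel_measurable_stable_density[OF k]
  show ?thesis unfolding stable_laplace_def[abs_def]
    by (rule lborel.borel_measurable_nn_integral) (simp add: split_beta')
qed

lemma stable_laplace_antimono:
  assumes "k \<ge> 2" "s \<le> t"
  shows "stable_laplace k t \<le> stable_laplace k s"
  unfolding stable_laplace_def
proof (intro nn_integral_mono ennreal_leI)
  fix y
  show "exp (- t * y) * stable_density k y \<le> exp (- s * y) * stable_density k y"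
  proof (cases "y > 0")
    case True
    then show ?thesis using assms stable_density_nonneg[OF assms(1)] by (intro mult_right_mono) auto
  qed (simp add: stable_density_def)
qed

text \<open>The square of n! is at most (2n)!, because the central binomial coefficient is at least
  1. This is the uniqueness criterion for a law whose moment of order 2n is n!.\<close>

lemma factorial_ratio_tendsto_0:
  fixes t :: real
  shows "(\<lambda>n. t ^ (2 * n) * fact n / fact (2 * n)) \<longlonglongrightarrow> 0"
proof (rule Lim_null_comparison[OF always_eventually], rule allI)
  fix n :: nat
  have "fact n * fact n * ((2 * n) choose n) = (fact (2 * n) :: nat)"
    using binomial_fact_lemma[of n "2 * n"] by simp
  moreover have "(2 * n) choose n \<ge> 1" by (simp add: Suc_leI)
  ultimately have "fact n * fact n \<le> (fact (2 * n) :: nat)"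
    by (metis mult.right_neutral mult_le_mono2)
  then have f: "fact n * fact n \<le> (fact (2 * n) :: real)"
    by (metis of_nat_fact of_nat_le_iff of_nat_mult)
  have "fact n / fact (2 * n) \<le> (1 / fact n :: real)"
    using f by (simp add: field_simps)
  then show "norm (t ^ (2 * n) * fact n / fact (2 * n)) \<le> (t\<^sup>2) ^ n / fact n"
    using mult_left_mono[of "fact n / fact (2 * n)" "1 / fact n :: real" "(t\<^sup>2) ^ n"] by (simp add: power_mult)
next
  show "(\<lambda>n. (t\<^sup>2) ^ n / fact n) \<longlonglongrightarrow> 0"
    using summable_LIMSEQ_zero[OF summable_exp[of "t\<^sup>2"]] by (simp add: field_simps)
qed

lemma real_distribution_density:
  assumes [measurable]: "e \<in> borel_measurable borel" and "(\<integral>\<^sup>+x. e x \<partial>lborel) = 1"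
  shows "real_distribution (density lborel e)"
proof -
  have "prob_space (density lborel e)"
    using assms by (intro prob_spaceI) (simp add: emeasure_density)
  then show ?thesis by (simp add: real_distribution_def real_distribution_axioms_def)
qed

text \<open>Equality of the two measures gives the formula only for almost every v. The transform is
  antitone and the claimed value continuous, so nearby good points squeeze the transform at every t
  > 0.\<close>

lemma stable_laplace_pos:
  assumes k: "k \<ge> 2"
    and mom: "\<And>r. (\<integral>\<^sup>+x\<in>{0<..}. ennreal (x ^ r * limit_density k x) \<partial>lborel) = ennreal (block_limit_moment k r)"
    and t: "t > 0"
  shows "stable_laplace k t = ennreal (exp (- (t powr (1 / real k))))"
proof -
  note [measurable] = borel_measurable_stable_laplace[OF k]
  define e1 where "e1 = (\<lambda>v. ennreal \<bar>v\<bar> * stable_laplace k (v ^ (2 * k)))"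
  define e2 where "e2 = (\<lambda>v::real. ennreal (\<bar>v\<bar> * exp (- (v\<^sup>2))))"
  have [measurable]: "e1 \<in> borel_measurable borel" "e2 \<in> borel_measurable borel"
    unfolding e1_def e2_def by measurable
  have m1: "(\<integral>\<^sup>+v. e1 v * ennreal (v ^ (2 * r)) \<partial>lborel) = ennreal (fact r)" for r
    unfolding e1_def by (rule stable_laplace_moments[OF k mom])
  have m2: "(\<integral>\<^sup>+v. e2 v * ennreal (v ^ (2 * r)) \<partial>lborel) = ennreal (fact r)" for r
  proof -
    have "(\<integral>\<^sup>+v. e2 v * ennreal (v ^ (2 * r)) \<partial>lborel) =
        (\<integral>\<^sup>+v. ennreal (\<bar>v\<bar> * v ^ (2 * r) * exp (- 1 * v ^ (2 * 1))) \<partial>lborel)"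
      unfolding e2_def by (intro nn_integral_cong, subst ennreal_mult'[symmetric]) (simp_all add: mult_ac)
    also have "\<dots> = ennreal (fact r)"
      using nn_integral_even_exp_power[of 1 1 r] Gamma_fact[of r, where ?'a = real] by (simp add: add.commute)
    finally show ?thesis .
  qed
  have ev: "e1 (- v) = e1 v" "e2 (- v) = e2 v" for v
    by (simp_all add: e1_def e2_def)
  have "density lborel e1 = density lborel e2"
  proof (rule real_distribution_moments_unique)
    show "real_distribution (density lborel e1)" "real_distribution (density lborel e2)"
      using m1[of 0] m2[of 0] by (auto intro!: real_distribution_density)
    show "has_bochner_integral (density lborel e1) (\<lambda>x. x ^ r) (if even r then fact (r div 2) else 0)"
      "has_bochner_integral (density lborel e2) (\<lambda>x. x ^ r) (if even r then fact (r div 2) else 0)" for r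
      using m1 m2 ev by (intro density_even_moments; simp)+
    show "(\<lambda>n. t ^ (2 * n) * (if even (2 * n) then fact (2 * n div 2) else 0) / fact (2 * n)) \<longlonglongrightarrow> 0" for t :: real
      using factorial_ratio_tendsto_0[of t] by simp
  qed
  then have "AE v in lborel. e1 v = e2 v"
    by (subst (asm) sigma_finite_measure.density_unique_iff[OF lborel.sigma_finite_measure_axioms]) auto
  then have ae: "AE v in lborel. v \<noteq> 0 \<longrightarrow> stable_laplace k (v ^ (2 * k)) = ennreal (exp (- (v\<^sup>2)))"
  proof eventually_elim
    case (elim v)
    show ?case
    proof
      assume "v \<noteq> 0"
      have "ennreal \<bar>v\<bar> * stable_laplace k (v ^ (2 * k)) = ennreal \<bar>v\<bar> * ennreal (exp (- (v\<^sup>2)))"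
        using elim by (simp add: e1_def e2_def ennreal_mult)
      then show "stable_laplace k (v ^ (2 * k)) = ennreal (exp (- (v\<^sup>2)))"
        using \<open>v \<noteq> 0\<close> by (subst (asm) ennreal_mult_cancel_left) auto
    qed
  qed
  \<comment> \<open>The exceptional set is null and hence contains no interval.\<close>
  have dense: "\<exists>v. a < v \<and> v < b \<and> stable_laplace k (v ^ (2 * k)) = ennreal (exp (- (v\<^sup>2)))"
    if ab: "0 \<le> a" "a < b" for a b :: real
  proof (rule ccontr)
    assume "\<not> ?thesis"
    then have "AE v in lborel. v \<notin> {a<..<b}"
      using ae ab by (auto elim!: eventually_mono)
    then have "emeasure lborel {a<..<b} = 0"
      by (subst (asm) AE_iff_measurable[where N = "{a<..<b}"]) auto
    then show False using ab by simp
  qed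
  define v where "v = t powr (1 / real (2 * k))"
  have v: "v > 0" using t by (simp add: v_def)
  have "v ^ (2 * k) = v powr real (2 * k)" using v by (simp only: powr_realpow)
  then have vk: "v ^ (2 * k) = t" using t k by (simp add: v_def powr_powr)
  have "v\<^sup>2 = v powr real 2" using v by (simp only: powr_realpow)
  then have v2: "v\<^sup>2 = t powr (1 / real k)" using k by (simp add: v_def powr_powr)
  have "stable_laplace k (v ^ (2 * k)) = ennreal (exp (- (v\<^sup>2)))"
  proof (rule antisym)
    show "stable_laplace k (v ^ (2 * k)) \<le> ennreal (exp (- (v\<^sup>2)))"
    proof (rule tendsto_lowerbound)
      show "((\<lambda>a. ennreal (exp (- (a\<^sup>2)))) \<longlongrightarrow> ennreal (exp (- (v\<^sup>2)))) (at_left v)"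
        by (intro tendsto_ennrealI tendsto_intros)
      show "eventually (\<lambda>a. stable_laplace k (v ^ (2 * k)) \<le> ennreal (exp (- (a\<^sup>2)))) (at_left v)"
        using eventually_at_left_real[OF v]
      proof eventually_elim
        case (elim a)
        then obtain b where b: "a < b" "b < v" "stable_laplace k (b ^ (2 * k)) = ennreal (exp (- (b\<^sup>2)))"
          using dense[of a v] by auto
        have "stable_laplace k (v ^ (2 * k)) \<le> stable_laplace k (b ^ (2 * k))"
          using b elim by (intro stable_laplace_antimono[OF k] power_mono) auto
        also have "\<dots> \<le> ennreal (exp (- (a\<^sup>2)))"
          unfolding b(3) using b elim by (intro ennreal_leI) (auto intro!: power_mono)
        finally show ?case .
      qed
    qed simp
    show "ennreal (exp (- (v\<^sup>2))) \<le> stable_laplace k (v ^ (2 * k))"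
    proof (rule tendsto_upperbound)
      show "((\<lambda>a. ennreal (exp (- (a\<^sup>2)))) \<longlongrightarrow> ennreal (exp (- (v\<^sup>2)))) (at_right v)"
        by (intro tendsto_ennrealI tendsto_intros)
      show "eventually (\<lambda>a. ennreal (exp (- (a\<^sup>2))) \<le> stable_laplace k (v ^ (2 * k))) (at_right v)"
        using eventually_at_right_less[of v]
      proof eventually_elim
        case (elim a)
        then obtain b where b: "v < b" "b < a" "stable_laplace k (b ^ (2 * k)) = ennreal (exp (- (b\<^sup>2)))"
          using dense[of v a] v by auto
        have "ennreal (exp (- (a\<^sup>2))) \<le> stable_laplace k (b ^ (2 * k))"
          unfolding b(3) using b elim v by (intro ennreal_leI) (auto intro!: power_mono)
        also have "\<dots> \<le> stable_laplace k (v ^ (2 * k))"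
          using b elim v by (intro stable_laplace_antimono[OF k] power_mono) auto
        finally show ?case .
      qed
    qed simp
  qed
  then show ?thesis by (simp only: vk v2)
qed

text \<open>The squeeze uses points on both sides of v > 0, so t = 0 is reached separately, by
  monotone convergence along 1/(n + 1). The value 1 says that \<open>stable_density\<close> has
  total mass 1.\<close>

lemma stable_laplace_0:
  assumes k: "k \<ge> 2"
    and mom: "\<And>r. (\<integral>\<^sup>+x\<in>{0<..}. ennreal (x ^ r * limit_density k x) \<partial>lborel) = ennreal (block_limit_moment k r)"
  shows "stable_laplace k 0 = 1"
proof -
  note [measurable] = borel_measurable_stable_density[OF k]
  have "(\<lambda>n. stable_laplace k (1 / real (Suc n))) \<longlonglongrightarrow> stable_laplace k 0"
    unfolding stable_laplace_def
  proof (rule nn_integral_LIMSEQ)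
    show "incseq (\<lambda>n y. ennreal (exp (- (1 / real (Suc n)) * y) * stable_density k y))"
    proof (intro incseq_SucI le_funI ennreal_leI)
      fix n y
      show "exp (- (1 / real (Suc n)) * y) * stable_density k y \<le> exp (- (1 / real (Suc (Suc n))) * y) * stable_density k y"
      proof (cases "y > 0")
        case True
        then show ?thesis
          using stable_density_nonneg[OF k] by (intro mult_right_mono) (auto simp: frac_le divide_le_cancel)
      qed (simp add: stable_density_def)
    qed
    fix y
    have "(\<lambda>n. 1 / real (Suc n)) \<longlonglongrightarrow> 0"
      using LIMSEQ_inverse_real_of_nat by (simp add: inverse_eq_divide)
    then have "(\<lambda>n. - (1 / real (Suc n)) * y) \<longlonglongrightarrow> - 0 * y"
      by (intro tendsto_intros)
    then show "(\<lambda>n. ennreal (exp (- (1 / real (Suc n)) * y) * stable_density k y)) \<longlonglongrightarrow> ennreal (exp (- 0 * y) * stable_density k y)"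
      by (rule tendsto_ennrealI[OF tendsto_mult[OF tendsto_exp tendsto_const]])
  qed auto
  moreover have "(\<lambda>n. stable_laplace k (1 / real (Suc n))) \<longlonglongrightarrow> ennreal (exp (- 0))"
  proof -
    have "(\<lambda>n. (1 / real (Suc n)) powr (1 / real k)) \<longlonglongrightarrow> 0"
      using k by real_asymp
    then have "(\<lambda>n. ennreal (exp (- ((1 / real (Suc n)) powr (1 / real k))))) \<longlonglongrightarrow> ennreal (exp (- 0))"
      by (intro tendsto_intros)
    then show ?thesis by (simp only: stable_laplace_pos[OF k mom] zero_less_divide_iff of_nat_0_less_iff zero_less_Suc zero_less_one simp_thms)
  qed
  ultimately have "stable_laplace k 0 = ennreal (exp (- 0))" by (rule LIMSEQ_unique)
  then show ?thesis by simp
qed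

lemma nn_integral_stable:
  assumes k: "k \<ge> 2"
  shows "(\<integral>\<^sup>+y. ennreal (exp (- t * y)) \<partial>density lborel (\<lambda>x. ennreal (stable_density k x))) = stable_laplace k t"
proof -
  note [measurable] = borel_measurable_stable_density[OF k]
  show ?thesis
    unfolding stable_laplace_def by (subst nn_integral_density)
      (auto simp: ennreal_mult'[symmetric] stable_density_nonneg[OF k] mult.commute intro!: nn_integral_cong)
qed

lemma positive_stable_density_stable_density:
  assumes k: "k \<ge> 2"
    and mom: "\<And>r. (\<integral>\<^sup>+x\<in>{0<..}. ennreal (x ^ r * limit_density k x) \<partial>lborel) = ennreal (block_limit_moment k r)"
  shows "positive_stable_density (1 / real k) (stable_density k)"
proof -
  note [measurable] = borel_measurable_stable_density[OF k]
  define \<alpha> where "\<alpha> = 1 / real k"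
  have \<alpha>: "\<alpha> > 0" using k by (simp add: \<alpha>_def)
  define \<mu> where "\<mu> = density lborel (\<lambda>x. ennreal (stable_density k x))"
  have L: "(\<integral>\<^sup>+y. ennreal (exp (- t * y)) \<partial>\<mu>) = ennreal (exp (- (t powr \<alpha>)))" if "t \<ge> 0" for t
    using stable_laplace_pos[OF k mom, of t] stable_laplace_0[OF k mom] that
    unfolding \<mu>_def nn_integral_stable[OF k] \<alpha>_def by (cases "t = 0") auto
  have rd: "real_distribution \<mu>"
    unfolding \<mu>_def using stable_laplace_0[OF k mom] by (intro real_distribution_density) (auto simp: stable_laplace_def)
  interpret real_distribution \<mu> by (rule rd)
  have pos: "AE x in \<mu>. 0 < x"
    unfolding \<mu>_def
  proof (subst AE_density)
    show "AE x in lborel. 0 < ennreal (stable_density k x) \<longrightarrow> 0 < x"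
      by (auto simp: stable_density_def)
  qed measurable
  let ?c = "\<lambda>a b. (a powr \<alpha> + b powr \<alpha>) powr (1 / \<alpha>)"
  let ?X = "\<lambda>a b. distr (\<mu> \<Otimes>\<^sub>M \<mu>) borel (\<lambda>(x, y). a * x + b * y)"
  let ?Y = "\<lambda>a b. distr \<mu> borel (\<lambda>x. ?c a b * x)"
  \<comment> \<open>At each integer n both laws have the transform exp(-n^\<alpha> (a^\<alpha> +
    b^\<alpha>)), so \<open>laplace_unique\<close> applies.\<close>
  have stable: "?X a b =
        ?Y a b" if ab: "a > 0" "b > 0" for a b
  proof (rule laplace_unique)
    interpret P: pair_prob_space \<mu> \<mu> ..
    have m: "(\<lambda>(x, y). a * x + b * y) \<in> borel_measurable (\<mu> \<Otimes>\<^sub>M \<mu>)"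
      by measurable
    have ab': "a powr \<alpha> + b powr \<alpha> > 0" using ab by (simp add: add_pos_pos)
    then have c: "?c a b > 0" by simp
    show "real_distribution (?X a b)"
      using m by (intro prob_space.real_distribution_distr[OF P.P.prob_space_axioms])
    show "real_distribution (?Y a b)"
      by (intro prob_space.real_distribution_distr[OF prob_space_axioms]) measurable
    show "AE x in ?Y a b. 0 < x"
      using pos c by (subst AE_distr_iff) (auto elim!: eventually_mono)
    have "AE x in \<mu> \<Otimes>\<^sub>M \<mu>. 0 < fst x \<and> 0 < snd x"
    proof (rule AE_conjI)
      have "{x \<in> space (\<mu> \<Otimes>\<^sub>M \<mu>). 0 < fst x} \<in> sets (\<mu> \<Otimes>\<^sub>M \<mu>)" by measurable
      then show "AE x in \<mu> \<Otimes>\<^sub>M \<mu>. 0 < fst x"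
        using pos by (intro P.AE_pair_measure) (auto elim!: eventually_mono)
      have "{x \<in> space (\<mu> \<Otimes>\<^sub>M \<mu>). 0 < snd x} \<in> sets (\<mu> \<Otimes>\<^sub>M \<mu>)" by measurable
      then show "AE x in \<mu> \<Otimes>\<^sub>M \<mu>. 0 < snd x"
        using pos by (intro P.AE_pair_measure) auto
    qed
    then have "AE z in \<mu> \<Otimes>\<^sub>M \<mu>. 0 < (case z of (x, y) \<Rightarrow> a * x + b * y)"
      by eventually_elim (use ab in \<open>auto simp: add_pos_pos split: prod.splits\<close>)
    then show "AE x in ?X a b. 0 < x"
      using m by (subst AE_distr_iff) auto
    fix n :: nat
    have "(\<integral>\<^sup>+x. ennreal (exp (- real n * x)) \<partial>?X a b) =
        (\<integral>\<^sup>+z. ennreal (exp (- real n * (case z of (x, y) \<Rightarrow> a * x + b * y))) \<partial>(\<mu> \<Otimes>\<^sub>M \<mu>))"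
      using m by (intro nn_integral_distr) auto
    also have "\<dots> = (\<integral>\<^sup>+x. \<integral>\<^sup>+y. ennreal (exp (- real n * (a * x + b * y))) \<partial>\<mu> \<partial>\<mu>)"
      by (subst nn_integral_fst[symmetric]) auto
    also have "\<dots> = (\<integral>\<^sup>+x. \<integral>\<^sup>+y. ennreal (exp (- (real n * a) * x)) * ennreal (exp (- (real n * b) * y)) \<partial>\<mu> \<partial>\<mu>)"
      by (intro nn_integral_cong) (simp add: ennreal_mult[symmetric] exp_add[symmetric] algebra_simps)
    also have "\<dots> = (\<integral>\<^sup>+x. ennreal (exp (- (real n * a) * x)) \<partial>\<mu>) * (\<integral>\<^sup>+y. ennreal (exp (- (real n * b) * y)) \<partial>\<mu>)"
      by (simp add: nn_integral_cmult nn_integral_multc)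
    also have "\<dots> = ennreal (exp (- ((real n * a) powr \<alpha>))) * ennreal (exp (- ((real n * b) powr \<alpha>)))"
      using ab by (subst (1 2) L) auto
    also have "\<dots> = ennreal (exp (- (real n powr \<alpha> * (a powr \<alpha> + b powr \<alpha>))))"
      using ab by (simp add: ennreal_mult[symmetric] exp_add[symmetric] powr_mult algebra_simps)
    also have "real n powr \<alpha> * (a powr \<alpha> + b powr \<alpha>) = (real n * ?c a b) powr \<alpha>"
      using ab' \<alpha> by (simp add: powr_mult powr_powr)
    also have "ennreal (exp (- \<dots>)) = (\<integral>\<^sup>+x. ennreal (exp (- (real n * ?c a b) * x)) \<partial>\<mu>)"
      by (rule L[symmetric]) simp
    also have "\<dots> = (\<integral>\<^sup>+x. ennreal (exp (- real n * (?c a b * x))) \<partial>\<mu>)"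
      by (simp add: mult.assoc)
    also have "\<dots> = (\<integral>\<^sup>+x. ennreal (exp (- real n * x)) \<partial>?Y a b)"
      by (intro nn_integral_distr[symmetric]) measurable
    finally show "(\<integral>\<^sup>+x. ennreal (exp (- real n * x)) \<partial>?X a b) =
        (\<integral>\<^sup>+x. ennreal (exp (- real n * x)) \<partial>?Y a b)" .
  qed
  have int: "(\<integral>x. exp (- t * x) \<partial>\<mu>) = exp (- (t powr \<alpha>))" if "t \<ge> 0" for t
    using L[OF that] by (subst integral_eq_nn_integral) auto
  show ?thesis
    unfolding positive_stable_density_def Let_def stable_law_def \<mu>_def[symmetric] \<alpha>_def[symmetric]
    using borel_measurable_stable_density[OF k] stable_density_nonneg[OF k] rd pos stable int by blast
qed

section \<open>The growth process\<close>

text \<open>Clipping an oversized gap lets structural facts about the words hold at every point of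
  the space, not just almost surely.\<close>

lemma insert_at_gap_min: "insert_at_gap g u w = insert_at_gap (min g (length w)) u w"
  by (simp add: insert_at_gap_def min_def)

lemma filter_insert_replicate:
  assumes "set w \<subseteq> {1..n}"
  shows "filter (\<lambda>x. x \<le> n) (insert_at_gap g (replicate k (Suc n)) w) = w"
proof -
  have "filter (\<lambda>x. x \<le> n) (insert_at_gap g (replicate k (Suc n)) w) =
      filter (\<lambda>x. x \<le> n) (take g w @ drop g w)"
    unfolding insert_at_gap_def filter_append by simp
  also have "\<dots> = w" using assms by (auto simp: filter_id_conv)
  finally show ?thesis .
qed

context stirling_growth
begin

lemma W_Suc_0: "\<omega> \<in> space M \<Longrightarrow> W (Suc 0) \<omega> = replicate k 1"
  using W_start by simp

lemma W_in_stirling_perms: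
  assumes "n \<ge> 1" "\<omega> \<in> space M"
  shows "W n \<omega> \<in> stirling_perms k n"
  using assms(1)
proof (induction n rule: dec_induct)
  case base
  have "insert_at_gap 0 (replicate k (Suc 0)) [] \<in> stirling_perms k (Suc 0)"
    by (rule insert_at_gap_in_stirling_perms) (auto simp: stirling_perms_0)
  then show ?case using W_Suc_0[OF assms(2)] by (simp add: insert_at_gap_def)
next
  case (step n)
  have "W (Suc n) \<omega> = insert_at_gap (min (gap n \<omega>) (length (W n \<omega>))) (replicate k (Suc n)) (W n \<omega>)"
    unfolding W_step[OF step(1) assms(2)] by (rule insert_at_gap_min)
  then show ?case
    using insert_at_gap_in_stirling_perms[OF step.IH] by simp
qed

text \<open>Deleting the letters above \<open>i\<close> undoes the later insertions, so
  \<open>W n\<close> contains its whole history.\<close>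

lemma filter_W:
  assumes "1 \<le> i" "i \<le> n" "\<omega> \<in> space M"
  shows "filter (\<lambda>x. x \<le> i) (W n \<omega>) = W i \<omega>"
  using assms(2)
proof (induction n rule: dec_induct)
  case base
  then show ?case
    using stirling_permsD(1)[OF W_in_stirling_perms[OF assms(1,3)]] by (auto simp: filter_id_conv)
next
  case (step n)
  have n: "n \<ge> 1" using step assms by simp
  have "filter (\<lambda>x. x \<le> i) (W (Suc n) \<omega>) = filter (\<lambda>x. x \<le> i) (filter (\<lambda>x. x \<le> n) (W (Suc n) \<omega>))"
    unfolding filter_filter using step(1) by (intro filter_cong) auto
  also have "filter (\<lambda>x. x \<le> n) (W (Suc n) \<omega>) = W n \<omega>"
    unfolding W_step[OF n assms(3)]
    by (rule filter_insert_replicate[OF stirling_permsD(1)[OF W_in_stirling_perms[OF n assms(3)]]])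
  finally show ?case using step.IH by simp
qed

section \<open>Measurability and law of the process\<close>

lemma measurable_gap:
  assumes "n \<ge> 1"
  shows "gap n \<in> measurable M (count_space UNIV)"
  using gap_indep assms unfolding indep_vars_def by auto

lemma measurable_W:
  assumes "n \<ge> 1"
  shows "W n \<in> measurable M (count_space UNIV)"
  using assms
proof (induction n rule: dec_induct)
  case base
  show ?case
    by (subst measurable_cong[where g = "\<lambda>_. replicate k 1"]) (auto simp: W_Suc_0)
next
  case (step n)
  have "(\<lambda>\<omega>. insert_at_gap (gap n \<omega>) (replicate k (Suc n)) (W n \<omega>)) \<in> measurable M (count_space UNIV)"
  proof (rule measurable_compose_countable[OF _ measurable_gap[OF step(1)]])
    show "(\<lambda>\<omega>. insert_at_gap i (replicate k (Suc n)) (W n \<omega>)) \<in> measurable M (count_space UNIV)" for i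
      by (rule measurable_compose[OF step.IH]) simp
  qed
  then show ?case
    by (subst measurable_cong[OF W_step[OF step(1)]])
qed

text \<open>\<open>W n\<close> is a function of the gaps with index below \<open>n\<close>, and
  these are independent of \<open>gap n\<close>.\<close>

lemma prob_W_gap:
  assumes n: "n \<ge> 1"
  shows "prob {\<omega> \<in> space M. W n \<omega> = w \<and> gap n \<omega> = g} =
    prob {\<omega> \<in> space M. W n \<omega> = w} * prob {\<omega> \<in> space M. gap n \<omega> = g}"
proof -
  let ?N = "\<lambda>_::nat. count_space (UNIV :: nat set)"
  \<comment> \<open>The process starts at order 1, hence the recursion index \<open>m - 1\<close>
    and the double successor in the letters.\<close>
  define Wf :: "nat \<Rightarrow> (nat \<Rightarrow> nat) \<Rightarrow> nat list" where
    "Wf = (\<lambda>m x. rec_nat (replicate k 1) (\<lambda>i v. insert_at_gap (x (Suc i)) (replicate k (Suc (Suc i))) v) (m - 1))"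
  have Wf1: "Wf (Suc 0) x = replicate k 1" for x by (simp add: Wf_def)
  have WfS: "Wf (Suc m) x = insert_at_gap (x m) (replicate k (Suc m)) (Wf m x)" if "m \<ge> 1" for m x
    using that by (cases m) (auto simp: Wf_def)
  have Wf_W: "Wf m (restrict (\<lambda>i. gap i \<omega>) {1..<n}) = W m \<omega>"
    if "m \<ge> 1" "m \<le> n" "\<omega> \<in> space M" for m \<omega>
    using that
  proof (induction m rule: dec_induct)
    case base
    then show ?case using Wf1 W_Suc_0 by simp
  next
    case (step m)
    then show ?case using WfS[of m] W_step[of m \<omega>] by simp
  qed
  have Wf_meas: "Wf m \<in> measurable (PiM {1..<n} ?N) (count_space UNIV)" if "m \<ge> 1" "m \<le> n" for m
    using that
  proof (induction m rule: dec_induct)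
    case base
    have "Wf (Suc 0) = (\<lambda>_. replicate k 1)" using Wf1 by (intro ext)
    then show ?case by simp
  next
    case (step m)
    have "(\<lambda>x. insert_at_gap (x m) (replicate k (Suc m)) (Wf m x)) \<in> measurable (PiM {1..<n} ?N) (count_space UNIV)"
    proof (rule measurable_compose_countable[where g = "\<lambda>x. x m"
          and f = "\<lambda>i x. insert_at_gap i (replicate k (Suc m)) (Wf m x)"])
      show "(\<lambda>x. x m) \<in> measurable (PiM {1..<n} ?N) (count_space UNIV)"
        using step by (intro measurable_component_singleton) auto
      show "(\<lambda>x. insert_at_gap i (replicate k (Suc m)) (Wf m x)) \<in> measurable (PiM {1..<n} ?N) (count_space UNIV)" for i
      proof -
        have "Wf m \<in> measurable (PiM {1..<n} ?N) (count_space UNIV)" using step by auto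
        then show ?thesis by (rule measurable_compose) simp
      qed
    qed
    moreover have "Wf (Suc m) = (\<lambda>x. insert_at_gap (x m) (replicate k (Suc m)) (Wf m x))"
      using WfS[OF step(1)] by (intro ext)
    ultimately show ?case by simp
  qed
  have "indep_var (PiM {1..<n} ?N) (\<lambda>\<omega>. restrict (\<lambda>i. gap i \<omega>) {1..<n})
      (PiM {n} ?N) (\<lambda>\<omega>. restrict (\<lambda>i. gap i \<omega>) {n})"
    using n by (intro indep_var_restrict[OF gap_indep]) auto
  \<comment> \<open>Both members of \<open>indep_var\<close> have the same value type, so the event
    that the word is \<open>w\<close> is encoded as a natural number.\<close>
  then have ind: "indep_var (count_space UNIV) ((\<lambda>x. of_bool (Wf n x = w)) \<circ> (\<lambda>\<omega>. restrict (\<lambda>i. gap i \<omega>) {1..<n}))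
      (count_space UNIV) ((\<lambda>x. x n) \<circ> (\<lambda>\<omega>. restrict (\<lambda>i. gap i \<omega>) {n}))"
  proof (rule indep_var_compose)
    show "(\<lambda>x. of_bool (Wf n x = w)) \<in> measurable (PiM {1..<n} ?N) (count_space UNIV)"
      by (rule measurable_compose[OF Wf_meas[OF n order_refl]]) simp
  qed (intro measurable_component_singleton, simp)
  have b1: "(of_bool P = Suc 0) = P" for P by (simp add: of_bool_def)
  from indep_varD[OF ind, of "{1}" "{g}"]
  have "prob ((\<lambda>\<omega>. (of_bool (Wf n (restrict (\<lambda>i. gap i \<omega>) {1..<n}) = w), gap n \<omega>)) -` ({1::nat} \<times> {g}) \<inter> space M) =
      prob ((\<lambda>\<omega>. of_bool (Wf n (restrict (\<lambda>i. gap i \<omega>) {1..<n}) = w)) -` {1::nat} \<inter> space M) * prob (gap n -` {g} \<inter> space M)"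
    by (simp add: o_def)
  moreover have "(\<lambda>\<omega>. (of_bool (Wf n (restrict (\<lambda>i. gap i \<omega>) {1..<n}) = w), gap n \<omega>)) -` ({1::nat} \<times> {g}) \<inter> space M =
      {\<omega> \<in> space M. W n \<omega> = w \<and> gap n \<omega> = g}"
    using Wf_W[OF n order_refl] by (auto simp: b1)
  moreover have "(\<lambda>\<omega>. of_bool (Wf n (restrict (\<lambda>i. gap i \<omega>) {1..<n}) = w)) -` {1::nat} \<inter> space M = {\<omega> \<in> space M. W n \<omega> = w}"
    using Wf_W[OF n order_refl] by (auto simp: b1)
  moreover have "gap n -` {g} \<inter> space M = {\<omega> \<in> space M. gap n \<omega> = g}" by auto
  ultimately show ?thesis by simp
qed

lemma prob_gap:
  assumes n: "n \<ge> 1"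
  shows "prob {\<omega> \<in> space M. gap n \<omega> = g} = (if g \<le> k * n then 1 / real (k * n + 1) else 0)"
proof -
  have "prob {\<omega> \<in> space M. gap n \<omega> = g} = measure (distr M (count_space UNIV) (gap n)) {g}"
    using measurable_gap[OF n] by (subst measure_distr) (auto intro!: arg_cong[where f = prob])
  also have "\<dots> = (if g \<le> k * n then 1 / real (k * n + 1) else 0)"
    unfolding gap_uniform[OF n] by (simp add: measure_pmf_single)
  finally show ?thesis .
qed

lemma AE_gap_le:
  assumes n: "n \<ge> 1"
  shows "AE \<omega> in M. gap n \<omega> \<le> k * n"
proof -
  have "AE g in distr M (count_space UNIV) (gap n). g \<le> k * n"
    unfolding gap_uniform[OF n] by (subst AE_measure_pmf_iff) (auto simp: set_pmf_of_set)
  then show ?thesis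
    using measurable_gap[OF n] by (subst (asm) AE_distr_iff) auto
qed

text \<open>A word of order n + 1 arises from exactly one pair of a word and a gap in range, and
  that pair has the product of two uniform probabilities.\<close>

lemma prob_W:
  assumes k: "k \<ge> 1" and n: "n \<ge> 1" and w: "w \<in> stirling_perms k n"
  shows "prob {\<omega> \<in> space M. W n \<omega> = w} = 1 / real (card (stirling_perms k n))"
  using n w
proof (induction n arbitrary: w rule: dec_induct)
  case base
  have "card (stirling_perms k (Suc 0)) = 1"
    using card_stirling_perms_Suc[OF k, of 0] by (simp add: stirling_perms_0)
  then obtain v where v: "stirling_perms k 1 = {v}" by (auto simp: card_1_singleton_iff)
  then have "{\<omega> \<in> space M. W 1 \<omega> = w} = space M"
    using W_in_stirling_perms[of 1] base by auto
  then show ?case using v by (simp add: prob_space)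
next
  case (step n)
  obtain v g where v: "v \<in> stirling_perms k n" "g \<le> length v" "w = insert_at_gap g (replicate k (Suc n)) v"
    using stirling_perm_Suc_obtain[OF step.prems k] by blast
  have g: "g \<le> k * n" using v length_stirling_perm by auto
  have "prob {\<omega> \<in> space M. W (Suc n) \<omega> = w} = prob {\<omega> \<in> space M. W n \<omega> = v \<and> gap n \<omega> = g}"
  \<comment> \<open>The events may differ on the null set of gaps beyond the end, since such a gap
    acts like the last one.\<close>
  proof (rule measure_eq_AE)
    show "AE \<omega> in M. (\<omega> \<in> {\<omega> \<in> space M. W (Suc n) \<omega> = w}) = (\<omega> \<in> {\<omega> \<in> space M. W n \<omega> = v \<and> gap n \<omega> = g})"
      using AE_gap_le[OF step(1)] AE_space
    proof eventually_elim
      case (elim \<omega>)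
      have u: "W n \<omega> \<in> stirling_perms k n" using W_in_stirling_perms[OF step(1)] elim by blast
      have "insert_at_gap (gap n \<omega>) (replicate k (Suc n)) (W n \<omega>) = insert_at_gap g (replicate k (Suc n)) v \<longleftrightarrow>
          W n \<omega> = v \<and> gap n \<omega> = g"
        using inj_onD[OF bij_betw_imp_inj_on[OF bij_betw_insert_at_gap[OF k, of n]], of "(W n \<omega>, gap n \<omega>)" "(v, g)"] u v(1) elim g
        by auto
      then show ?case using elim W_step[OF step(1), of \<omega>] v(3) by simp
    qed
    have [measurable]: "W n \<in> measurable M (count_space UNIV)" "W (Suc n) \<in> measurable M (count_space UNIV)"
      "gap n \<in> measurable M (count_space UNIV)"
      using measurable_W measurable_gap step(1) by auto
    show "{\<omega> \<in> space M. W (Suc n) \<omega> = w} \<in> sets M" by measurable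
    show "{\<omega> \<in> space M. W n \<omega> = v \<and> gap n \<omega> = g} \<in> sets M" by measurable
  qed
  also have "\<dots> = 1 / real (card (stirling_perms k n)) * (1 / real (k * n + 1))"
    using prob_W_gap[OF step(1)] step.IH[OF v(1)] prob_gap[OF step(1), of g] g by simp
  finally show ?case by (simp add: card_stirling_perms_Suc[OF k] algebra_simps)
qed

text \<open>Almost surely the pair of word and gap is uniform on a finite set, so an integral over
  one step is a finite sum, and integrability comes with it.\<close>

lemma expectation_W_gap:
  fixes h :: "nat list \<Rightarrow> nat \<Rightarrow> real"
  assumes k: "k \<ge> 1" and n: "n \<ge> 1"
  shows "has_bochner_integral M (\<lambda>\<omega>. h (W n \<omega>) (gap n \<omega>))
    ((\<Sum>w\<in>stirling_perms k n. \<Sum>g\<in>{0..k * n}. h w g) / (real (card (stirling_perms k n)) * real (k * n + 1)))"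
proof -
  have [measurable]: "W n \<in> measurable M (count_space UNIV)" "gap n \<in> measurable M (count_space UNIV)"
    using measurable_W measurable_gap n by auto
  define E where "E = (\<lambda>w g. {\<omega> \<in> space M. W n \<omega> = w \<and> gap n \<omega> = g})"
  have E [measurable]: "E w g \<in> sets M" for w g unfolding E_def by measurable
  have "has_bochner_integral M (\<lambda>\<omega>. \<Sum>w\<in>stirling_perms k n. \<Sum>g\<in>{0..k * n}. h w g * indicator (E w g) \<omega>)
      (\<Sum>w\<in>stirling_perms k n. \<Sum>g\<in>{0..k * n}. h w g * prob (E w g))"
    by (intro has_bochner_integral_sum has_bochner_integral_mult_right has_bochner_integral_real_indicator E)
      (simp add: less_top[symmetric])
  also have "(\<Sum>w\<in>stirling_perms k n. \<Sum>g\<in>{0..k * n}. h w g * prob (E w g)) =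
      (\<Sum>w\<in>stirling_perms k n. \<Sum>g\<in>{0..k * n}. h w g / (real (card (stirling_perms k n)) * real (k * n + 1)))"
    unfolding E_def prob_W_gap[OF n] by (intro sum.cong refl) (simp add: prob_W[OF k n] prob_gap[OF n])
  also have "\<dots> = (\<Sum>w\<in>stirling_perms k n. \<Sum>g\<in>{0..k * n}. h w g) / (real (card (stirling_perms k n)) * real (k * n + 1))"
    by (simp only: sum_divide_distrib)
  finally have 1: "has_bochner_integral M (\<lambda>\<omega>. \<Sum>w\<in>stirling_perms k n. \<Sum>g\<in>{0..k * n}. h w g * indicator (E w g) \<omega>) \<dots>" .
  have ae: "AE \<omega> in M. (\<Sum>w\<in>stirling_perms k n. \<Sum>g\<in>{0..k * n}. h w g * indicator (E w g) \<omega>) = h (W n \<omega>) (gap n \<omega>)"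
    using AE_gap_le[OF n] AE_space
  proof eventually_elim
    case (elim \<omega>)
    have W: "W n \<omega> \<in> stirling_perms k n" using W_in_stirling_perms[OF n] elim by blast
    have "(\<Sum>w\<in>stirling_perms k n. \<Sum>g\<in>{0..k * n}. h w g * indicator (E w g) \<omega>) =
        (\<Sum>w\<in>stirling_perms k n. \<Sum>g\<in>{0..k * n}. if w = W n \<omega> then if g = gap n \<omega> then h w g else 0 else 0)"
      using elim by (intro sum.cong refl) (auto simp: E_def indicator_def)
    also have "\<dots> = (\<Sum>w\<in>stirling_perms k n. if w = W n \<omega> then (\<Sum>g\<in>{0..k * n}. if g = gap n \<omega> then h w g else 0) else 0)"
      by (intro sum.cong) auto
    also have "\<dots> = h (W n \<omega>) (gap n \<omega>)"
      using W elim by (simp add: sum.delta finite_stirling_perms)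
    finally show ?case .
  qed
  have m: "(\<lambda>\<omega>. h (W n \<omega>) (gap n \<omega>)) \<in> borel_measurable M"
  proof (rule measurable_compose_countable)
    show "(\<lambda>\<omega>. h (W n \<omega>) i) \<in> borel_measurable M" for i
      by (rule measurable_compose[of "W n" _ "count_space UNIV"]) auto
  qed measurable
  show ?thesis
    by (rule has_bochner_integralI_AE[OF 1 m ae])
qed

lemma expectation_W:
  fixes h :: "nat list \<Rightarrow> real"
  assumes k: "k \<ge> 1" and n: "n \<ge> 1"
  shows "has_bochner_integral M (\<lambda>\<omega>. h (W n \<omega>))
    ((\<Sum>w\<in>stirling_perms k n. h w) / real (card (stirling_perms k n)))"
proof -
  have "(\<Sum>w\<in>stirling_perms k n. \<Sum>g\<in>{0..k * n}. h w) = (\<Sum>w\<in>stirling_perms k n. h w) * real (k * n + 1)"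
    unfolding sum_distrib_right by (intro sum.cong refl) (simp add: mult.commute)
  moreover have "a * real (k * n + 1) / (b * real (k * n + 1)) = a / b" for a b :: real
    by (rule nonzero_mult_divide_mult_cancel_right) linarith
  ultimately show ?thesis
    using expectation_W_gap[OF k n, of "\<lambda>w _. h w"] by (simp only:)
qed

lemma expectation_num_blocks_W:
  assumes k: "k \<ge> 1" and n: "n \<ge> 1"
  shows "has_bochner_integral M (\<lambda>\<omega>. \<phi> (num_blocks (W n \<omega>))) (block_mean k n \<phi>)"
  unfolding block_mean_def by (rule expectation_W[OF k n])

lemma prob_num_blocks_le:
  assumes k: "k \<ge> 1" and n: "n \<ge> 1"
  shows "prob {\<omega> \<in> space M. num_blocks (W n \<omega>) \<le> m} = (\<Sum>j\<le>m. block_prob k n j)"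
proof -
  have [measurable]: "W n \<in> measurable M (count_space UNIV)" using measurable_W n by auto
  have "(\<Sum>j\<le>m. block_prob k n j) = block_mean k n (\<lambda>s. \<Sum>j\<le>m. of_bool (s = j))"
    unfolding block_prob_def block_mean_def sum_divide_distrib[symmetric] by (subst sum.swap) (rule refl)
  also have "(\<lambda>s. \<Sum>j\<le>m. of_bool (s = j)) = (\<lambda>s. of_bool (s \<le> m) :: real)"
    by (intro ext) (auto simp: of_bool_def sum.delta)
  also have "block_mean k n \<dots> = (\<integral>\<omega>. of_bool (num_blocks (W n \<omega>) \<le> m) \<partial>M)"
    using expectation_num_blocks_W[OF k n] by (rule has_bochner_integral_integral_eq[symmetric])
  also have "\<dots> = (\<integral>\<omega>. indicator {\<omega> \<in> space M. num_blocks (W n \<omega>) \<le> m} \<omega> \<partial>M)"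
    by (intro Bochner_Integration.integral_cong) (auto simp: indicator_def)
  also have "\<dots> = prob {\<omega> \<in> space M. num_blocks (W n \<omega>) \<le> m}"
    by (simp add: Int_absorb1)
  finally show ?thesis ..
qed

end

section \<open>The martingale\<close>

text \<open>The mean of S_n + 1 is \<open>block_moment k n 1\<close>, so this normalisation gives
  the constant mean 2, which is the value of the martingale at n = 1.\<close>

definition mart_coeff :: "nat \<Rightarrow> nat \<Rightarrow> real" where
  "mart_coeff k n = 2 / block_moment k n 1"

lemma block_moment_pos:
  assumes "k \<ge> 1"
  shows "block_moment k n r > 0"
  unfolding block_moment_def using assms by (intro divide_pos_pos pochhammer_pos) auto

lemma mart_coeff_pos: "k \<ge> 1 \<Longrightarrow> mart_coeff k n > 0"
  using block_moment_pos[of k n 1] by (simp add: mart_coeff_def)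

lemma mart_coeff_gbinomial:
  assumes k: "k \<ge> 1" and n: "n \<ge> 1"
  shows "((real n - 1 + 1 / real k) gchoose (n - 1)) / ((real n - 1 + 2 / real k) gchoose (n - 1)) = mart_coeff k n"
  unfolding mart_coeff_def block_moment_gbinomial'[OF k n, of 1, symmetric] by simp

lemma mart_coeff_Suc:
  assumes k: "k \<ge> 1"
  shows "mart_coeff k (Suc n) * (real (k * n + 1) + 1) = mart_coeff k n * real (k * n + 1)"
proof -
  have "1 + real 1 / real (k * n + 1) = (real (k * n + 1) + 1) / real (k * n + 1)"
    unfolding add_divide_distrib by (subst divide_self) linarith+
  moreover have "0 < real (k * n + 1)" by linarith
  moreover have "2 / (e * ((q + 1) / q)) * (q + 1) = 2 / e * q" if "0 < q" for e q :: real
    using that by simp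
  ultimately show ?thesis
    unfolding mart_coeff_def block_moment_Suc[OF k] by simp
qed

lemma block_moment_tendsto:
  assumes k: "k \<ge> 1"
  shows "(\<lambda>n. block_moment k n r * real n powr (- (real r / real k)))
    \<longlonglongrightarrow> Gamma (1 / real k) / Gamma (real (r + 1) / real k)"
proof -
  have "1 / real k - (real r + 1) / real k = - (real r / real k)"
    by (simp add: diff_divide_distrib[symmetric])
  then show ?thesis
    using pochhammer_ratio_tendsto[of "1 / real k" "(real r + 1) / real k"] k
    by (simp add: block_moment_def rGamma_inverse_Gamma field_simps add.commute)
qed

text \<open>The limit is the reciprocal of the constant that relates \<zeta> to the martingale
  limit.\<close>

lemma mart_coeff_tendsto:
  assumes k: "k \<ge> 1"
  shows "(\<lambda>n. mart_coeff k n * real n powr (1 / real k)) \<longlonglongrightarrow> Gamma (1 + 2 / real k) / Gamma (1 + 1 / real k)"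
proof -
  have G: "Gamma (1 / real k) > 0" "Gamma (2 / real k) > 0" "Gamma (1 + 1 / real k) > 0" "Gamma (1 + 2 / real k) > 0"
    using k by (auto intro!: Gamma_real_pos add_pos_pos)
  have "(\<lambda>n. 2 / (block_moment k n 1 * real n powr (- (real 1 / real k))))
      \<longlonglongrightarrow> 2 / (Gamma (1 / real k) / Gamma (real (1 + 1) / real k))"
    using G by (intro tendsto_divide tendsto_const block_moment_tendsto k) auto
  also have "2 / (Gamma (1 / real k) / Gamma (real (1 + 1) / real k)) = Gamma (1 + 2 / real k) / Gamma (1 + 1 / real k)"
    using block_limit_moment_alt[OF k, of 1] G by (simp add: block_limit_moment_def field_simps)
  also have "(\<lambda>n. 2 / (block_moment k n 1 * real n powr (- (real 1 / real k)))) = (\<lambda>n. mart_coeff k n * real n powr (1 / real k))"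
    by (intro ext) (simp add: mart_coeff_def powr_minus field_simps)
  finally show ?thesis .
qed

text \<open>The second moment of the martingale is 8 times this decreasing ratio minus
  \<open>4 / block_moment k n 1\<close>; hence its increments after time \<open>m\<close> have second moment at most
  \<open>4 / block_moment k m 1\<close>.\<close>

lemma block_moment_ratio_Suc_le:
  assumes k: "k \<ge> 1"
  shows "block_moment k (Suc n) 2 / (block_moment k (Suc n) 1)\<^sup>2 \<le> block_moment k n 2 / (block_moment k n 1)\<^sup>2"
proof -
  define q where "q = 1 / real (k * n + 1)"
  have q: "q > 0" unfolding q_def by (intro divide_pos_pos) linarith+
  have eq: "block_moment k (Suc n) 2 / (block_moment k (Suc n) 1)\<^sup>2 =
      block_moment k n 2 / (block_moment k n 1)\<^sup>2 * ((1 + 2 * q) / (1 + q)\<^sup>2)"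
    unfolding block_moment_Suc[OF k] q_def by (simp add: power_mult_distrib)
  have le: "(1 + 2 * q) / (1 + q)\<^sup>2 \<le> 1"
  proof -
    have "(1 + q)\<^sup>2 > 0" "1 + 2 * q \<le> (1 + q)\<^sup>2" using q by (simp, simp add: power2_sum)
    then show ?thesis by (simp add: divide_le_eq_1_pos)
  qed
  have "0 \<le> block_moment k n 2 / (block_moment k n 1)\<^sup>2"
    using block_moment_pos[OF k, of n 2] by simp
  from mult_left_mono[OF le this] show ?thesis unfolding eq by simp
qed

text \<open>Bounded second moments give uniform integrability. Explicitly, truncation at j + 1 costs
  at most Y^2 / (j + 1), hence B / (j + 1) in mean uniformly in n; first n and then j tends to
  infinity.\<close>

lemma (in prob_space) has_bochner_integral_limit_bounded_L2:
  fixes Y :: "nat \<Rightarrow> 'a \<Rightarrow> real"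
  assumes [measurable]: "\<And>n. Y n \<in> borel_measurable M" "Z \<in> borel_measurable M"
    and nn: "\<And>n \<omega>. \<omega> \<in> space M \<Longrightarrow> 0 \<le> Y n \<omega>"
    and int: "\<And>n. integrable M (Y n)" "\<And>n. integrable M (\<lambda>\<omega>. (Y n \<omega>)\<^sup>2)"
    and B: "\<And>n. expectation (\<lambda>\<omega>. (Y n \<omega>)\<^sup>2) \<le> B"
    and lim: "AE \<omega> in M. (\<lambda>n. Y n \<omega>) \<longlonglongrightarrow> Z \<omega>"
    and L: "(\<lambda>n. expectation (Y n)) \<longlonglongrightarrow> L"
  shows "has_bochner_integral M Z L"
proof -
  define T where "T = (\<lambda>j y. min y (real (Suc j)))"
  have intT: "integrable M (\<lambda>\<omega>. T j (Z \<omega>))" and limT: "(\<lambda>n. expectation (\<lambda>\<omega>. T j (Y n \<omega>))) \<longlonglongrightarrow> expectation (\<lambda>\<omega>. T j (Z \<omega>))" for j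
  proof -
    have a: "AE \<omega> in M. (\<lambda>n. T j (Y n \<omega>)) \<longlonglongrightarrow> T j (Z \<omega>)"
      using lim unfolding T_def by eventually_elim (intro tendsto_min tendsto_const)
    have b: "AE \<omega> in M. norm (T j (Y n \<omega>)) \<le> real (Suc j)" for n
      using nn by (intro AE_I2) (auto simp: T_def min_def)
    show "integrable M (\<lambda>\<omega>. T j (Z \<omega>))"
      by (rule integrable_dominated_convergence[OF _ _ _ a b]) (auto simp: T_def)
    show "(\<lambda>n. expectation (\<lambda>\<omega>. T j (Y n \<omega>))) \<longlonglongrightarrow> expectation (\<lambda>\<omega>. T j (Z \<omega>))"
      by (rule integral_dominated_convergence[OF _ _ _ a b]) (auto simp: T_def)
  qed
  have trunc: "expectation (\<lambda>\<omega>. T j (Y n \<omega>)) \<le> expectation (Y n)"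
      "expectation (Y n) - B / real (Suc j) \<le> expectation (\<lambda>\<omega>. T j (Y n \<omega>))" for j n
  proof -
    have iT: "integrable M (\<lambda>\<omega>. T j (Y n \<omega>))"
      using nn by (intro integrable_const_bound[where B = "real (Suc j)"] AE_I2) (auto simp: T_def min_def)
    show "expectation (\<lambda>\<omega>. T j (Y n \<omega>)) \<le> expectation (Y n)"
      using iT int by (intro integral_mono) (auto simp: T_def)
    have "expectation (\<lambda>\<omega>. Y n \<omega> - T j (Y n \<omega>)) \<le> expectation (\<lambda>\<omega>. (Y n \<omega>)\<^sup>2 / real (Suc j))"
    proof (intro integral_mono)
      fix \<omega> assume "\<omega> \<in> space M"
      show "Y n \<omega> - T j (Y n \<omega>) \<le> (Y n \<omega>)\<^sup>2 / real (Suc j)"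
      proof (cases "Y n \<omega> \<le> real (Suc j)")
        case False
        then have "Y n \<omega> * real (Suc j) \<le> (Y n \<omega>)\<^sup>2"
          unfolding power2_eq_square by (intro mult_left_mono) auto
        then have "Y n \<omega> \<le> (Y n \<omega>)\<^sup>2 / real (Suc j)" by (subst pos_le_divide_eq) auto
        then show ?thesis using False by (simp add: T_def)
      qed (simp add: T_def)
    qed (use iT int in auto)
    also have "\<dots> = expectation (\<lambda>\<omega>. (Y n \<omega>)\<^sup>2) / real (Suc j)"
      by simp
    also have "\<dots> \<le> B / real (Suc j)"
      using B by (intro divide_right_mono) auto
    finally show "expectation (Y n) - B / real (Suc j) \<le> expectation (\<lambda>\<omega>. T j (Y n \<omega>))"
      using iT int by simp
  qed
  have up: "expectation (\<lambda>\<omega>. T j (Z \<omega>)) \<le> L" for j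
    by (rule LIMSEQ_le[OF limT L]) (use trunc in auto)
  have lo: "L - B / real (Suc j) \<le> expectation (\<lambda>\<omega>. T j (Z \<omega>))" for j
    by (rule LIMSEQ_le[OF tendsto_diff[OF L tendsto_const] limT]) (use trunc in auto)
  have ilim: "(\<lambda>j. expectation (\<lambda>\<omega>. T j (Z \<omega>))) \<longlonglongrightarrow> L"
  proof (rule real_tendsto_sandwich)
    show "(\<lambda>j. L - B / real (Suc j)) \<longlonglongrightarrow> L" by real_asymp
  qed (use up lo in auto)
  have mono: "AE \<omega> in M. mono (\<lambda>j. T j (Z \<omega>))"
    by (intro AE_I2 monoI) (auto simp: T_def min_def)
  have lim: "AE \<omega> in M. (\<lambda>j. T j (Z \<omega>)) \<longlonglongrightarrow> Z \<omega>"
  proof (intro AE_I2 tendsto_eventually)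
    fix \<omega>
    show "eventually (\<lambda>j. T j (Z \<omega>) = Z \<omega>) sequentially"
      using eventually_ge_at_top[of "nat \<lceil>Z \<omega>\<rceil>"]
      by eventually_elim (auto simp: T_def min_def; linarith)
  qed
  show ?thesis
    using integrable_monotone_convergence[OF intT mono lim ilim] integral_monotone_convergence[OF intT mono lim ilim]
    by (simp add: has_bochner_integral_iff)
qed

text \<open>Consecutive \<open>p\<close>-th powers have ratio tending to 1, so monotonicity controls the values in
  between.\<close>

lemma mono_tendsto_along_powers:
  fixes a :: "nat \<Rightarrow> real" and p q :: nat
  assumes p: "p \<ge> 1" and a0: "\<And>n. n \<ge> 1 \<Longrightarrow> 0 \<le> a n"
    and mono: "\<And>m n. 1 \<le> m \<Longrightarrow> m \<le> n \<Longrightarrow> a m \<le> a n"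
    and lim: "(\<lambda>j. a (Suc j ^ p) / real (Suc j) ^ q) \<longlonglongrightarrow> L"
  shows "(\<lambda>n. a n / real n powr (real q / real p)) \<longlonglongrightarrow> L"
proof -
  define J where "J = (\<lambda>n. nat \<lfloor>real n powr (1 / real p)\<rfloor>)"
  have "filterlim (\<lambda>n. real n powr (1 / real p)) at_top sequentially"
    using p by real_asymp
  then have Jtop: "filterlim J at_top sequentially"
    unfolding J_def by (intro filterlim_compose[OF filterlim_nat_sequentially] filterlim_compose[OF filterlim_floor_sequentially])
  have limS: "(\<lambda>j. a (j ^ p) / real j ^ q) \<longlonglongrightarrow> L"
    using lim by (subst (asm) filterlim_sequentially_Suc)
  have up: "(\<lambda>j. a (Suc j ^ p) / real (Suc j) ^ q * (real (Suc j) / real j) ^ q) \<longlonglongrightarrow> L * 1 ^ q"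
    by (intro tendsto_mult lim tendsto_power) real_asymp
  have lo: "(\<lambda>j. a (j ^ p) / real j ^ q * (real j / real (Suc j)) ^ q) \<longlonglongrightarrow> L * 1 ^ q"
    by (intro tendsto_mult limS tendsto_power) real_asymp
  show ?thesis
  proof (rule real_tendsto_sandwich)
    show "(\<lambda>n. a (J n ^ p) / real (J n) ^ q * (real (J n) / real (Suc (J n))) ^ q) \<longlonglongrightarrow> L"
      using filterlim_compose[OF lo Jtop] by simp
    show "(\<lambda>n. a (Suc (J n) ^ p) / real (Suc (J n)) ^ q * (real (Suc (J n)) / real (J n)) ^ q) \<longlonglongrightarrow> L"
      using filterlim_compose[OF up Jtop] by simp
    have bounds: "1 \<le> J n" "J n ^ p \<le> n" "n \<le> Suc (J n) ^ p"
        "real (J n) ^ q \<le> real n powr (real q / real p)" "real n powr (real q / real p) \<le> real (Suc (J n)) ^ q"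
      if n: "n \<ge> 1" for n
    proof -
      define x where "x = real n powr (1 / real p)"
      have x1: "x \<ge> 1" unfolding x_def using n by (intro ge_one_powr_ge_zero) auto
      have Jx: "real (J n) \<le> x" "x \<le> real (Suc (J n))" "1 \<le> J n"
        using x1 unfolding J_def x_def[symmetric] by linarith+
      have xp: "x ^ p = real n" using n p by (simp add: x_def powr_realpow[symmetric] powr_powr)
      have xq: "x ^ q = real n powr (real q / real p)" using n by (simp add: x_def powr_realpow[symmetric] powr_powr)
      show "1 \<le> J n" by (rule Jx)
      have "real (J n) ^ p \<le> real n" using power_mono[OF Jx(1), of p] xp by simp
      then show "J n ^ p \<le> n" by (metis of_nat_le_iff of_nat_power)
      have "real n \<le> real (Suc (J n)) ^ p" using power_mono[OF Jx(2), of p] x1 xp by simp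
      then show "n \<le> Suc (J n) ^ p" by (metis of_nat_le_iff of_nat_power)
      show "real (J n) ^ q \<le> real n powr (real q / real p)" using power_mono[OF Jx(1), of q] xq by simp
      show "real n powr (real q / real p) \<le> real (Suc (J n)) ^ q" using power_mono[OF Jx(2), of q] x1 xq by simp
    qed
    show "eventually (\<lambda>n. a (J n ^ p) / real (J n) ^ q * (real (J n) / real (Suc (J n))) ^ q \<le> a n / real n powr (real q / real p)) sequentially"
      using eventually_ge_at_top[of 1]
    proof eventually_elim
      case (elim n)
      note b = bounds[OF elim]
      have "1 \<le> J n ^ p" using b(1) by simp
      have n1: "n \<ge> 1" "0 < real n powr (real q / real p)" using elim by auto
      have "a (J n ^ p) / real (J n) ^ q * (real (J n) / real (Suc (J n))) ^ q = a (J n ^ p) / real (Suc (J n)) ^ q"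
        using b(1) by (simp add: power_divide)
      also have "\<dots> \<le> a n / real n powr (real q / real p)"
        by (rule frac_le[OF a0[OF n1(1)] mono[OF \<open>1 \<le> J n ^ p\<close> b(2)] n1(2) b(5)])
      finally show ?case .
    qed
    show "eventually (\<lambda>n. a n / real n powr (real q / real p) \<le> a (Suc (J n) ^ p) / real (Suc (J n)) ^ q * (real (Suc (J n)) / real (J n)) ^ q) sequentially"
      using eventually_ge_at_top[of 1]
    proof eventually_elim
      case (elim n)
      note b = bounds[OF elim]
      have "a n / real n powr (real q / real p) \<le> a (Suc (J n) ^ p) / real (J n) ^ q"
        using b elim by (intro frac_le a0 mono) auto
      also have "\<dots> = a (Suc (J n) ^ p) / real (Suc (J n)) ^ q * (real (Suc (J n)) / real (J n)) ^ q"
        by (simp add: power_divide del: of_nat_Suc)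
      finally show ?case .
    qed
  qed
qed


context stirling_growth
begin

definition mart :: "nat \<Rightarrow> 'a \<Rightarrow> real" where
  "mart n \<omega> = mart_coeff k n * real (num_blocks (W n \<omega>) + 1)"

lemma measurable_mart: "n \<ge> 1 \<Longrightarrow> mart n \<in> borel_measurable M"
  unfolding mart_def[abs_def] by (rule measurable_compose[OF measurable_W]) auto

lemma integrable_W: "k \<ge> 1 \<Longrightarrow> n \<ge> 1 \<Longrightarrow> integrable M (\<lambda>\<omega>. (h (W n \<omega>) :: real))"
  using expectation_W by (auto simp: has_bochner_integral_iff)

text \<open>The martingale property tested against functions of the current word. Averaging over the
  gaps multiplies S + 1 by (k n + 2) / (k n + 1), which the coefficient compensates.\<close>

lemma mart_step:
  assumes k: "k \<ge> 1" and n: "n \<ge> 1"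
  shows "expectation (\<lambda>\<omega>. \<psi> (W n \<omega>) * mart (Suc n) \<omega>) = expectation (\<lambda>\<omega>. \<psi> (W n \<omega>) * mart n \<omega>)"
    and "integrable M (\<lambda>\<omega>. \<psi> (W n \<omega>) * mart (Suc n) \<omega>)"
proof -
  define h where "h = (\<lambda>w g. \<psi> w * (mart_coeff k (Suc n) * real (num_blocks (insert_at_gap g (replicate k (Suc n)) w) + 1)))"
  have "(\<Sum>g\<in>{0..k * n}. h w g) = \<psi> w * (mart_coeff k n * real (num_blocks w + 1)) * real (k * n + 1)"
    if w: "w \<in> stirling_perms k n" for w
  proof -
    have "(\<Sum>g\<in>{0..k * n}. h w g) =
        \<psi> w * (mart_coeff k (Suc n) * (\<Sum>g\<in>{0..k * n}. real (num_blocks (insert_at_gap g (replicate k (Suc n)) w) + 1)))"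
      by (simp add: h_def sum_distrib_left)
    also have "(\<Sum>g\<in>{0..k * n}. real (num_blocks (insert_at_gap g (replicate k (Suc n)) w) + 1)) =
        real (num_blocks w + 1) * (real (k * n + 1) + 1)"
      using sum_gaps_num_blocks[OF w k, of "\<lambda>s. real (s + 1)"] by (simp add: algebra_simps)
    also have "\<psi> w * (mart_coeff k (Suc n) * (real (num_blocks w + 1) * (real (k * n + 1) + 1))) =
        \<psi> w * real (num_blocks w + 1) * (mart_coeff k (Suc n) * (real (k * n + 1) + 1))"
      by (simp only: mult_ac)
    also have "\<dots> = \<psi> w * (mart_coeff k n * real (num_blocks w + 1)) * real (k * n + 1)"
      unfolding mart_coeff_Suc[OF k] by (simp only: mult_ac)
    finally show ?thesis .
  qed
  then have "(\<Sum>w\<in>stirling_perms k n. \<Sum>g\<in>{0..k * n}. h w g) =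
      (\<Sum>w\<in>stirling_perms k n. \<psi> w * (mart_coeff k n * real (num_blocks w + 1))) * real (k * n + 1)"
    unfolding sum_distrib_right by (intro sum.cong) auto
  moreover have "a * real (k * n + 1) / (b * real (k * n + 1)) = a / b" for a b :: real
    by (rule nonzero_mult_divide_mult_cancel_right) linarith
  ultimately have "has_bochner_integral M (\<lambda>\<omega>. h (W n \<omega>) (gap n \<omega>))
      ((\<Sum>w\<in>stirling_perms k n. \<psi> w * (mart_coeff k n * real (num_blocks w + 1))) / real (card (stirling_perms k n)))"
    using expectation_W_gap[OF k n, of h] by (simp only:)
  then have 1: "has_bochner_integral M (\<lambda>\<omega>. \<psi> (W n \<omega>) * mart (Suc n) \<omega>)
      ((\<Sum>w\<in>stirling_perms k n. \<psi> w * (mart_coeff k n * real (num_blocks w + 1))) / real (card (stirling_perms k n)))"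
    by (rule has_bochner_integral_cong[THEN iffD1, rotated -1])
      (auto simp: h_def mart_def W_step[OF n])
  have 2: "has_bochner_integral M (\<lambda>\<omega>. \<psi> (W n \<omega>) * mart n \<omega>)
      ((\<Sum>w\<in>stirling_perms k n. \<psi> w * (mart_coeff k n * real (num_blocks w + 1))) / real (card (stirling_perms k n)))"
    using expectation_W[OF k n, of "\<lambda>w. \<psi> w * (mart_coeff k n * real (num_blocks w + 1))"]
    by (simp add: mart_def)
  show "expectation (\<lambda>\<omega>. \<psi> (W n \<omega>) * mart (Suc n) \<omega>) = expectation (\<lambda>\<omega>. \<psi> (W n \<omega>) * mart n \<omega>)"
    using 1 2 by (simp add: has_bochner_integral_iff)
  show "integrable M (\<lambda>\<omega>. \<psi> (W n \<omega>) * mart (Suc n) \<omega>)"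
    using 1 by (simp add: has_bochner_integral_iff)
qed

text \<open>By \<open>filter_W\<close> a function of \<open>W m\<close> is a function of every later
  word, so the one-step identity can be iterated.\<close>

lemma expectation_mart_eq:
  assumes k: "k \<ge> 1" and m: "1 \<le> m" "m \<le> n"
  shows "expectation (\<lambda>\<omega>. \<psi> (W m \<omega>) * mart n \<omega>) = expectation (\<lambda>\<omega>. \<psi> (W m \<omega>) * mart m \<omega>)"
  using m(2)
proof (induction n rule: dec_induct)
  case (step n)
  have n: "n \<ge> 1" using step m by simp
  have eq: "expectation (\<lambda>\<omega>. \<psi> (W m \<omega>) * mart j \<omega>) =
      expectation (\<lambda>\<omega>. \<psi> (filter (\<lambda>x. x \<le> m) (W n \<omega>)) * mart j \<omega>)" for j
    using filter_W[OF m(1) step(1)] by (intro Bochner_Integration.integral_cong) auto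
  show ?case
    using mart_step(1)[OF k n, of "\<lambda>w. \<psi> (filter (\<lambda>x. x \<le> m) w)"] step.IH eq by simp
qed simp

lemma generated_filtration_sets:
  "sets (generated_filtration M W n) =
    sigma_sets (space M) {W i -` A \<inter> space M |i A. 1 \<le> i \<and> i \<le> n}"
  "space (generated_filtration M W n) = space M"
proof -
  have "{W i -` A \<inter> space M |i A. 1 \<le> i \<and> i \<le> n} \<subseteq> Pow (space M)" by auto
  then show "sets (generated_filtration M W n) =
      sigma_sets (space M) {W i -` A \<inter> space M |i A. 1 \<le> i \<and> i \<le> n}"
    "space (generated_filtration M W n) = space M"
    by (simp_all add: generated_filtration_def sets_measure_of space_measure_of)
qed

text \<open>The last word determines the earlier ones. Testing conditional expectations on events
  about the last word is therefore enough.\<close>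

lemma generated_filtration_eq_vimage:
  assumes n: "n \<ge> 1"
  shows "sets (generated_filtration M W n) = {W n -` A \<inter> space M |A. True}"
proof
  let ?V = "vimage_algebra (space M) (W n) (count_space UNIV)"
  have V: "sets ?V = {W n -` A \<inter> space M |A. True}"
    by (subst sets_vimage_algebra2) auto
  show "sets (generated_filtration M W n) \<subseteq> {W n -` A \<inter> space M |A. True}"
    unfolding generated_filtration_sets V[symmetric]
  proof -
    have "{W i -` A \<inter> space M |i A. 1 \<le> i \<and> i \<le> n} \<subseteq> sets ?V"
    proof
      fix B assume "B \<in> {W i -` A \<inter> space M |i A. 1 \<le> i \<and> i \<le> n}"
      then obtain i A where iA: "B = W i -` A \<inter> space M" "1 \<le> i" "i \<le> n" by auto
      have "B = W n -` {w. filter (\<lambda>x. x \<le> i) w \<in> A} \<inter> space M"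
        using filter_W[OF iA(2,3)] iA(1) by auto
      then show "B \<in> sets ?V" unfolding V by blast
    qed
    from sets.sigma_sets_subset[OF this]
    show "sigma_sets (space M) {W i -` A \<inter> space M |i A. 1 \<le> i \<and> i \<le> n} \<subseteq> sets ?V" by simp
  qed
  show "{W n -` A \<inter> space M |A. True} \<subseteq> sets (generated_filtration M W n)"
    unfolding generated_filtration_sets using n by (auto intro!: sigma_sets.Basic)
qed

lemma subalgebra_generated_filtration: "subalgebra M (generated_filtration M W n)"
proof -
  have "W i -` A \<inter> space M \<in> sets M" if "1 \<le> i" for i A
    using measurable_sets[OF measurable_W[OF that], of A] by simp
  then have "{W i -` A \<inter> space M |i A. 1 \<le> i \<and> i \<le> n} \<subseteq> sets M" by auto
  then show ?thesis
    unfolding subalgebra_def generated_filtration_sets by (simp add: sets.sigma_sets_subset)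
qed

lemma martingale_mart:
  assumes k: "k \<ge> 1"
  shows "martingale_from 1 M (generated_filtration M W) mart"
  unfolding martingale_from_def
proof (intro conjI allI impI)
  show "filtration (space M) (generated_filtration M W)"
  proof
    show "space (generated_filtration M W i) = space M" for i
      by (rule generated_filtration_sets)
    show "sets (generated_filtration M W i) \<subseteq> sets (generated_filtration M W j)" if "i \<le> j" for i j
      unfolding generated_filtration_sets using that by (intro sigma_sets_mono') force
  qed
  show "subalgebra M (generated_filtration M W n)" for n by (rule subalgebra_generated_filtration)
  have meas: "mart n \<in> borel_measurable (generated_filtration M W n)" if n: "1 \<le> n" for n
  proof (rule measurableI)
    fix A :: "real set"
    have "mart n -` A \<inter> space (generated_filtration M W n) =
        W n -` {w. mart_coeff k n * real (num_blocks w + 1) \<in> A} \<inter> space M"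
      by (auto simp: mart_def generated_filtration_sets(2))
    then show "mart n -` A \<inter> space (generated_filtration M W n) \<in> sets (generated_filtration M W n)"
      unfolding generated_filtration_eq_vimage[OF n] by blast
  qed simp
  then show "mart n \<in> borel_measurable (generated_filtration M W n)" if "1 \<le> n" for n using that by blast
  have int: "integrable M (mart n)" if n: "1 \<le> n" for n
    unfolding mart_def[abs_def] by (rule integrable_W[OF k n])
  then show "integrable M (mart n)" if "1 \<le> n" for n using that by blast
  fix i j :: nat assume ij: "1 \<le> i" "i \<le> j"
  interpret F: finite_measure_subalgebra M "generated_filtration M W i"
    by unfold_locales (rule subalgebra_generated_filtration)
  show "AE \<omega> in M. real_cond_exp M (generated_filtration M W i) (mart j) \<omega> = mart i \<omega>"
  proof (rule F.real_cond_exp_charact)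
    fix A assume "A \<in> sets (generated_filtration M W i)"
    then obtain B where B: "A = W i -` B \<inter> space M"
      unfolding generated_filtration_eq_vimage[OF ij(1)] by auto
    have "(\<integral>\<omega>\<in>A. mart n \<omega> \<partial>M) = expectation (\<lambda>\<omega>. indicator B (W i \<omega>) * mart n \<omega>)" for n
      unfolding set_lebesgue_integral_def B by (intro Bochner_Integration.integral_cong) (auto simp: indicator_def)
    then show "(\<integral>\<omega>\<in>A. mart j \<omega> \<partial>M) = (\<integral>\<omega>\<in>A. mart i \<omega> \<partial>M)"
      using expectation_mart_eq[OF k ij, of "indicator B"] by simp
  qed (use int meas ij in auto)
qed

section \<open>Second moments and almost sure convergence\<close>

lemma mart_second_moment:
  assumes k: "k \<ge> 1" and n: "n \<ge> 1"
  shows "expectation (\<lambda>\<omega>. (mart n \<omega>)\<^sup>2) =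
    8 * (block_moment k n 2 / (block_moment k n 1)\<^sup>2) - 4 / block_moment k n 1"
proof -
  \<comment> \<open>The square is expressed through the rising binomials of orders 2 and 1, whose
    means are known.\<close>
  have sq: "(real (s + 1))\<^sup>2 = 2 * real ((s + 2) choose 2) + (- 1) * real ((s + 1) choose 1)" for s
  proof -
    have "2 * ((s + 2) choose 2) = (s + 2) * (s + 1)"
      using choose_two[of "s + 2"] by simp
    from arg_cong[OF this, of real] have "2 * real ((s + 2) choose 2) = (real s + 2) * (real s + 1)"
      by (simp only: of_nat_mult of_nat_add of_nat_1 of_nat_numeral)
    then show ?thesis by (simp add: power2_eq_square algebra_simps)
  qed
  have "expectation (\<lambda>\<omega>. (mart n \<omega>)\<^sup>2) = block_mean k n (\<lambda>s. (mart_coeff k n * real (s + 1))\<^sup>2)"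
    unfolding mart_def by (rule has_bochner_integral_integral_eq[OF expectation_num_blocks_W[OF k n]])
  also have "\<dots> = (mart_coeff k n)\<^sup>2 * (2 * block_moment k n 2 + (- 1) * block_moment k n 1)"
    unfolding power_mult_distrib sq block_mean_cmult block_mean_add block_mean_choose[OF k] ..
  also have "\<dots> = 8 * (block_moment k n 2 / (block_moment k n 1)\<^sup>2) - 4 / block_moment k n 1"
    using block_moment_pos[OF k, of n 1]
    by (simp add: mart_coeff_def power_divide field_simps power2_eq_square)
  finally show ?thesis .
qed

text \<open>Increments of a martingale are orthogonal, so the mean square of a difference is the
  difference of the mean squares.\<close>

lemma mart_increment:
  assumes k: "k \<ge> 1" and m: "1 \<le> m" "m \<le> n"
  shows "expectation (\<lambda>\<omega>. (mart n \<omega> - mart m \<omega>)\<^sup>2) \<le> 4 / block_moment k m 1"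
    and "integrable M (\<lambda>\<omega>. (mart n \<omega> - mart m \<omega>)\<^sup>2)"
proof -
  have n: "1 \<le> n" using m by simp
  let ?h = "\<lambda>j w. mart_coeff k j * real (num_blocks w + 1)"

  have i2: "integrable M (\<lambda>\<omega>. (mart n \<omega>)\<^sup>2)" "integrable M (\<lambda>\<omega>. (mart m \<omega>)\<^sup>2)"
    unfolding mart_def by (rule integrable_W[OF k n], rule integrable_W[OF k m(1)])
  have im: "integrable M (\<lambda>\<omega>. mart m \<omega> * mart n \<omega>)"
    using integrable_W[OF k n, of "\<lambda>w. ?h m (filter (\<lambda>x. x \<le> m) w) * ?h n w"]
    by (rule Bochner_Integration.integrable_cong[THEN iffD1, rotated -1]) (use filter_W[OF m] in \<open>auto simp: mart_def\<close>)
  have eq: "(mart n \<omega> - mart m \<omega>)\<^sup>2 = ((mart n \<omega>)\<^sup>2 + (mart m \<omega>)\<^sup>2) - 2 * (mart m \<omega> * mart n \<omega>)" for \<omega>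
    by (simp add: power2_diff)
  show "integrable M (\<lambda>\<omega>. (mart n \<omega> - mart m \<omega>)\<^sup>2)"
    unfolding eq using i2 im by simp
  have "expectation (\<lambda>\<omega>. mart m \<omega> * mart n \<omega>) = expectation (\<lambda>\<omega>. (mart m \<omega>)\<^sup>2)"
    using expectation_mart_eq[OF k m, of "?h m"] by (simp add: mart_def power2_eq_square)
  then have "expectation (\<lambda>\<omega>. (mart n \<omega> - mart m \<omega>)\<^sup>2) =
      expectation (\<lambda>\<omega>. (mart n \<omega>)\<^sup>2) - expectation (\<lambda>\<omega>. (mart m \<omega>)\<^sup>2)"
    unfolding eq using i2 im by simp
  also have "\<dots> \<le> 4 / block_moment k m 1"
  proof -
    have "block_moment k n 2 / (block_moment k n 1)\<^sup>2 \<le> block_moment k m 2 / (block_moment k m 1)\<^sup>2"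
      by (rule lift_Suc_antimono_le[where f = "\<lambda>n. block_moment k n 2 / (block_moment k n 1)\<^sup>2",
            OF block_moment_ratio_Suc_le[OF k] m(2)])
    moreover have "0 < 4 / block_moment k n 1" using block_moment_pos[OF k] by simp
    ultimately show ?thesis
      unfolding mart_second_moment[OF k n] mart_second_moment[OF k m(1)] by linarith
  qed
  finally show "expectation (\<lambda>\<omega>. (mart n \<omega> - mart m \<omega>)\<^sup>2) \<le> 4 / block_moment k m 1" .
qed

lemma mart_converges_along_powers:
  assumes k: "k \<ge> 1"
  shows "AE \<omega> in M. convergent (\<lambda>j. mart (Suc j ^ (4 * k)) \<omega>)"
proof -
  \<comment> \<open>\<open>block_moment k n 1\<close> grows like n^(1/k), hence like j^4 along this
    sequence.\<close>
  define N where "N = (\<lambda>j. Suc j ^ (4 * k))"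
  define d where "d = (\<lambda>j \<omega>. \<bar>mart (N (Suc j)) \<omega> - mart (N j) \<omega>\<bar>)"
  have N: "1 \<le> N j" "N j \<le> N (Suc j)" for j
    unfolding N_def by (auto simp: Suc_leI intro: power_mono)
  have "(\<lambda>n. 4 * (1 / (block_moment k n 1 * real n powr (- (real 1 / real k)))))
      \<longlonglongrightarrow> 4 * (1 / (Gamma (1 / real k) / Gamma (real (1 + 1) / real k)))"
  proof (intro tendsto_mult tendsto_divide tendsto_const block_moment_tendsto k)
    show "Gamma (1 / real k) / Gamma (real (1 + 1) / real k) \<noteq> 0"
    proof -
      have "Gamma (1 / real k) > 0" "Gamma (2 / real k) > 0" using k by (auto intro!: Gamma_real_pos)
      then show ?thesis by simp
    qed
  qed
  then have "Bseq (\<lambda>n. 4 * (1 / (block_moment k n 1 * real n powr (- (real 1 / real k)))))"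
    by (intro convergent_imp_Bseq convergentI)
  then obtain K where K: "K > 0" "\<And>n. norm (4 * (1 / (block_moment k n 1 * real n powr (- (real 1 / real k))))) \<le> K"
    by (auto simp: Bseq_def)
  have bm: "4 / block_moment k (N j) 1 \<le> K * (1 / real (Suc j) ^ 2)\<^sup>2" for j
  proof -
    have "real (N j) powr (- (real 1 / real k)) = (real (Suc j) powr real (4 * k)) powr (- (1 / real k))"
      unfolding N_def by (subst powr_realpow) simp_all
    also have "\<dots> = real (Suc j) powr (- 4)" using k by (simp add: powr_powr del: of_nat_Suc)
    also have "\<dots> = 1 / real (Suc j) ^ 4"
      by (subst powr_neg_numeral) simp_all
    finally have e: "real (N j) powr (- (real 1 / real k)) = 1 / real (Suc j) ^ 4" .
    have "4 * (1 / (block_moment k (N j) 1 * (1 / real (Suc j) ^ 4))) \<le> K"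
      using order_trans[OF abs_ge_self K(2)[of "N j", unfolded real_norm_def e]] .
    then have "4 / block_moment k (N j) 1 * real (Suc j) ^ 4 \<le> K" by simp
    then have "4 / block_moment k (N j) 1 \<le> K / real (Suc j) ^ 4"
      by (subst pos_le_divide_eq) auto
    then show ?thesis by (simp add: power_divide power_mult[symmetric] del: of_nat_Suc)
  qed
  have dm: "d j \<in> borel_measurable M" for j
    unfolding d_def using measurable_mart[OF N(1)] by (intro borel_measurable_abs borel_measurable_diff) auto
  have Ed: "(\<integral>\<^sup>+\<omega>. ennreal (d j \<omega>) \<partial>M) \<le> ennreal ((1 + K) * (1 / real (Suc j) ^ 2))" for j
  proof -
    \<comment> \<open>The bound d \<le> \<delta> + d^2 / \<delta> takes the place of the
      Cauchy-Schwarz inequality. As the mean of d^2 is of order \<delta>^2, both terms are of order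
      \<delta>, which is summable in j.\<close>
    define \<delta> where "\<delta> = 1 / real (Suc j) ^ 2"
    have \<delta>: "\<delta> > 0" by (simp add: \<delta>_def)
    have i: "integrable M (\<lambda>\<omega>. (mart (N (Suc j)) \<omega> - mart (N j) \<omega>)\<^sup>2)"
      by (rule mart_increment(2)[OF k N])
    have "d j \<omega> \<le> \<delta> + (mart (N (Suc j)) \<omega> - mart (N j) \<omega>)\<^sup>2 / \<delta>" for \<omega>
    proof -
      have "2 * \<delta> * d j \<omega> \<le> \<delta>\<^sup>2 + (d j \<omega>)\<^sup>2" by (rule sum_squares_bound)
      moreover have "0 \<le> \<delta> * d j \<omega>" using \<delta> by (simp add: d_def)
      ultimately have "d j \<omega> * \<delta> \<le> \<delta>\<^sup>2 + (d j \<omega>)\<^sup>2"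
        unfolding mult.commute[of "d j \<omega>"] mult.assoc by linarith
      also have "\<dots> = (\<delta> + (d j \<omega>)\<^sup>2 / \<delta>) * \<delta>" using \<delta> by (simp add: field_simps power2_eq_square)
      finally have "d j \<omega> \<le> \<delta> + (d j \<omega>)\<^sup>2 / \<delta>" using \<delta> by simp
      then show ?thesis by (simp add: d_def)
    qed
    then have "(\<integral>\<^sup>+\<omega>. ennreal (d j \<omega>) \<partial>M) \<le> (\<integral>\<^sup>+\<omega>. ennreal (\<delta> + (mart (N (Suc j)) \<omega> - mart (N j) \<omega>)\<^sup>2 / \<delta>) \<partial>M)"
      by (intro nn_integral_mono ennreal_leI)
    also have "\<dots> = ennreal (expectation (\<lambda>\<omega>. \<delta> + (mart (N (Suc j)) \<omega> - mart (N j) \<omega>)\<^sup>2 / \<delta>))"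
      using i \<delta> by (intro nn_integral_eq_integral) auto
    also have "expectation (\<lambda>\<omega>. \<delta> + (mart (N (Suc j)) \<omega> - mart (N j) \<omega>)\<^sup>2 / \<delta>) =
        \<delta> + expectation (\<lambda>\<omega>. (mart (N (Suc j)) \<omega> - mart (N j) \<omega>)\<^sup>2) / \<delta>"
      using i by (simp add: prob_space)
    also have "\<dots> \<le> \<delta> + K * \<delta>\<^sup>2 / \<delta>"
      using mart_increment(1)[OF k N, of j] bm[of j] \<delta> unfolding \<delta>_def[symmetric]
      by (intro add_left_mono divide_right_mono) auto
    also have "\<dots> = (1 + K) * \<delta>" using \<delta> by (simp add: field_simps power2_eq_square)
    finally show ?thesis by (simp add: \<delta>_def ennreal_leI)
  qed
  have "(\<integral>\<^sup>+\<omega>. (\<Sum>j. ennreal (d j \<omega>)) \<partial>M) = (\<Sum>j. \<integral>\<^sup>+\<omega>. ennreal (d j \<omega>) \<partial>M)"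
    using dm by (intro nn_integral_suminf) auto
  also have "\<dots> \<le> (\<Sum>j. ennreal ((1 + K) * (1 / real (Suc j) ^ 2)))"
    by (intro suminf_le Ed) auto
  also have "\<dots> < \<infinity>"
  proof -
    have "summable (\<lambda>j. 1 / real (Suc j) ^ 2)"
      using inverse_power_summable[of 2, where ?'a = real] by (subst summable_Suc_iff) (simp add: inverse_eq_divide)
    then have "summable (\<lambda>j. (1 + K) * (1 / real (Suc j) ^ 2))" by (rule summable_mult)
    then have "(\<Sum>j. ennreal ((1 + K) * (1 / real (Suc j) ^ 2))) = ennreal (\<Sum>j. (1 + K) * (1 / real (Suc j) ^ 2))"
      using K by (intro suminf_ennreal2) auto
    then show ?thesis by simp
  qed
  finally have "(\<integral>\<^sup>+\<omega>. (\<Sum>j. ennreal (d j \<omega>)) \<partial>M) \<noteq> \<infinity>" by simp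
  then have "AE \<omega> in M. (\<Sum>j. ennreal (d j \<omega>)) \<noteq> \<infinity>"
    using dm by (intro nn_integral_noteq_infinite) auto
  then show ?thesis
  proof eventually_elim
    case (elim \<omega>)
    have "summable (\<lambda>j. d j \<omega>)"
      using elim by (intro summable_suminf_not_top) (auto simp: d_def)
    then have "summable (\<lambda>j. mart (N (Suc j)) \<omega> - mart (N j) \<omega>)"
      unfolding d_def by (rule summable_rabs_cancel)
    then have "convergent (\<lambda>n. \<Sum>j<n. mart (N (Suc j)) \<omega> - mart (N j) \<omega>)"
      by (simp add: summable_iff_convergent)
    then have "convergent (\<lambda>n. mart (N n) \<omega> - mart (N 0) \<omega>)"
      by (simp only: sum_lessThan_telescope[of "\<lambda>j. mart (N j) \<omega>"])
    then have "convergent (\<lambda>n. mart (N n) \<omega>)"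
      by (simp add: convergent_diff_const_right_iff)
    then show ?case by (simp add: N_def)
  qed
qed

lemma num_blocks_mono:
  assumes k: "k \<ge> 1" and "1 \<le> m" "m \<le> n" "\<omega> \<in> space M"
  shows "num_blocks (W m \<omega>) \<le> num_blocks (W n \<omega>)"
  using assms(3)
proof (induction n rule: dec_induct)
  case (step n)
  have n: "n \<ge> 1" using step assms by simp
  have w: "W n \<omega> \<in> stirling_perms k n" by (rule W_in_stirling_perms[OF n assms(4)])
  have "W (Suc n) \<omega> = insert_at_gap (min (gap n \<omega>) (length (W n \<omega>))) (replicate k (Suc n)) (W n \<omega>)"
    unfolding W_step[OF n assms(4)] by (rule insert_at_gap_min)
  then have "num_blocks (W n \<omega>) \<le> num_blocks (W (Suc n) \<omega>)"
    using num_blocks_insert_stirling[OF w _ k, of "min (gap n \<omega>) (length (W n \<omega>))"]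
    by (simp add: length_stirling_perm[OF w])
  then show ?case using step.IH by simp
qed simp

lemma mart_converges:
  assumes k: "k \<ge> 1"
  shows "AE \<omega> in M. convergent (\<lambda>n. mart n \<omega>)"
  using mart_converges_along_powers[OF k] AE_space
proof eventually_elim
  case (elim \<omega>)
  define a where "a = (\<lambda>n. real (num_blocks (W n \<omega>) + 1))"
  define C where "C = Gamma (1 + 2 / real k) / Gamma (1 + 1 / real k)"
  have C: "C > 0" unfolding C_def using k by (intro divide_pos_pos Gamma_real_pos add_pos_pos) auto
  have c: "(\<lambda>n. mart_coeff k n * real n powr (1 / real k)) \<longlonglongrightarrow> C"
    unfolding C_def by (rule mart_coeff_tendsto[OF k])
  obtain L where L: "(\<lambda>j. mart (Suc j ^ (4 * k)) \<omega>) \<longlonglongrightarrow> L" using elim by (auto simp: convergent_def)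
  have "filterlim (\<lambda>j. Suc j ^ (4 * k)) at_top sequentially"
    by (rule filterlim_at_top_mono[OF filterlim_Suc]) (use k in \<open>auto intro!: always_eventually self_le_power\<close>)
  from filterlim_compose[OF c this]
  have "(\<lambda>j. mart_coeff k (Suc j ^ (4 * k)) * real (Suc j ^ (4 * k)) powr (1 / real k)) \<longlonglongrightarrow> C" .
  moreover have "real (Suc j ^ (4 * k)) powr (1 / real k) = real (Suc j) ^ 4" for j
  proof -
    have "real (Suc j ^ (4 * k)) powr (1 / real k) = (real (Suc j) powr real (4 * k)) powr (1 / real k)"
      by (simp add: powr_realpow[symmetric] del: of_nat_Suc)
    also have "\<dots> = real (Suc j) powr (real 4)" using k by (simp add: powr_powr del: of_nat_Suc)
    finally show ?thesis by (subst (asm) powr_realpow) auto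
  qed
  ultimately have "(\<lambda>j. mart_coeff k (Suc j ^ (4 * k)) * real (Suc j) ^ 4) \<longlonglongrightarrow> C" by simp
  from tendsto_divide[OF L this]
  have "(\<lambda>j. mart (Suc j ^ (4 * k)) \<omega> / (mart_coeff k (Suc j ^ (4 * k)) * real (Suc j) ^ 4)) \<longlonglongrightarrow> L / C"
    using C by simp
  \<comment> \<open>The decreasing coefficient is exchanged for a power of n, because S_n + 1 is
    monotone while the martingale is not. The interpolation lemma then applies with p = 4k and q =
    4.\<close>
  then have "(\<lambda>j. a (Suc j ^ (4 * k)) / real (Suc j) ^ 4) \<longlonglongrightarrow> L / C"
    using mart_coeff_pos[OF k] by (simp add: mart_def a_def less_imp_neq[symmetric])
  then have "(\<lambda>n. a n / real n powr (real 4 / real (4 * k))) \<longlonglongrightarrow> L / C"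
    using k num_blocks_mono[OF k _ _ elim(2)] by (intro mono_tendsto_along_powers) (auto simp: a_def)
  then have "(\<lambda>n. a n / real n powr (1 / real k)) \<longlonglongrightarrow> L / C" by simp
  from tendsto_mult[OF c this]
  have "(\<lambda>n. mart_coeff k n * real n powr (1 / real k) * (a n / real n powr (1 / real k))) \<longlonglongrightarrow> C * (L / C)" .
  moreover have "eventually (\<lambda>n. mart_coeff k n * real n powr (1 / real k) * (a n / real n powr (1 / real k)) = mart n \<omega>) sequentially"
    using eventually_gt_at_top[of 0] by eventually_elim (simp add: mart_def a_def)
  ultimately have "(\<lambda>n. mart n \<omega>) \<longlonglongrightarrow> C * (L / C)"
    by (rule Lim_transform_eventually)
  then show ?case by (rule convergentI)
qed

end

section \<open>The limit\<close>

lemma limit_density_0: "limit_density k 0 = 0"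
proof -
  have "limit_density k 0 = limit_coeff k 0"
    unfolding limit_density_def by (subst powser_zero) (rule refl)
  then show ?thesis by (simp add: limit_coeff_def)
qed

lemma nn_integral_limit_density:
  assumes k: "k \<ge> 2" and a: "0 \<le> a"
  shows "(\<integral>\<^sup>+x\<in>{0..a}. ennreal (limit_density k x) \<partial>lborel) = ennreal (limit_cdf k a)"
proof -
  have "(limit_density k has_integral limit_cdf k a - limit_cdf k 0) {0..a}"
    using a by (intro fundamental_theorem_of_calculus)
      (auto simp: has_real_derivative_iff_has_vector_derivative[symmetric]
        intro: DERIV_subset[OF limit_cdf_deriv[OF k]])
  moreover have "0 \<le> limit_density k x" if "x \<in> {0..a}" for x
    using limit_density_nonneg[OF k, of x] limit_density_0[of k] that by (cases "x = 0") auto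
  ultimately show ?thesis
    by (subst nn_integral_has_integral_lebesgue') (auto simp: limit_cdf_0)
qed

lemma stable_density_limit_density:
  assumes k: "k \<ge> 2" and x: "x > 0"
  shows "Gamma (1 / real k) * x powr (- real k) * stable_density k (x powr (- real k)) = limit_density k x"
proof -
  have "(x powr (- real k)) powr (- 1 / real k) = x"
    using x k by (simp add: powr_powr)
  moreover have "Gamma (1 / real k) > 0" using k by (intro Gamma_real_pos) simp
  ultimately show ?thesis using x by (simp add: stable_density_def)
qed

context stirling_growth
begin

text \<open>The sequence is shifted because \<open>W 0\<close> is unconstrained, so
  \<open>mart 0\<close> might not be measurable.\<close>

definition mart_limit :: "'a \<Rightarrow> real" where
  "mart_limit \<omega> = lim (\<lambda>n. mart (Suc n) \<omega>)"

definition zeta :: "'a \<Rightarrow> real" where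
  "zeta \<omega> = Gamma (1 + 1 / real k) / Gamma (1 + 2 / real k) * mart_limit \<omega>"

lemma measurable_mart_limit [measurable]: "mart_limit \<in> borel_measurable M"
  unfolding mart_limit_def[abs_def] by (rule borel_measurable_lim_metric) (rule measurable_mart, simp)

lemma measurable_zeta [measurable]: "zeta \<in> borel_measurable M"
  unfolding zeta_def[abs_def] by measurable

lemma mart_tendsto:
  assumes k: "k \<ge> 1"
  shows "AE \<omega> in M. (\<lambda>n. mart n \<omega>) \<longlonglongrightarrow> mart_limit \<omega>"
  using mart_converges[OF k]
proof eventually_elim
  case (elim \<omega>)
  then have "convergent (\<lambda>n. mart (Suc n) \<omega>)" by (subst convergent_Suc_iff)
  then have "(\<lambda>n. mart (Suc n) \<omega>) \<longlonglongrightarrow> mart_limit \<omega>"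
    by (simp add: mart_limit_def convergent_LIMSEQ_iff)
  then show ?case by (subst (asm) filterlim_sequentially_Suc)
qed

lemma num_blocks_tendsto:
  assumes k: "k \<ge> 1"
  shows "AE \<omega> in M. (\<lambda>n. real n powr (- 1 / real k) * real (num_blocks (W n \<omega>))) \<longlonglongrightarrow> zeta \<omega>"
  using mart_tendsto[OF k]
proof eventually_elim
  case (elim \<omega>)
  define C where "C = Gamma (1 + 2 / real k) / Gamma (1 + 1 / real k)"
  have C: "C > 0" unfolding C_def using k by (intro divide_pos_pos Gamma_real_pos add_pos_pos) auto
  have "(\<lambda>n. mart n \<omega> / (mart_coeff k n * real n powr (1 / real k))) \<longlonglongrightarrow> mart_limit \<omega> / C"
    using tendsto_divide[OF elim mart_coeff_tendsto[OF k, folded C_def]] C by simp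
  \<comment> \<open>This removes the summand 1 of S_n + 1 in the limit.\<close>
  moreover have "(\<lambda>n. real n powr (- 1 / real k)) \<longlonglongrightarrow> 0"
    using k by real_asymp
  ultimately have "(\<lambda>n. mart n \<omega> / (mart_coeff k n * real n powr (1 / real k)) - real n powr (- 1 / real k)) \<longlonglongrightarrow> mart_limit \<omega> / C - 0"
    by (intro tendsto_diff)
  also have "(\<lambda>n. mart n \<omega> / (mart_coeff k n * real n powr (1 / real k)) - real n powr (- 1 / real k)) =
      (\<lambda>n. real n powr (- 1 / real k) * real (num_blocks (W n \<omega>)))"
  proof
    fix n
    show "mart n \<omega> / (mart_coeff k n * real n powr (1 / real k)) - real n powr (- 1 / real k) =
      real n powr (- 1 / real k) * real (num_blocks (W n \<omega>))"
      using mart_coeff_pos[OF k, of n] by (simp add: mart_def powr_minus_divide add_divide_distrib)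
  qed
  also have "mart_limit \<omega> / C - 0 = zeta \<omega>" by (simp add: zeta_def C_def)
  finally show ?case .
qed

lemma zeta_nonneg:
  assumes k: "k \<ge> 1"
  shows "AE \<omega> in M. 0 \<le> zeta \<omega>"
  using num_blocks_tendsto[OF k]
  by eventually_elim (rule LIMSEQ_le_const, auto)

text \<open>The variables choose(S_n + r, r) / n^(r/k) have known means and tend to \<zeta>^r / r!.
  Their squares are controlled by the known moments of order 2r, so the means converge to the mean
  of the limit.\<close>

lemma zeta_moments:
  assumes k: "k \<ge> 1"
  shows "has_bochner_integral M (\<lambda>\<omega>. zeta \<omega> ^ r) (block_limit_moment k r)"
proof -
  define q where "q = (\<lambda>n. real (Suc n) powr (1 / real k))"
  define Y where "Y = (\<lambda>n \<omega>. real ((num_blocks (W (Suc n) \<omega>) + r) choose r) / q n ^ r)"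
  have q: "q n > 0" for n by (simp add: q_def)
  have qr: "1 / q n ^ j = real (Suc n) powr (- (real j / real k))" for n j
    using q[of n] by (simp add: q_def powr_realpow[symmetric] powr_powr powr_minus_divide del: of_nat_Suc)
  have bmt: "(\<lambda>n. block_moment k (Suc n) j / q n ^ j) \<longlonglongrightarrow> Gamma (1 / real k) / Gamma (real (j + 1) / real k)" for j
    using LIMSEQ_Suc[OF block_moment_tendsto[OF k, of j]] by (simp only: qr[symmetric] times_divide_eq_right mult_1_right)
  have EY: "has_bochner_integral M (Y n) (block_moment k (Suc n) r / q n ^ r)" for n
  proof -
    have "block_mean k (Suc n) (\<lambda>s. (1 / q n ^ r) * real ((s + r) choose r)) = block_moment k (Suc n) r / q n ^ r"
      unfolding block_mean_cmult block_mean_choose[OF k] by simp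
    then show ?thesis
      using expectation_num_blocks_W[OF k, of "Suc n" "\<lambda>s. (1 / q n ^ r) * real ((s + r) choose r)"]
      by (simp add: Y_def[abs_def])
  qed
  \<comment> \<open>The central binomial coefficient: the square of a rising product of r factors is
    at most the rising product of 2r factors, and \<open>D\<close> adjusts the factorials.\<close>
  define D where "D = fact (2 * r) / (fact r * fact r :: real)"
  have sq: "(real ((s + r) choose r))\<^sup>2 \<le> D * real ((s + 2 * r) choose (2 * r))" for s
  proof -
    have c: "real ((s + j) choose j) = pochhammer (real s + 1) j / fact j" for j
      by (simp add: binomial_gbinomial gbinomial_pochhammer' add.commute)
    have "pochhammer (real s + 1) r \<le> pochhammer (real s + 1 + real r) r"
      unfolding pochhammer_prod by (intro prod_mono) auto
    then have "pochhammer (real s + 1) r * pochhammer (real s + 1) r \<le> pochhammer (real s + 1) (2 * r)"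
      unfolding mult_2 pochhammer_product'
      by (intro mult_left_mono) (auto intro!: pochhammer_nonneg)
    then show ?thesis
      unfolding c by (simp add: D_def power2_eq_square divide_right_mono)
  qed
  have Y2: "integrable M (\<lambda>\<omega>. (Y n \<omega>)\<^sup>2)" for n
    unfolding Y_def by (rule integrable_W[OF k]) simp
  have EY2: "expectation (\<lambda>\<omega>. (Y n \<omega>)\<^sup>2) \<le> D * (block_moment k (Suc n) (2 * r) / q n ^ (2 * r))" for n
  proof -
    have 1: "has_bochner_integral M (\<lambda>\<omega>. (D / q n ^ (2 * r)) * real ((num_blocks (W (Suc n) \<omega>) + 2 * r) choose (2 * r)))
        (D * (block_moment k (Suc n) (2 * r) / q n ^ (2 * r)))"
      using expectation_num_blocks_W[OF k, of "Suc n" "\<lambda>s. (D / q n ^ (2 * r)) * real ((s + 2 * r) choose (2 * r))"]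
      unfolding block_mean_cmult block_mean_choose[OF k] by simp
    have "expectation (\<lambda>\<omega>. (Y n \<omega>)\<^sup>2) \<le>
        expectation (\<lambda>\<omega>. (D / q n ^ (2 * r)) * real ((num_blocks (W (Suc n) \<omega>) + 2 * r) choose (2 * r)))"
    proof (rule integral_mono[OF Y2])
      show "integrable M (\<lambda>\<omega>. (D / q n ^ (2 * r)) * real ((num_blocks (W (Suc n) \<omega>) + 2 * r) choose (2 * r)))"
        using 1 by (simp add: has_bochner_integral_iff)
      fix \<omega>
      have "(Y n \<omega>)\<^sup>2 = (real ((num_blocks (W (Suc n) \<omega>) + r) choose r))\<^sup>2 / q n ^ (2 * r)"
        by (simp add: Y_def power_divide power_mult[symmetric] mult.commute)
      also have "\<dots> \<le> (D * real ((num_blocks (W (Suc n) \<omega>) + 2 * r) choose (2 * r))) / q n ^ (2 * r)"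
        using sq q[of n] by (intro divide_right_mono) auto
      finally show "(Y n \<omega>)\<^sup>2 \<le> (D / q n ^ (2 * r)) * real ((num_blocks (W (Suc n) \<omega>) + 2 * r) choose (2 * r))"
        by simp
    qed
    also have "\<dots> = D * (block_moment k (Suc n) (2 * r) / q n ^ (2 * r))"
      by (rule has_bochner_integral_integral_eq[OF 1])
    finally show ?thesis .
  qed
  have "Bseq (\<lambda>n. D * (block_moment k (Suc n) (2 * r) / q n ^ (2 * r)))"
    by (rule convergent_imp_Bseq, rule convergentI, rule tendsto_mult_left, rule bmt)
  then obtain B where B: "\<And>n. norm (D * (block_moment k (Suc n) (2 * r) / q n ^ (2 * r))) \<le> B"
    by (auto simp: Bseq_def)
  have "has_bochner_integral M (\<lambda>\<omega>. zeta \<omega> ^ r / fact r) (Gamma (1 / real k) / Gamma (real (r + 1) / real k))"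
  proof (rule has_bochner_integral_limit_bounded_L2[where Y = Y and B = B])
    show "Y n \<in> borel_measurable M" for n
      using EY[of n] by (auto simp: has_bochner_integral_iff)
    show "integrable M (Y n)" for n using EY[of n] by (simp add: has_bochner_integral_iff)
    show "0 \<le> Y n \<omega>" for n \<omega> using q[of n] by (simp add: Y_def)
    show "expectation (\<lambda>\<omega>. (Y n \<omega>)\<^sup>2) \<le> B" for n
      by (rule order_trans[OF EY2 order_trans[OF abs_ge_self B[unfolded real_norm_def]]])
    show "(\<lambda>n. expectation (Y n)) \<longlonglongrightarrow> Gamma (1 / real k) / Gamma (real (r + 1) / real k)"
      using bmt[of r] by (simp add: has_bochner_integral_integral_eq[OF EY])
    show "AE \<omega> in M. (\<lambda>n. Y n \<omega>) \<longlonglongrightarrow> zeta \<omega> ^ r / fact r"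
      using num_blocks_tendsto[OF k]
    proof eventually_elim
      case (elim \<omega>)
      have qtop: "filterlim q at_top sequentially" unfolding q_def using k by real_asymp
      have "(\<lambda>n. real (num_blocks (W (Suc n) \<omega>)) / q n) \<longlonglongrightarrow> zeta \<omega>"
        using LIMSEQ_Suc[OF elim] by (simp add: q_def powr_minus_divide)
      from tendsto_add[OF this real_tendsto_divide_at_top[OF tendsto_const qtop, of "real r"]]
      have "(\<lambda>n. real (num_blocks (W (Suc n) \<omega>) + r) / q n) \<longlonglongrightarrow> zeta \<omega>"
        by (simp add: add_divide_distrib)
      from binomial_over_power_tendsto[OF this qtop, of r]
      show ?case by (simp add: Y_def)
    qed
  qed (use Y2 in auto)
  from has_bochner_integral_mult_left[OF this, of "fact r"]
  show ?thesis using block_limit_moment_alt[OF k, of r] by simp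
qed

section \<open>The law of the limit\<close>

lemma scaled_num_blocks_cdf_tendsto:
  assumes k: "k \<ge> 2" and x: "x \<ge> 0"
  shows "(\<lambda>n. prob {\<omega> \<in> space M. real (Suc n) powr (- 1 / real k) * real (num_blocks (W (Suc n) \<omega>)) \<le> x})
    \<longlonglongrightarrow> limit_cdf k x"
proof -
  have k1: "k \<ge> 1" using k by simp
  have "prob {\<omega> \<in> space M. real (Suc n) powr (- 1 / real k) * real (num_blocks (W (Suc n) \<omega>)) \<le> x} =
      (\<Sum>j\<le>nat \<lfloor>x * real (Suc n) powr (1 / real k)\<rfloor>. block_prob k (Suc n) j)" for n
  proof -
    have "real (Suc n) powr (- 1 / real k) * real s \<le> x \<longleftrightarrow> s \<le> nat \<lfloor>x * real (Suc n) powr (1 / real k)\<rfloor>" for s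
    proof -
      define y where "y = real (Suc n) powr (1 / real k)"
      have y: "y > 0" by (simp add: y_def)
      have y': "real (Suc n) powr (- 1 / real k) = 1 / y" by (simp add: y_def powr_minus_divide)
      have "real (Suc n) powr (- 1 / real k) * real s \<le> x \<longleftrightarrow> real s \<le> x * y"
        unfolding y' using y by (simp add: field_simps)
      also have "\<dots> \<longleftrightarrow> s \<le> nat \<lfloor>x * y\<rfloor>"
        using x y by (simp add: le_nat_iff le_floor_iff)
      finally show ?thesis by (simp add: y_def)
    qed
    then show ?thesis using prob_num_blocks_le[OF k1, of "Suc n"] by simp
  qed
  then show ?thesis using LIMSEQ_Suc[OF sum_block_prob_tendsto(1)[OF k x]] by simp
qed

text \<open>Means of bounded continuous functions converge. Ramps descending between x and x +
  \<epsilon> compare them with distribution functions, and continuity of \<open>limit_cdf\<close>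
  removes \<epsilon>.\<close>

lemma zeta_cdf:
  assumes k: "k \<ge> 2"
  shows "prob {\<omega> \<in> space M. zeta \<omega> \<le> x} = (if 0 \<le> x then limit_cdf k x else 0)"
proof -
  let ?P = "\<lambda>X x. prob {\<omega> \<in> space M. X \<omega> \<le> x}"
  have k1: "k \<ge> 1" using k by simp
  define Z where "Z = (\<lambda>n \<omega>. real (Suc n) powr (- 1 / real k) * real (num_blocks (W (Suc n) \<omega>)))"
  have Zm [measurable]: "Z n \<in> borel_measurable M" for n
    unfolding Z_def by (rule measurable_compose[OF measurable_W]) auto
  have Zlim: "AE \<omega> in M. (\<lambda>n. Z n \<omega>) \<longlonglongrightarrow> zeta \<omega>"
    using num_blocks_tendsto[OF k1] unfolding Z_def by eventually_elim (rule LIMSEQ_Suc)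
  have cdfZ: "(\<lambda>n. ?P (Z n) x) \<longlonglongrightarrow> limit_cdf k x" if "x \<ge> 0" for x
    using scaled_num_blocks_cdf_tendsto[OF k that] by (simp add: Z_def)
  define h where "h = (\<lambda>x \<epsilon> z::real. max 0 (min 1 ((x + \<epsilon> - z) / \<epsilon>)))"
  have hm [measurable]: "h x \<epsilon> \<in> borel_measurable borel" for x \<epsilon> unfolding h_def by measurable
  have h01: "0 \<le> h x \<epsilon> z" "h x \<epsilon> z \<le> 1" for x \<epsilon> z by (auto simp: h_def)
  have h1: "h x \<epsilon> z = 1" if "\<epsilon> > 0" "z \<le> x" for x \<epsilon> z
    using that by (simp add: h_def field_simps)
  have h0: "h x \<epsilon> z = 0" if "\<epsilon> > 0" "x + \<epsilon> \<le> z" for x \<epsilon> z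
    using that by (auto simp: h_def field_simps max_def min_def)
  have ih: "integrable M (\<lambda>\<omega>. h x \<epsilon> (X \<omega>))" if [measurable]: "X \<in> borel_measurable M" for x \<epsilon> X
    using h01 by (intro integrable_const_bound[where B = 1]) auto
  have lower: "?P X x \<le> expectation (\<lambda>\<omega>. h x \<epsilon> (X \<omega>))"
      and upper: "expectation (\<lambda>\<omega>. h x \<epsilon> (X \<omega>)) \<le> ?P X (x + \<epsilon>)"
    if e: "\<epsilon> > 0" and [measurable]: "X \<in> borel_measurable M" for x \<epsilon> X
  proof -
    have e1: "expectation (indicator {\<omega> \<in> space M. X \<omega> \<le> y}) = ?P X y" for y
      by (simp add: Int_absorb1)
    have i1: "integrable M (indicator {\<omega> \<in> space M. X \<omega> \<le> y} :: 'a \<Rightarrow> real)" for y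
      by (intro integrable_real_indicator) (auto simp: less_top[symmetric])
    show "?P X x \<le> expectation (\<lambda>\<omega>. h x \<epsilon> (X \<omega>))"
      unfolding e1[symmetric] using h1[OF e] h01
      by (intro integral_mono i1 ih) (auto simp: indicator_def)
    show "expectation (\<lambda>\<omega>. h x \<epsilon> (X \<omega>)) \<le> ?P X (x + \<epsilon>)"
      unfolding e1[symmetric] using h0[OF e] h01
      by (intro integral_mono i1 ih) (auto simp: indicator_def)
  qed
  have Eh: "(\<lambda>n. expectation (\<lambda>\<omega>. h x \<epsilon> (Z n \<omega>))) \<longlonglongrightarrow> expectation (\<lambda>\<omega>. h x \<epsilon> (zeta \<omega>))" if "\<epsilon> > 0" for x \<epsilon>
  proof (rule integral_dominated_convergence[where w = "\<lambda>_. 1"])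
    show "AE \<omega> in M. (\<lambda>n. h x \<epsilon> (Z n \<omega>)) \<longlonglongrightarrow> h x \<epsilon> (zeta \<omega>)"
      using Zlim
    proof eventually_elim
      case (elim \<omega>)
      then show ?case unfolding h_def using that by (intro tendsto_intros) auto
    qed
  qed (use h01 in auto)
  have le1: "limit_cdf k x \<le> ?P zeta (x + \<epsilon>)" if "x \<ge> 0" "\<epsilon> > 0" for x \<epsilon>
  proof -
    have "limit_cdf k x \<le> expectation (\<lambda>\<omega>. h x \<epsilon> (zeta \<omega>))"
      by (rule LIMSEQ_le[OF cdfZ Eh]) (use lower that Zm in auto)
    also have "\<dots> \<le> ?P zeta (x + \<epsilon>)" by (rule upper[OF that(2)]) simp
    finally show ?thesis .
  qed
  have le2: "?P zeta x \<le> limit_cdf k (x + \<epsilon>)" if "x \<ge> 0" "\<epsilon> > 0" for x \<epsilon>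
  proof -
    have "?P zeta x \<le> expectation (\<lambda>\<omega>. h x \<epsilon> (zeta \<omega>))"
      by (rule lower[OF that(2)]) simp
    also have "\<dots> \<le> limit_cdf k (x + \<epsilon>)"
      by (rule LIMSEQ_le[OF Eh cdfZ]) (use upper that Zm in auto)
    finally show ?thesis .
  qed
  have contF: "isCont (limit_cdf k) x" for x by (rule DERIV_isCont[OF limit_cdf_deriv[OF k]])
  have up: "?P zeta x \<le> limit_cdf k x" if "x \<ge> 0" for x
  proof (rule tendsto_lowerbound)
    show "(limit_cdf k \<longlongrightarrow> limit_cdf k x) (at_right x)"
      using contF[of x] unfolding isCont_def by (rule filterlim_mono) (auto intro: at_le)
    show "eventually (\<lambda>y. ?P zeta x \<le> limit_cdf k y) (at_right x)"
      using eventually_at_right_less[of x]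
      by eventually_elim (use le2[OF that, of "y - x" for y] in \<open>metis add.commute diff_add_cancel diff_gt_0_iff_gt\<close>)
  qed simp
  have lo: "limit_cdf k x \<le> ?P zeta x" if "x > 0" for x
  proof (rule tendsto_upperbound)
    show "(limit_cdf k \<longlongrightarrow> limit_cdf k x) (at_left x)"
      using contF[of x] unfolding isCont_def by (rule filterlim_mono) (auto intro: at_le)
    show "eventually (\<lambda>y. limit_cdf k y \<le> ?P zeta x) (at_left x)"
      using eventually_at_left_real[OF that]
    proof eventually_elim
      case (elim y)
      then show ?case using le1[of y "x - y"] by simp
    qed
  qed simp
  \<comment> \<open>Approach from the left is confined to x > 0. At 0 the upper bound alone is
    enough, since \<open>limit_cdf\<close> vanishes there, and negative x follow by
    monotonicity.\<close>
  have z: "?P zeta 0 = 0"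
    using up[of 0] by (simp add: limit_cdf_0 measure_le_0_iff)
  show ?thesis
  proof (cases "x \<ge> 0")
    case True
    then show ?thesis using up[of x] lo[of x] z by (cases "x = 0") (auto simp: limit_cdf_0)
  next
    case False
    have "?P zeta x \<le> ?P zeta 0"
      using False by (intro finite_measure_mono) auto
    then show ?thesis using z False by (simp add: measure_le_0_iff)
  qed
qed

lemma distributed_zeta:
  assumes k: "k \<ge> 2"
  shows "distributed M lborel zeta (\<lambda>x. if 0 < x then ennreal (limit_density k x) else 0)"
proof -
  note [measurable] = borel_measurable_limit_density[OF k]
  have "distributed M lborel zeta (\<lambda>x. ennreal (if 0 < x then limit_density k x else 0))"
  proof (rule distributedI_borel_atMost[where g = "\<lambda>x. if 0 \<le> x then limit_cdf k x else 0"])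
    show "AE x in lborel. 0 \<le> (if 0 < x then limit_density k x else 0)"
      using limit_density_nonneg[OF k] by auto
    fix a :: real
    show "(\<integral>\<^sup>+x. ennreal ((if 0 < x then limit_density k x else 0) * indicator {..a} x) \<partial>lborel) =
        ennreal (if 0 \<le> a then limit_cdf k a else 0)"
    proof (cases "0 \<le> a")
      case True
      have "(\<integral>\<^sup>+x. ennreal ((if 0 < x then limit_density k x else 0) * indicator {..a} x) \<partial>lborel) =
          (\<integral>\<^sup>+x\<in>{0..a}. ennreal (limit_density k x) \<partial>lborel)"
        by (intro nn_integral_cong) (auto simp: indicator_def limit_density_0)
      then show ?thesis using nn_integral_limit_density[OF k True] True by simp
    next
      case False
      have "(\<integral>\<^sup>+x. ennreal ((if 0 < x then limit_density k x else 0) * indicator {..a} x) \<partial>lborel) =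
          (\<integral>\<^sup>+x. 0 \<partial>(lborel :: real measure))"
        using False by (intro nn_integral_cong) (auto simp: indicator_def)
      then show ?thesis using False by simp
    qed
    show "emeasure M {\<omega> \<in> space M. zeta \<omega> \<le> a} = ennreal (if 0 \<le> a then limit_cdf k a else 0)"
      unfolding zeta_cdf[OF k, of a, symmetric] by (rule emeasure_eq_measure)
  qed measurable
  also have "(\<lambda>x. ennreal (if 0 < x then limit_density k x else 0)) = (\<lambda>x. if 0 < x then ennreal (limit_density k x) else 0)"
    by auto
  finally show ?thesis .
qed

text \<open>Powers of x are not integrable on the half line, so termwise integration of the series
  is impossible. The moments are carried over from \<zeta>, whose density is now known.\<close>

lemma limit_density_moments:
  assumes k: "k \<ge> 2"
  shows "(\<integral>\<^sup>+x\<in>{0<..}. ennreal (x ^ r * limit_density k x) \<partial>lborel) = ennreal (block_limit_moment k r)"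
proof -
  have k1: "k \<ge> 1" using k by simp
  have "(\<integral>\<^sup>+x\<in>{0<..}. ennreal (x ^ r * limit_density k x) \<partial>lborel) =
      (\<integral>\<^sup>+x. (if 0 < x then ennreal (limit_density k x) else 0) * ennreal (x ^ r) \<partial>lborel)"
    by (intro nn_integral_cong)
      (auto simp: indicator_def ennreal_mult'[symmetric] limit_density_nonneg[OF k] mult.commute)
  also have "\<dots> = (\<integral>\<^sup>+\<omega>. ennreal (zeta \<omega> ^ r) \<partial>M)"
    by (rule distributed_nn_integral[OF distributed_zeta[OF k]]) simp
  also have "\<dots> = ennreal (block_limit_moment k r)"
    using zeta_moments[OF k1, of r] zeta_nonneg[OF k1]
    by (subst nn_integral_eq_integral) (auto simp: has_bochner_integral_iff elim!: eventually_mono)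
  finally show ?thesis .
qed

lemma zeta_moments_determine:
  assumes k: "k \<ge> 1" and \<nu>: "real_distribution \<nu>"
    and mom: "\<And>r. has_bochner_integral \<nu> (\<lambda>x. x ^ r) (block_limit_moment k r)"
  shows "\<nu> = distr M borel zeta"
proof (rule real_distribution_moments_unique[OF \<nu> real_distribution_distr mom])
  show "has_bochner_integral (distr M borel zeta) (\<lambda>x. x ^ r) (block_limit_moment k r)" for r
    by (intro has_bochner_integral_distr zeta_moments[OF k]) auto
  fix t :: real
  have "(\<lambda>r. t ^ r * block_limit_moment k r / fact r) \<longlonglongrightarrow> 0"
    unfolding block_limit_moment_def by (rule limit_moments_growth[OF k])
  from LIMSEQ_subseq_LIMSEQ[OF this, of "\<lambda>n. 2 * n"]
  show "(\<lambda>n. t ^ (2 * n) * block_limit_moment k (2 * n) / fact (2 * n)) \<longlonglongrightarrow> 0"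
    by (simp add: strict_mono_def o_def)
qed measurable

end

section \<open>Assembly of the statement\<close>

lemma prob_num_blocks:
  assumes k: "k \<ge> 1"
  shows "measure_pmf.prob (pmf_of_set (stirling_perms k n)) {w. num_blocks w = m} = block_prob k n m"
  unfolding block_prob_def block_mean_def
  by (subst measure_pmf_of_set[OF stirling_perms_nonempty[OF k] finite_stirling_perms])
    (simp add: sum_of_bool_eq finite_stirling_perms)

text \<open>Times before \<open>t0\<close> carry no condition on the process, so a representative
  that differs at time 0 can be substituted.\<close>

lemma martingale_from_cong:
  assumes "\<And>n. n \<ge> t0 \<Longrightarrow> X n = Y n"
  shows "martingale_from t0 M F X \<longleftrightarrow> martingale_from t0 M F Y"
  unfolding martingale_from_def using assms by auto

theorem theorem6p1:
  fixes k :: nat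
  assumes "k \<ge> 2"
  shows
    "(\<forall>n m. 1 \<le> m \<and> m \<le> n \<longrightarrow>
        measure_pmf.prob (pmf_of_set (stirling_perms k n)) {w. num_blocks w = m} =
          (\<Sum>l=0..m. real (m choose l) * (- 1) ^ l *
             (((real n - real l / real k - 1) gchoose n) / ((real n + 1 / real k - 1) gchoose n)))) \<and>
     (\<forall>n\<ge>1. \<forall>r\<ge>1.
        measure_pmf.expectation (pmf_of_set (stirling_perms k n))
            (\<lambda>w. real ((num_blocks w + r) choose r)) =
          ((real n - 1 + real (r + 1) / real k) gchoose n) / ((real n - 1 + 1 / real k) gchoose n) \<and>
        ((real n - 1 + real (r + 1) / real k) gchoose n) / ((real n - 1 + 1 / real k) gchoose n) =
          real (r + 1) * (((real n - 1 + real (r + 1) / real k) gchoose (n - 1)) /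
                          ((real n - 1 + 1 / real k) gchoose (n - 1)))) \<and>
     (\<forall>(M :: 'a measure) gap W. stirling_growth M k gap W \<longrightarrow>
        (let S = (\<lambda>n \<omega>. num_blocks (W n \<omega>));
             Smart = (\<lambda>n \<omega>. ((real n - 1 + 1 / real k) gchoose (n - 1)) /
                            ((real n - 1 + 2 / real k) gchoose (n - 1)) * real (S n \<omega> + 1))
         in martingale_from 1 M (generated_filtration M W) Smart \<and>
            (\<forall>n\<ge>1. \<forall>\<omega>\<in>space M. 0 < Smart n \<omega>) \<and>
            (\<exists>zhat \<in> borel_measurable M.
               (AE \<omega> in M. (\<lambda>n. Smart n \<omega>) \<longlonglongrightarrow> zhat \<omega>) \<and>
               (let zeta = (\<lambda>\<omega>. Gamma (1 + 1 / real k) / Gamma (1 + 2 / real k) * zhat \<omega>);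
                    mom = (\<lambda>r::nat. fact (r + 1) * (Gamma (1 + 1 / real k) /
                                                Gamma (1 + real (r + 1) / real k)))
                in (AE \<omega> in M. (\<lambda>n. real n powr (- 1 / real k) * real (S n \<omega>)) \<longlonglongrightarrow> zeta \<omega>) \<and>
                   (\<forall>r. has_bochner_integral M (\<lambda>\<omega>. zeta \<omega> ^ r) (mom r)) \<and>
                   (\<forall>\<nu>. real_distribution \<nu> \<and> (\<forall>r. has_bochner_integral \<nu> (\<lambda>x. x ^ r) (mom r)) \<longrightarrow>
                        \<nu> = distr M borel zeta) \<and>
                   (\<exists>g. positive_stable_density (1 / real k) g \<and>
                      (let f = (\<lambda>x. Gamma (1 / real k) * x powr (- real k) * g (x powr (- real k)))
                       in distributed M lborel zeta (\<lambda>x. if 0 < x then ennreal (f x) else 0) \<and>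
                          (\<forall>x>0. summable (\<lambda>j. (- 1) ^ j * (Gamma (real (Suc j) / real k + 1) *
                                     sin (real (Suc j) * pi / real k) / fact (Suc j)) * x ^ Suc j) \<and>
                             f x = Gamma (1 / real k) / pi *
                               (\<Sum>j. (- 1) ^ j * (Gamma (real (Suc j) / real k + 1) *
                                     sin (real (Suc j) * pi / real k) / fact (Suc j)) * x ^ Suc j))))))))"
proof (intro conjI allI impI, goal_cases)
  have k: "k \<ge> 1" using assms by simp
  show "measure_pmf.prob (pmf_of_set (stirling_perms k n)) {w. num_blocks w = m} =
      (\<Sum>l=0..m. real (m choose l) * (- 1) ^ l *
        (((real n - real l / real k - 1) gchoose n) / ((real n + 1 / real k - 1) gchoose n)))" for n m
    unfolding prob_num_blocks[OF k] block_prob_eq[OF k] block_weight_gbinomial ..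
  show "measure_pmf.expectation (pmf_of_set (stirling_perms k n))
            (\<lambda>w. real ((num_blocks w + r) choose r)) =
          ((real n - 1 + real (r + 1) / real k) gchoose n) / ((real n - 1 + 1 / real k) gchoose n)" for n r
    unfolding expectation_num_blocks[OF k, of n "\<lambda>s. real ((s + r) choose r)"] block_mean_choose[OF k]
      block_moment_gbinomial ..
  show "((real n - 1 + real (r + 1) / real k) gchoose n) / ((real n - 1 + 1 / real k) gchoose n) =
          real (r + 1) * (((real n - 1 + real (r + 1) / real k) gchoose (n - 1)) /
                          ((real n - 1 + 1 / real k) gchoose (n - 1)))" if "n \<ge> 1" for n r
    unfolding block_moment_gbinomial block_moment_gbinomial'[OF k that] ..
next
  case (4 M gap W)
  then interpret stirling_growth M k gap W .
  have k: "k \<ge> 1" using assms by simp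
  \<comment> \<open>The restriction to n \<ge> 1 matters: at n = 0 the quotient is 1, while
    \<open>mart_coeff\<close> is 2.\<close>
  have Smart: "(\<lambda>\<omega>. ((real n - 1 + 1 / real k) gchoose (n - 1)) / ((real n - 1 + 2 / real k) gchoose (n - 1)) *
      real (num_blocks (W n \<omega>) + 1)) = mart n" if "n \<ge> 1" for n
    unfolding mart_coeff_gbinomial[OF k that] mart_def[abs_def] ..
  note Smart_app = fun_cong[OF Smart]
  \<comment> \<open>The moments required for the stable density are supplied by the growth process
    at hand.\<close>
  have stable: "positive_stable_density (1 / real k) (stable_density k)"
    by (rule positive_stable_density_stable_density[OF assms limit_density_moments[OF assms]])
  have dens: "(\<lambda>x. if 0 < x then ennreal (Gamma (1 / real k) * x powr (- real k) * stable_density k (x powr (- real k))) else 0) =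
      (\<lambda>x. if 0 < x then ennreal (limit_density k x) else 0)"
    using stable_density_limit_density[OF assms] by auto
  have mart_lim: "AE \<omega> in M. (\<lambda>n. ((real n - 1 + 1 / real k) gchoose (n - 1)) /
      ((real n - 1 + 2 / real k) gchoose (n - 1)) * real (num_blocks (W n \<omega>) + 1)) \<longlonglongrightarrow> mart_limit \<omega>"
    using mart_tendsto[OF k]
  proof eventually_elim
    case (elim \<omega>)
    have "eventually (\<lambda>n. mart n \<omega> = ((real n - 1 + 1 / real k) gchoose (n - 1)) /
        ((real n - 1 + 2 / real k) gchoose (n - 1)) * real (num_blocks (W n \<omega>) + 1)) sequentially"
      using eventually_ge_at_top[of 1] by eventually_elim (rule Smart_app[symmetric])
    with elim show ?case by (rule Lim_transform_eventually)
  qed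
  show ?case
    unfolding Let_def
  proof (intro bexI[of _ mart_limit] exI[of _ "stable_density k"] conjI allI impI mart_lim,
      unfold zeta_def[symmetric] block_limit_moment_def[symmetric] dens)
    show "martingale_from 1 M (generated_filtration M W) (\<lambda>n \<omega>. ((real n - 1 + 1 / real k) gchoose (n - 1)) /
        ((real n - 1 + 2 / real k) gchoose (n - 1)) * real (num_blocks (W n \<omega>) + 1))"
      using martingale_mart[OF k] by (subst martingale_from_cong[OF Smart])
    show "\<forall>\<omega>\<in>space M. 0 < ((real n - 1 + 1 / real k) gchoose (n - 1)) /
        ((real n - 1 + 2 / real k) gchoose (n - 1)) * real (num_blocks (W n \<omega>) + 1)" if "n \<ge> 1" for n
      using mart_coeff_gbinomial[OF k that] mart_coeff_pos[OF k, of n] by simp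
    show "AE \<omega> in M. (\<lambda>n. real n powr (- 1 / real k) * real (num_blocks (W n \<omega>))) \<longlonglongrightarrow> zeta \<omega>"
      by (rule num_blocks_tendsto[OF k])
    show "has_bochner_integral M (\<lambda>\<omega>. zeta \<omega> ^ r) (block_limit_moment k r)" for r
      by (rule zeta_moments[OF k])
    show "\<nu> = distr M borel (\<lambda>\<omega>. zeta \<omega>)"
      if "real_distribution \<nu> \<and> (\<forall>r. has_bochner_integral \<nu> (\<lambda>x. x ^ r) (block_limit_moment k r))" for \<nu>
      using that by (intro zeta_moments_determine[OF k]) auto
    show "distributed M lborel (\<lambda>\<omega>. zeta \<omega>) (\<lambda>x. if 0 < x then ennreal (limit_density k x) else 0)"
      by (rule distributed_zeta[OF assms])
    fix x :: real assume "0 < x"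
    then show "Gamma (1 / real k) * x powr (- real k) * stable_density k (x powr (- real k)) = Gamma (1 / real k) / pi *
             (\<Sum>j. (- 1) ^ j * (Gamma (real (Suc j) / real k + 1) *
                   sin (real (Suc j) * pi / real k) / fact (Suc j)) * x ^ Suc j)"
      using stable_density_limit_density[OF assms] limit_density_series(2)[OF assms] by simp
  qed (use stable limit_density_series(1)[OF assms] in auto)
qed


end
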